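(* Let $p$ be a natural number and let $\Bbbk$ be a field of characteristic different from $2$. The space $\mathcal{A}_c(p)_{-1}$ of (unrooted) acyclic Jacobi diagram classes is isomorphic to the algebra of words $\mathcal{W}'(p)$, and the free Lie algebra $\mathcal{L}(\underline{p})$ over $\Bbbk$ on $p$ generators is isomorphic to the algebra of words ${}^{l}\mathcal{W}(p)$.
   Context: Let $\underline{p}=\{1,2,\ldots,p\}$. Diagrams. An acyclic Jacobi diagram is a connected acyclic graph whose vertices have valence $1$ or $3$, which is vertex-oriented (a cyclic ordering of the three edges at each trivalent vertex is given), and whose univalent vertices (legs) are labelled by elements of $\underline{p}$. $\mathcal{A}_c(p)_{-1}$ is the space of $\Bbbk$-linear combinations of acyclic Jacobi diagrams modulo the local relations AS and IHX. AS: reversing the cyclic order at one trivalent vertex multiplies the diagram by $-1$. IHX: for three diagrams $I,H,X$ that are identical except near one edge joining two trivalent vertices, where they realise the three ways of joining the same four branches, $I=H+X$; viewing one of the four branches as the root side and calling the others $A,B,C$, this is the Jacobi identity $[[A,B],C]=[A,[B,C]]+[[A,C],B]$, where $[X,Y]$ denotes the tree obtained by joining $X$ and $Y$ at a trivalent vertex with cyclic order ($X$, $Y$, edge towards the root). (The analogous space for diagrams with one leg distinguished as a root is the free Lie algebra $\mathcal{L}(\underline{p})$, AS being antisymmetry and IHX the Jacobi identity.) Words. $ASS(\underline{p})$ is the free associative $\Bbbk$-algebra of words on the $p$ letters of $\underline{p}$, with product given by concatenation; $len(w)$ is the length of a word $w$. The operations below are defined on words and extended by linearity. $\eta(a_1)=a_1$,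 and $\eta(a_1\cdots a_n)=a_n\,\eta(a_1\cdots a_{n-1})-\eta(a_1\cdots a_{n-1})\,a_n$ for $n\ge2$. Fold moves. For a word $w=a_1\cdots a_{len(w)}$ put $h^l_n(w)=(-1)^{n-1}a_n\,\eta(a_1\cdots a_{n-1})\,a_{n+1}\cdots a_{len(w)}$ if $2\le n\le len(w)$, and $h^l_n(w)=w$ otherwise. Put $h'_n(w)=0$ if $len(w)=1$; $h'_n(w)=(-1)^n a_na_{n-1}\cdots a_1$ if $n=len(w)>1$; and $h'_n(w)=h^l_n(w)$ otherwise. Let ${}^{l}H$ be the set of all relations $h^l_n(w)-w=0$ and $H'$ the set of all relations $h'_n(w)-w=0$, for all $n\ge2$ and all $w\in ASS(\underline{p})$. Then ${}^{l}\mathcal{W}(p)$ is the quotient of $ASS(\underline{p})$ by ${}^{l}H$, and $\mathcal{W}'(p)$ is the quotient of $ASS(\underline{p})$ by $H'$. *)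

theory Defs
  imports
    Complex_Main
    "HOL-Library.Poly_Mapping"
    "HOL-Library.Set_Algebras"
    "HOL-Combinatorics.Orbits"
begin

section \<open>Free vector spaces and their quotients\<close>

text \<open>
  The space of finite \<open>'k\<close>-linear combinations of elements of \<open>'a\<close> is the type
  \<open>'a \<Rightarrow>\<^sub>0 'k\<close>; the generator belonging to \<open>a\<close> is \<open>gen a\<close>.
\<close>

abbreviation gen :: "'a \<Rightarrow> 'a \<Rightarrow>\<^sub>0 'k::field"
  where "gen a \<equiv> Poly_Mapping.single a 1"

definition smul :: "'k::field \<Rightarrow> ('a \<Rightarrow>\<^sub>0 'k) \<Rightarrow> 'a \<Rightarrow>\<^sub>0 'k"
  where "smul c x = Poly_Mapping.map (\<lambda>k. c * k) x"

lemma lookup_smul: "Poly_Mapping.lookup (smul c x) a = c * Poly_Mapping.lookup x a"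
  by (simp add: smul_def map.rep_eq when_def)

interpretation pm: vector_space "smul :: 'k::field \<Rightarrow> ('a \<Rightarrow>\<^sub>0 'k) \<Rightarrow> 'a \<Rightarrow>\<^sub>0 'k"
  by unfold_locales
    (rule poly_mapping_eqI, simp add: lookup_smul lookup_add algebra_simps)+

definition free_on :: "'a set \<Rightarrow> ('a \<Rightarrow>\<^sub>0 'k::field) set"
  where "free_on B = {x. Poly_Mapping.keys x \<subseteq> B}"

definition linear_ext :: "('a \<Rightarrow> 'b \<Rightarrow>\<^sub>0 'k::field) \<Rightarrow> ('a \<Rightarrow>\<^sub>0 'k) \<Rightarrow> 'b \<Rightarrow>\<^sub>0 'k"
  where "linear_ext f x = (\<Sum>a\<in>Poly_Mapping.keys x. smul (Poly_Mapping.lookup x a) (f a))"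

definition bilinear_ext ::
  "('a \<Rightarrow> 'a \<Rightarrow> 'a) \<Rightarrow> ('a \<Rightarrow>\<^sub>0 'k::field) \<Rightarrow> ('a \<Rightarrow>\<^sub>0 'k) \<Rightarrow> 'a \<Rightarrow>\<^sub>0 'k"
  where "bilinear_ext f x y = linear_ext (\<lambda>a. linear_ext (\<lambda>b. gen (f a b)) y) x"

text \<open>
  For a subspace \<open>R\<close>, \<open>quot V R\<close> is the set of cosets \<open>x + R\<close> with \<open>x \<in> V\<close>.  If \<open>V\<close> contains
  \<open>R\<close>, it is the vector space \<open>V / R\<close>; otherwise it is the image of \<open>V\<close> in the quotient.
  Addition of cosets is addition of sets.  In the scalar multiplication, \<open>R\<close> is added
  to the image of the coset so that the zero scalar also yields a coset.
\<close>

definition quot :: "('a \<Rightarrow>\<^sub>0 'k::field) set \<Rightarrow> ('a \<Rightarrow>\<^sub>0 'k) set \<Rightarrow> ('a \<Rightarrow>\<^sub>0 'k) set set"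
  where "quot V R = (\<lambda>x. x +o R) ` V"

definition quot_smul :: "('a \<Rightarrow>\<^sub>0 'k::field) set \<Rightarrow> 'k \<Rightarrow> ('a \<Rightarrow>\<^sub>0 'k) set \<Rightarrow> ('a \<Rightarrow>\<^sub>0 'k) set"
  where "quot_smul R c X = smul c ` X + R"

definition quot_linear_iso ::
  "('a \<Rightarrow>\<^sub>0 'k::field) set \<Rightarrow> ('a \<Rightarrow>\<^sub>0 'k) set \<Rightarrow> ('b \<Rightarrow>\<^sub>0 'k) set \<Rightarrow> ('b \<Rightarrow>\<^sub>0 'k) set
    \<Rightarrow> (('a \<Rightarrow>\<^sub>0 'k) set \<Rightarrow> ('b \<Rightarrow>\<^sub>0 'k) set) \<Rightarrow> bool"
  where "quot_linear_iso V R W S \<phi> \<longleftrightarrow>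
    bij_betw \<phi> (quot V R) (quot W S) \<and>
    (\<forall>X\<in>quot V R. \<forall>Y\<in>quot V R. \<phi> (X + Y) = \<phi> X + \<phi> Y) \<and>
    (\<forall>c. \<forall>X\<in>quot V R. \<phi> (quot_smul R c X) = quot_smul S c (\<phi> X))"


section \<open>Acyclic Jacobi diagrams\<close>

text \<open>
  A vertex-oriented graph is given by its half-edges (darts).  The involution \<open>opp\<close> exchanges the
  two halves of an edge, and the permutation \<open>rot\<close> sends a dart to the next one at the same vertex
  in the cyclic order, so that the vertices are the orbits of \<open>rot\<close>.  The label of a univalent
  vertex is the value of \<open>lab\<close> at its only dart; other values of \<open>lab\<close> are irrelevant.
\<close>

record diagram =
  darts :: "nat set"
  opp :: "nat \<Rightarrow> nat"
  rot :: "nat \<Rightarrow> nat"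
  lab :: "nat \<Rightarrow> nat"

definition vertex :: "diagram \<Rightarrow> nat \<Rightarrow> nat set"
  where "vertex D d = orbit (rot D) d"

definition vertices :: "diagram \<Rightarrow> nat set set"
  where "vertices D = vertex D ` darts D"

definition valence :: "diagram \<Rightarrow> nat \<Rightarrow> nat"
  where "valence D d = card (vertex D d)"

definition adjacency :: "diagram \<Rightarrow> (nat set \<times> nat set) set"
  where "adjacency D = {(vertex D d, vertex D (opp D d)) | d. d \<in> darts D}"

definition legs :: "diagram \<Rightarrow> nat set"
  where "legs D = {d \<in> darts D. valence D d = 1}"

definition connected_diagram :: "diagram \<Rightarrow> bool"
  where "connected_diagram D \<longleftrightarrow>
    darts D \<noteq> {} \<and> (\<forall>u\<in>vertices D. \<forall>v\<in>vertices D. (u, v) \<in> (adjacency D)\<^sup>*)"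

text \<open>A cycle traverses distinct edges and visits distinct vertices; loops and double edges count.\<close>

definition is_cycle :: "diagram \<Rightarrow> nat list \<Rightarrow> bool"
  where "is_cycle D ds \<longleftrightarrow>
    ds \<noteq> [] \<and> set ds \<subseteq> darts D \<and>
    (\<forall>i<length ds. vertex D (opp D (ds ! i)) = vertex D (ds ! (Suc i mod length ds))) \<and>
    distinct (map (vertex D) ds) \<and>
    distinct (map (\<lambda>d. {d, opp D d}) ds)"

definition jacobi_diagrams :: "nat \<Rightarrow> diagram set"
  where "jacobi_diagrams p = {D.
    finite (darts D) \<and>
    opp D permutes darts D \<and> (\<forall>d\<in>darts D. opp D d \<noteq> d \<and> opp D (opp D d) = d) \<and>
    rot D permutes darts D \<and> (\<forall>d\<in>darts D. valence D d = 1 \<or> valence D d = 3) \<and>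
    connected_diagram D \<and> (\<nexists>ds. is_cycle D ds) \<and>
    (\<forall>d\<in>legs D. lab D d \<in> {1..p})}"

definition diagram_iso :: "diagram \<Rightarrow> diagram \<Rightarrow> bool"
  where "diagram_iso D D' \<longleftrightarrow> (\<exists>f. bij_betw f (darts D) (darts D') \<and>
    (\<forall>d\<in>darts D. f (opp D d) = opp D' (f d) \<and> f (rot D d) = rot D' (f d)) \<and>
    (\<forall>d\<in>legs D. lab D' (f d) = lab D d))"

definition flip_vertex :: "diagram \<Rightarrow> nat \<Rightarrow> diagram"
  where "flip_vertex D d =
    D\<lparr>rot := (\<lambda>e. if e \<in> vertex D d then inv (rot D) e else rot D e)\<rparr>"

text \<open>
  In an IHX triple, the edge \<open>{e, e'}\<close> of the first diagram joins a trivalent vertex with cyclic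
  order \<open>(a, b, e)\<close> to one with cyclic order \<open>(e', c, r)\<close>.  Here \<open>a\<close>, \<open>b\<close>, \<open>c\<close> are the darts
  leading to the branches A, B, C, and \<open>r\<close> is the dart leading to the root side, so that the
  diagram is [[A,B],C].  The other two diagrams regroup the same six darts as [A,[B,C]] and
  [[A,C],B].
\<close>

definition cyc3 :: "(nat \<Rightarrow> nat) \<Rightarrow> nat \<Rightarrow> nat \<Rightarrow> nat \<Rightarrow> nat \<Rightarrow> nat"
  where "cyc3 f x y z = f(x := y, y := z, z := x)"

definition ihx_triple :: "diagram \<Rightarrow> diagram \<Rightarrow> diagram \<Rightarrow> bool"
  where "ihx_triple DI DH DX \<longleftrightarrow> (\<exists>e\<in>darts DI.
    valence DI e = 3 \<and> valence DI (opp DI e) = 3 \<and>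
    (let e' = opp DI e;
         a = rot DI e; b = rot DI a;
         c = rot DI e'; r = rot DI c
     in DH = DI\<lparr>rot := cyc3 (cyc3 (rot DI) b c e) a e' r\<rparr> \<and>
        DX = DI\<lparr>rot := cyc3 (cyc3 (rot DI) a c e) e' b r\<rparr>))"

text \<open>Diagrams are considered up to isomorphism, so isomorphic ones are identified as well.\<close>

definition diagram_relations :: "nat \<Rightarrow> (diagram \<Rightarrow>\<^sub>0 'k::field) set"
  where "diagram_relations p = pm.span (
    {gen D - gen D' | D D'.
       D \<in> jacobi_diagrams p \<and> D' \<in> jacobi_diagrams p \<and> diagram_iso D D'} \<union>
    {gen (flip_vertex D d) + gen D | D d.
       D \<in> jacobi_diagrams p \<and> d \<in> darts D \<and> valence D d = 3} \<union>
    {gen DI - (gen DH + gen DX) | DI DH DX.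
       DI \<in> jacobi_diagrams p \<and> DH \<in> jacobi_diagrams p \<and> DX \<in> jacobi_diagrams p \<and>
       ihx_triple DI DH DX})"


section \<open>The free Lie algebra\<close>

text \<open>
  The free Lie algebra is the quotient of the free non-associative algebra (with basis the
  bracketed monomials) by the ideal generated by all \<open>[x,x]\<close> and all Jacobi expressions.
\<close>

datatype (atoms: 'a) monomial = Atom 'a | Br "'a monomial" "'a monomial"

fun degree_mono :: "'a monomial \<Rightarrow> nat"
  where
    "degree_mono (Atom a) = 1"
  | "degree_mono (Br s t) = degree_mono s + degree_mono t"

definition monomials :: "nat \<Rightarrow> nat monomial set"
  where "monomials p = {t. atoms t \<subseteq> {1..p}}"

abbreviation brk :: "('a monomial \<Rightarrow>\<^sub>0 'k::field) \<Rightarrow> ('a monomial \<Rightarrow>\<^sub>0 'k) \<Rightarrow> 'a monomial \<Rightarrow>\<^sub>0 'k"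
  where "brk \<equiv> bilinear_ext Br"

inductive_set lie_ideal :: "nat \<Rightarrow> (nat monomial \<Rightarrow>\<^sub>0 'k::field) set" for p :: nat
  where
    alternating: "x \<in> free_on (monomials p) \<Longrightarrow> brk x x \<in> lie_ideal p"
  | jacobi: "\<lbrakk>x \<in> free_on (monomials p); y \<in> free_on (monomials p); z \<in> free_on (monomials p)\<rbrakk>
      \<Longrightarrow> brk x (brk y z) + brk y (brk z x) + brk z (brk x y) \<in> lie_ideal p"
  | add: "\<lbrakk>u \<in> lie_ideal p; v \<in> lie_ideal p\<rbrakk> \<Longrightarrow> u + v \<in> lie_ideal p"
  | scale: "u \<in> lie_ideal p \<Longrightarrow> smul c u \<in> lie_ideal p"
  | bracket_left: "\<lbrakk>u \<in> lie_ideal p; x \<in> free_on (monomials p)\<rbrakk> \<Longrightarrow> brk x u \<in> lie_ideal p"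
  | bracket_right: "\<lbrakk>u \<in> lie_ideal p; x \<in> free_on (monomials p)\<rbrakk> \<Longrightarrow> brk u x \<in> lie_ideal p"


section \<open>Words and fold moves\<close>

text \<open>
  Words are non-empty: the algebra of words has no unit.  With the empty word included, both
  quotients would have an additional dimension in length 0.
\<close>

definition words :: "nat \<Rightarrow> nat list set"
  where "words p = {w. w \<noteq> [] \<and> set w \<subseteq> {1..p}}"

abbreviation ASS :: "nat \<Rightarrow> (nat list \<Rightarrow>\<^sub>0 'k::field) set"
  where "ASS p \<equiv> free_on (words p)"

abbreviation conc :: "('a list \<Rightarrow>\<^sub>0 'k::field) \<Rightarrow> ('a list \<Rightarrow>\<^sub>0 'k) \<Rightarrow> 'a list \<Rightarrow>\<^sub>0 'k" (infixl "\<odot>" 70)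
  where "x \<odot> y \<equiv> bilinear_ext (@) x y"

text \<open>
  The recursion for \<open>\<eta>\<close> removes the last letter of the word, hence the detour via \<open>rev\<close>.
  The value of \<open>eta\<close> at the empty word plays no role.
\<close>

fun eta_rev :: "'a list \<Rightarrow> 'a list \<Rightarrow>\<^sub>0 'k::field"
  where
    "eta_rev [] = 0"
  | "eta_rev [a] = gen [a]"
  | "eta_rev (a # b # u) = gen [a] \<odot> eta_rev (b # u) - eta_rev (b # u) \<odot> gen [a]"

definition eta :: "'a list \<Rightarrow> 'a list \<Rightarrow>\<^sub>0 'k::field"
  where "eta w = eta_rev (rev w)"

lemma eta_single: "eta [a] = gen [a]"
  by (simp add: eta_def)

lemma eta_snoc: "w \<noteq> [] \<Longrightarrow> eta (w @ [a]) = gen [a] \<odot> eta w - eta w \<odot> gen [a]"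
  by (cases w rule: rev_cases) (simp_all add: eta_def)

text \<open>
  Lists are indexed from 0: the letter \<open>a\<^sub>n\<close> of \<open>w\<close> is \<open>w ! (n - 1)\<close>.  For \<open>n = length w\<close> the last
  factor is \<open>gen []\<close>, which is neutral for \<open>\<odot>\<close>.
\<close>

definition fold_l :: "nat \<Rightarrow> nat list \<Rightarrow> nat list \<Rightarrow>\<^sub>0 'k::field"
  where "fold_l n w =
    (if 2 \<le> n \<and> n \<le> length w
     then smul ((- 1) ^ (n - 1)) (gen [w ! (n - 1)] \<odot> eta (take (n - 1) w) \<odot> gen (drop n w))
     else gen w)"

definition fold' :: "nat \<Rightarrow> nat list \<Rightarrow> nat list \<Rightarrow>\<^sub>0 'k::field"
  where "fold' n w =
    (if length w = 1 then 0
     else if n = length w \<and> length w > 1 then smul ((- 1) ^ n) (gen (rev w))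
     else fold_l n w)"

text \<open>
  The fold moves are compatible with right but not with left concatenation, and the quotients
  are quotients of vector spaces: the relations generate a subspace, not a two-sided ideal.
\<close>

definition H_l :: "nat \<Rightarrow> (nat list \<Rightarrow>\<^sub>0 'k::field) set"
  where "H_l p = pm.span {linear_ext (fold_l n) x - x | n x. 2 \<le> n \<and> x \<in> ASS p}"

definition H' :: "nat \<Rightarrow> (nat list \<Rightarrow>\<^sub>0 'k::field) set"
  where "H' p = pm.span {linear_ext (fold' n) x - x | n x. 2 \<le> n \<and> x \<in> ASS p}"

end

(*  Reading a rooted tree off as a sum of words in which bracketing with t is right multiplication
    by the commutator polynomial of t is well defined modulo the fold moves, and inverse to sending
    a word to its left-normed bracket.  This gives the free Lie algebra.

    An edge of a diagram cuts it into two rooted trees s and t, and the diagram corresponds to the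
    product of the word of s with the reversed word of t (up to sign).  Moving the edge across a
    vertex, or turning it around, does not change this product modulo H': the former is the Jacobi
    identity, the latter is the move that reverses a whole word.  Conversely, a diagram is determined
    by the two trees at any of its edges, so a word gives the caterpillar diagram whose branches at
    the last edge are the left-normed bracket and the last letter.
*)
theory Submission
  imports Defs "HOL-Library.Countable"
begin

text \<open>The sign of a fold and the sign of \<open>eta\<close> combine so that the generators of
  \<open>H_l\<close> read \<open>a P(u) v + u a v\<close>, with \<open>P(u)\<close> the commutator
  polynomial of the left-normed bracket of \<open>u\<close>. In the Lie algebra this is
  \<open>[a, u] + [u, a]\<close>, acted on by \<open>v\<close>: antisymmetry against one letter. The
  crux is to extend it to two arbitrary words (\<open>dynkin_antisym\<close>), from which Jacobi
  follows as well. The relations \<open>[x, x]\<close> need a division by 2, the one place where the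
  characteristic enters. As \<open>H_l\<close> is stable under right multiplication only, the
  leftmost factor carries the class, and everything to its right enters through commutator
  polynomials, where Lie relations hold exactly. Reversal with sign is the antipode of the free
  associative algebra; it is -1 on Lie polynomials, and so moving an edge across a vertex is an
  exact cancellation up to antisymmetry. For diagrams the obstacle is that acyclicity speaks of
  cycles while words need recursion. Non-backtracking walks link the two: they never return to a
  vertex in a tree, and conversely a graph whose two sides at one edge can be read off as finite
  trees has no cycle.\<close>

section \<open>Linear and bilinear extensions\<close>

abbreviation lin :: "(('a \<Rightarrow>\<^sub>0 'k::field) \<Rightarrow> 'b \<Rightarrow>\<^sub>0 'k) \<Rightarrow> bool"
  where "lin \<equiv> Vector_Spaces.linear smul smul"

lemma linI:
  assumes "\<And>x y. F (x + y) = F x + F y" "\<And>c x. F (smul c x) = smul c (F x)"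
  shows "lin F"
  unfolding Vector_Spaces.linear_def module_hom_def module_hom_axioms_def
  by (intro conjI allI assms pm.vector_space_axioms pm.module_axioms)

lemma
  assumes "lin F"
  shows lin_add: "F (x + y) = F x + F y" and lin_scale: "F (smul c x) = smul c (F x)"
    and lin_0: "F 0 = 0" and lin_neg: "F (- x) = - F x" and lin_diff: "F (x - y) = F x - F y"
proof -
  interpret l: Vector_Spaces.linear smul smul F by (rule assms)
  show "F (x + y) = F x + F y" "F (smul c x) = smul c (F x)" "F 0 = 0" "F (- x) = - F x" "F (x - y) = F x - F y"
    by (simp_all add: l.add l.scale l.zero l.neg l.diff)
qed

lemma lin_zero_map: "lin (\<lambda>x. 0)" by (rule linI) auto
lemma lin_id: "lin (\<lambda>x. x)" by (rule linI) auto
lemma lin_plus_map: "lin F \<Longrightarrow> lin G \<Longrightarrow> lin (\<lambda>x. F x + G x)"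
  by (rule linI) (auto simp: lin_add lin_scale pm.scale_right_distrib)
lemma lin_minus_map: "lin F \<Longrightarrow> lin G \<Longrightarrow> lin (\<lambda>x. F x - G x)"
  by (rule linI) (auto simp: lin_add lin_scale pm.scale_right_diff_distrib)
lemma lin_uminus_map: "lin F \<Longrightarrow> lin (\<lambda>x. - F x)"
  by (rule linI) (auto simp: lin_add lin_scale)
lemma lin_comp: "lin G \<Longrightarrow> lin F \<Longrightarrow> lin (\<lambda>x. G (F x))"
  by (rule linI) (auto simp: lin_add lin_scale)

lemma linear_ext_superset:
  assumes "finite A" "Poly_Mapping.keys x \<subseteq> A"
  shows "linear_ext f x = (\<Sum>a\<in>A. smul (Poly_Mapping.lookup x a) (f a))"
  unfolding linear_ext_def using assms
  by (intro sum.mono_neutral_left) (auto simp: in_keys_iff)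

lemma lin_linear_ext:
  fixes f :: "'a \<Rightarrow> 'b \<Rightarrow>\<^sub>0 'k::field"
  shows "lin (linear_ext f)"
proof (rule linI)
  fix x y :: "'a \<Rightarrow>\<^sub>0 'k" and c :: 'k
  let ?A = "Poly_Mapping.keys x \<union> Poly_Mapping.keys y"
  have "Poly_Mapping.keys (x + y) \<subseteq> ?A" "Poly_Mapping.keys (smul c x) \<subseteq> ?A"
    using Poly_Mapping.keys_add[of x y] by (auto simp: in_keys_iff lookup_smul)
  then show "linear_ext f (x + y) = linear_ext f x + linear_ext f y"
    "linear_ext f (smul c x) = smul c (linear_ext f x)"
    by (simp_all add: linear_ext_superset[of ?A] lookup_add lookup_smul pm.scale_left_distrib
        sum.distrib pm.scale_sum_right)
qed

lemma linear_ext_gen [simp]: "linear_ext f (gen a) = f a"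
  by (simp add: linear_ext_def)

lemma lin_linear_ext_fun: "(\<And>a. lin (\<lambda>y. f a y)) \<Longrightarrow> lin (\<lambda>y. linear_ext (\<lambda>a. f a y) x)"
proof (rule linI)
  fix y z c assume l: "\<And>a. lin (\<lambda>y. f a y)"
  show "linear_ext (\<lambda>a. f a (y + z)) x = linear_ext (\<lambda>a. f a y) x + linear_ext (\<lambda>a. f a z) x"
    "linear_ext (\<lambda>a. f a (smul c y)) x = smul c (linear_ext (\<lambda>a. f a y) x)"
    unfolding linear_ext_def lin_add[OF l] lin_scale[OF l]
    by (simp_all add: pm.scale_right_distrib sum.distrib pm.scale_sum_right mult.commute)
qed

lemma lin_linear_ext_comp: "lin F \<Longrightarrow> lin (\<lambda>x. linear_ext f (F x))"
  by (rule lin_comp[OF lin_linear_ext])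

lemma lin_bilinear_ext_left: "lin F \<Longrightarrow> lin (\<lambda>x. bilinear_ext f (F x) y)"
  unfolding bilinear_ext_def by (rule lin_linear_ext_comp)

lemma lin_bilinear_ext_right: "lin F \<Longrightarrow> lin (\<lambda>y. bilinear_ext f x (F y))"
  unfolding bilinear_ext_def by (intro lin_linear_ext_fun lin_linear_ext_comp)

lemma lin_smul_map: "lin F \<Longrightarrow> lin (\<lambda>x. smul c (F x))"
  by (rule linI) (auto simp: lin_add lin_scale pm.scale_right_distrib mult.commute)

lemmas lin_intros = lin_zero_map lin_id lin_plus_map lin_minus_map lin_uminus_map lin_smul_map
  lin_bilinear_ext_left lin_bilinear_ext_right lin_linear_ext_comp lin_linear_ext

lemma bilinear_ext_gen [simp]: "bilinear_ext f (gen a) (gen b) = gen (f a b)"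
  by (simp add: bilinear_ext_def)

lemmas bilinear_ext_simps =
  lin_add[OF lin_bilinear_ext_left[OF lin_id]] lin_add[OF lin_bilinear_ext_right[OF lin_id]]
  lin_diff[OF lin_bilinear_ext_left[OF lin_id]] lin_diff[OF lin_bilinear_ext_right[OF lin_id]]
  lin_neg[OF lin_bilinear_ext_left[OF lin_id]] lin_neg[OF lin_bilinear_ext_right[OF lin_id]]
  lin_0[OF lin_bilinear_ext_left[OF lin_id]] lin_0[OF lin_bilinear_ext_right[OF lin_id]]
  lin_scale[OF lin_bilinear_ext_left[OF lin_id]] lin_scale[OF lin_bilinear_ext_right[OF lin_id]]

lemmas linear_ext_simps =
  lin_add[OF lin_linear_ext] lin_diff[OF lin_linear_ext] lin_neg[OF lin_linear_ext]
  lin_0[OF lin_linear_ext] lin_scale[OF lin_linear_ext]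

lemma subspace_free_on: "pm.subspace (free_on B)"
  unfolding pm.subspace_def free_on_def
  by (auto simp: in_keys_iff lookup_add lookup_smul subset_eq)

lemma gen_in_free_on [simp]: "gen a \<in> (free_on B :: ('a \<Rightarrow>\<^sub>0 'k::field) set) \<longleftrightarrow> a \<in> B"
  by (simp add: free_on_def)

lemma free_on_mono: "A \<subseteq> B \<Longrightarrow> free_on A \<subseteq> free_on B"
  by (auto simp: free_on_def)

lemma free_on_UNIV: "x \<in> free_on UNIV"
  by (simp add: free_on_def)

lemma expand_gen: "x = (\<Sum>a\<in>Poly_Mapping.keys x. smul (Poly_Mapping.lookup x a) (gen a))"
proof (rule poly_mapping_eqI)
  fix b
  have "(\<Sum>a\<in>Poly_Mapping.keys x. Poly_Mapping.lookup x a * Poly_Mapping.lookup (gen a) b)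
    = (\<Sum>a\<in>Poly_Mapping.keys x. if a = b then Poly_Mapping.lookup x b else 0)"
    by (intro sum.cong) (auto simp: lookup_single)
  then show "Poly_Mapping.lookup x b
    = Poly_Mapping.lookup (\<Sum>a\<in>Poly_Mapping.keys x. smul (Poly_Mapping.lookup x a) (gen a)) b"
    by (simp add: lookup_sum lookup_smul in_keys_iff)
qed

lemma free_on_eq_span: "(free_on B :: ('a \<Rightarrow>\<^sub>0 'k::field) set) = pm.span (gen ` B)"
proof (intro subset_antisym subsetI)
  fix x :: "'a \<Rightarrow>\<^sub>0 'k" assume "x \<in> free_on B"
  then show "x \<in> pm.span (gen ` B)"
    by (subst expand_gen, intro pm.span_sum pm.span_scale pm.span_base)
      (auto simp: free_on_def)
next
  fix x :: "'a \<Rightarrow>\<^sub>0 'k" assume "x \<in> pm.span (gen ` B)"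
  moreover have "pm.span (gen ` B) \<subseteq> (free_on B :: ('a \<Rightarrow>\<^sub>0 'k) set)"
    by (rule pm.span_minimal) (auto simp: subspace_free_on)
  ultimately show "x \<in> free_on B" by blast
qed

lemma lin_span_into_subspace:
  assumes "lin F" "pm.subspace S" "\<And>a. a \<in> B \<Longrightarrow> F a \<in> S" "x \<in> pm.span B"
  shows "F x \<in> S"
  using assms(4)
proof (induction rule: pm.span_induct_alt)
  case base then show ?case using assms by (simp add: lin_0 pm.subspace_0)
next
  case (step c a y)
  then show ?case using assms by (simp add: lin_add lin_scale pm.subspace_add pm.subspace_scale)
qed

text \<open>The tool by which relations are transported. With \<open>S = {0}\<close> it proves
  equality of linear maps on \<open>free_on B\<close> only, as required by identities that fail for
  the empty word.\<close>

lemma lin_into_subspace: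
  assumes "lin F" "pm.subspace S" "\<And>a. a \<in> B \<Longrightarrow> F (gen a) \<in> S" "x \<in> free_on B"
  shows "F x \<in> S"
  using lin_span_into_subspace[OF assms(1,2), of "gen ` B" x] assms(3,4)
  by (auto simp: free_on_eq_span)

lemma lin_eqI:
  assumes "lin F" "lin G" "\<And>a. F (gen a) = G (gen a)"
  shows "F x = G x"
  using lin_into_subspace[OF lin_minus_map[OF assms(1,2)], of "{0}" UNIV x] assms(3)
  by (simp add: free_on_UNIV pm.subspace_single_0)

lemma linear_ext_in_free_on:
  assumes "\<And>a. a \<in> A \<Longrightarrow> f a \<in> free_on B" "x \<in> free_on A"
  shows "linear_ext f x \<in> free_on B"
  by (rule lin_into_subspace[OF lin_linear_ext subspace_free_on _ assms(2)]) (simp add: assms(1))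

lemma bilinear_ext_in_free_on:
  assumes "\<And>a b. a \<in> A \<Longrightarrow> b \<in> B \<Longrightarrow> f a b \<in> C" "x \<in> free_on A" "y \<in> free_on B"
  shows "bilinear_ext f x y \<in> free_on C"
  unfolding bilinear_ext_def using assms by (intro linear_ext_in_free_on) auto

lemma conc_assoc: "(x \<odot> y) \<odot> z = x \<odot> (y \<odot> z)"
proof -
  have "(gen a \<odot> gen b) \<odot> z = gen a \<odot> (gen b \<odot> z)" for a b :: "'a list" and z :: "'a list \<Rightarrow>\<^sub>0 'k::field"
    by (rule lin_eqI[of "\<lambda>z. (gen a \<odot> gen b) \<odot> z" "\<lambda>z. gen a \<odot> (gen b \<odot> z)"]) (intro lin_intros | simp)+
  then have "(gen a \<odot> y) \<odot> z = gen a \<odot> (y \<odot> z)" for a :: "'a list" and y z :: "'a list \<Rightarrow>\<^sub>0 'k::field"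
    by (intro lin_eqI[of "\<lambda>y. (gen a \<odot> y) \<odot> z" "\<lambda>y. gen a \<odot> (y \<odot> z)" y]) (intro lin_intros | simp)+
  then show ?thesis
    by (intro lin_eqI[of "\<lambda>x. (x \<odot> y) \<odot> z" "\<lambda>x. x \<odot> (y \<odot> z)" x]) (intro lin_intros | simp)+
qed

lemma conc_Nil [simp]: "gen [] \<odot> x = x" "x \<odot> gen [] = x"
  by (rule lin_eqI[of "\<lambda>x. gen [] \<odot> x" "\<lambda>x. x"], (intro lin_intros | simp)+)
    (rule lin_eqI[of "\<lambda>x. x \<odot> gen []" "\<lambda>x. x"], (intro lin_intros | simp)+)

lemma linear_ext_bilinear_ext:
  assumes "\<And>a b. g (f a b) = bilinear_ext h (k a) (l b)"
  shows "linear_ext g (bilinear_ext f x y) = bilinear_ext h (linear_ext k x) (linear_ext l y)"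
proof -
  have "linear_ext g (bilinear_ext f (gen a) y) = bilinear_ext h (linear_ext k (gen a)) (linear_ext l y)" for a
    by (rule lin_eqI[of "\<lambda>y. linear_ext g (bilinear_ext f (gen a) y)"
          "\<lambda>y. bilinear_ext h (linear_ext k (gen a)) (linear_ext l y)"]) (intro lin_intros | simp add: assms)+
  then show ?thesis
    by (intro lin_eqI[of "\<lambda>x. linear_ext g (bilinear_ext f x y)"
          "\<lambda>x. bilinear_ext h (linear_ext k x) (linear_ext l y)" x]) (intro lin_intros | simp)+
qed

section \<open>Isomorphisms of quotients\<close>

lemma subspace_elt_set_plus:
  assumes "pm.subspace S"
  shows "x +o S = y +o S \<longleftrightarrow> x - y \<in> S"
proof
  assume "x +o S = y +o S"
  moreover have "x \<in> x +o S" using pm.subspace_0[OF assms] by (force simp: elt_set_plus_def)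
  ultimately show "x - y \<in> S" by (auto simp: elt_set_plus_def)
next
  assume d: "x - y \<in> S"
  have "a +o S \<subseteq> b +o S" if "a - b \<in> S" for a b
  proof
    fix z assume "z \<in> a +o S"
    then obtain s where "s \<in> S" "z = b + ((a - b) + s)" by (auto simp: elt_set_plus_def)
    then show "z \<in> b +o S" using pm.subspace_add[OF assms that] unfolding elt_set_plus_def by blast
  qed
  from this[OF d] this[of y x] show "x +o S = y +o S"
    using pm.subspace_neg[OF assms d] by simp
qed

lemma coset_plus_coset:
  assumes "pm.subspace S"
  shows "(x +o S) + (y +o S) = (x + y) +o S"
proof (intro set_eqI iffI)
  fix z assume "z \<in> (x +o S) + (y +o S)"
  then obtain s t where "s \<in> S" "t \<in> S" "z = (x + y) + (s + t)"
    by (auto simp: elt_set_plus_def set_plus_def algebra_simps)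
  then show "z \<in> (x + y) +o S" using assms by (auto simp: elt_set_plus_def pm.subspace_add)
next
  fix z assume "z \<in> (x + y) +o S"
  then obtain s where "s \<in> S" "z = (x + s) + (y + 0)" by (auto simp: elt_set_plus_def algebra_simps)
  then show "z \<in> (x +o S) + (y +o S)"
    unfolding elt_set_plus_def set_plus_def using pm.subspace_0[OF assms] by blast
qed

text \<open>\<open>F\<close> may send a coset to a proper part of a coset; adding \<open>S\<close>
  fills it up. With \<open>F = smul c\<close> the same fact describes \<open>quot_smul\<close>,
  including \<open>c = 0\<close>.\<close>

lemma image_coset:
  assumes "lin F" "pm.subspace R" "pm.subspace S" "F ` R \<subseteq> S"
  shows "F ` (x +o R) + S = F x +o S"
proof (intro set_eqI iffI)
  fix z assume "z \<in> F ` (x +o R) + S"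
  then obtain r s where "r \<in> R" "s \<in> S" "z = F x + (F r + s)"
    by (auto simp: elt_set_plus_def set_plus_def lin_add[OF assms(1)] algebra_simps)
  then show "z \<in> F x +o S" using assms(3,4) by (auto simp: elt_set_plus_def pm.subspace_add image_subset_iff)
next
  fix z assume "z \<in> F x +o S"
  then obtain s where "s \<in> S" "z = F (x + 0) + s" by (auto simp: elt_set_plus_def)
  then show "z \<in> F ` (x +o R) + S"
    unfolding elt_set_plus_def set_plus_def using pm.subspace_0[OF assms(2)] by blast
qed

lemma lin_smul: "lin (smul c)"
  by (intro lin_smul_map lin_id)

lemma quot_smul_coset:
  assumes "pm.subspace S"
  shows "quot_smul S c (x +o S) = smul c x +o S"
  unfolding quot_smul_def using assms
  by (intro image_coset lin_smul) (auto intro: pm.subspace_scale)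

text \<open>Linear maps in both directions that respect the relations and are mutually inverse
  modulo them induce the isomorphism. The second conclusion serves the grading: the induced map
  matches the images of any subsets that \<open>F\<close> and \<open>G\<close> exchange.\<close>

lemma quot_linear_isoI:
  assumes F: "lin F" "F ` V \<subseteq> W" "F ` R \<subseteq> S" and G: "lin G" "G ` W \<subseteq> V" "G ` S \<subseteq> R"
    and sub: "pm.subspace V" "pm.subspace W" "pm.subspace R" "pm.subspace S"
    and GF: "\<And>x. x \<in> V \<Longrightarrow> G (F x) - x \<in> R" and FG: "\<And>y. y \<in> W \<Longrightarrow> F (G y) - y \<in> S"
  shows "quot_linear_iso V R W S (\<lambda>X. F ` X + S)"
    and "\<And>V' W'. V' \<subseteq> V \<Longrightarrow> W' \<subseteq> W \<Longrightarrow> F ` V' \<subseteq> W' \<Longrightarrow> G ` W' \<subseteq> V' \<Longrightarrow>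
      (\<lambda>X. F ` X + S) ` quot V' R = quot W' S"
proof -
  have im: "F ` (x +o R) + S = F x +o S" for x
    using image_coset F(1) sub(3,4) F(3) by blast
  show *: "(\<lambda>X. F ` X + S) ` quot V' R = quot W' S"
    if "V' \<subseteq> V" "W' \<subseteq> W" "F ` V' \<subseteq> W'" "G ` W' \<subseteq> V'" for V' W'
  proof -
    have "y +o S \<in> (\<lambda>x. F x +o S) ` V'" if "y \<in> W'" for y
    proof -
      have "F (G y) +o S = y +o S"
        using FG \<open>W' \<subseteq> W\<close> that by (auto simp: subspace_elt_set_plus[OF sub(4)])
      then show ?thesis using \<open>G ` W' \<subseteq> V'\<close> that by blast
    qed
    then show ?thesis using that(3) by (auto simp: quot_def image_image im)
  qed
  have "inj_on (\<lambda>X. F ` X + S) (quot V R)"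
  proof (rule inj_onI)
    fix X Y assume XY: "X \<in> quot V R" "Y \<in> quot V R" and eq: "F ` X + S = F ` Y + S"
    then obtain x y where xy: "x \<in> V" "y \<in> V" "X = x +o R" "Y = y +o R" by (auto simp: quot_def)
    with eq have "F x - F y \<in> S" by (simp add: im subspace_elt_set_plus[OF sub(4)])
    then have 1: "G (F (x - y)) \<in> R" using G(3) by (auto simp: lin_diff[OF F(1)])
    have "G (F (x - y)) - (x - y) \<in> R" using GF xy sub(1) by (simp add: pm.subspace_diff)
    from pm.subspace_diff[OF sub(3) 1 this] have "x - y \<in> R" by simp
    then show "X = Y" by (simp add: xy subspace_elt_set_plus[OF sub(3)])
  qed
  then show "quot_linear_iso V R W S (\<lambda>X. F ` X + S)"
    unfolding quot_linear_iso_def bij_betw_def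
    using *[of V W] F(2) G(2)
    by (auto simp: quot_def im coset_plus_coset quot_smul_coset sub lin_add[OF F(1)] lin_scale[OF F(1)])
qed

section \<open>The free Lie algebra and left-normed words\<close>

fun commutator :: "'a monomial \<Rightarrow> 'a list \<Rightarrow>\<^sub>0 'k::field"
  where
    "commutator (Atom a) = gen [a]"
  | "commutator (Br s t) = commutator s \<odot> commutator t - commutator t \<odot> commutator s"

text \<open>
  A word stands for its left-normed bracket; by the Jacobi identity, bracketing with \<open>t\<close> on the
  right is right multiplication by the commutator polynomial of \<open>t\<close>.
\<close>

fun unbracket :: "'a monomial \<Rightarrow> 'a list \<Rightarrow>\<^sub>0 'k::field"
  where
    "unbracket (Atom a) = gen [a]"
  | "unbracket (Br s t) = unbracket s \<odot> commutator t"

fun comb_rev :: "'a list \<Rightarrow> 'a monomial"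
  where
    "comb_rev [] = undefined"
  | "comb_rev [a] = Atom a"
  | "comb_rev (a # b # u) = Br (comb_rev (b # u)) (Atom a)"

definition comb :: "'a list \<Rightarrow> 'a monomial"
  where "comb w = comb_rev (rev w)"

lemma comb_single [simp]: "comb [a] = Atom a"
  by (simp add: comb_def)

lemma comb_snoc [simp]: "w \<noteq> [] \<Longrightarrow> comb (w @ [a]) = Br (comb w) (Atom a)"
  by (cases w rule: rev_cases) (simp_all add: comb_def)

abbreviation "commutator_lin \<equiv> linear_ext commutator"
abbreviation "unbracket_lin \<equiv> linear_ext unbracket"
abbreviation comb_lin :: "('a list \<Rightarrow>\<^sub>0 'k::field) \<Rightarrow> 'a monomial \<Rightarrow>\<^sub>0 'k"
  where "comb_lin \<equiv> linear_ext (\<lambda>w. gen (comb w))"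

text \<open>The Dynkin operator, which replaces a word by its iterated commutator from the
  left.\<close>

abbreviation dynkin :: "('a list \<Rightarrow>\<^sub>0 'k::field) \<Rightarrow> 'a list \<Rightarrow>\<^sub>0 'k"
  where "dynkin \<equiv> linear_ext (\<lambda>w. commutator (comb w))"

lemma nonempty_snoc_induct [consumes 1, case_names single snoc]:
  assumes "w \<noteq> []" "\<And>a. P [a]" "\<And>u a. u \<noteq> [] \<Longrightarrow> P u \<Longrightarrow> P (u @ [a])"
  shows "P w"
  using assms(1)
proof (induction w rule: rev_induct)
  case (snoc a u) then show ?case using assms(2,3) by (cases "u = []") auto
qed simp

text \<open>\<open>eta\<close> brackets with the new letter on the left, \<open>comb\<close> with
  the new letter on the right, so each letter after the first contributes a factor -1.\<close>

lemma eta_eq_commutator_comb: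
  "w \<noteq> [] \<Longrightarrow> eta w = smul ((- 1) ^ (length w - 1)) (commutator (comb w))"
proof (induction w rule: nonempty_snoc_induct)
  case (single a) then show ?case by (simp add: eta_single)
next
  case (snoc u a)
  then obtain n where "length u = Suc n" by (cases u) auto
  with snoc show ?case
    by (simp add: eta_snoc bilinear_ext_simps flip: pm.scale_right_diff_distrib)
      (simp flip: pm.scale_minus_right)
qed

lemma commutator_lin_brk:
  "commutator_lin (brk x y) = commutator_lin x \<odot> commutator_lin y - commutator_lin y \<odot> commutator_lin x"
proof -
  have "commutator_lin (brk (gen s) y) = commutator_lin (gen s) \<odot> commutator_lin y - commutator_lin y \<odot> commutator_lin (gen s)" for s
    by (rule lin_eqI[of "\<lambda>y. commutator_lin (brk (gen s) y)"
          "\<lambda>y. commutator_lin (gen s) \<odot> commutator_lin y - commutator_lin y \<odot> commutator_lin (gen s)" y])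
      (intro lin_intros | simp)+
  then show ?thesis
    by (intro lin_eqI[of "\<lambda>x. commutator_lin (brk x y)"
          "\<lambda>x. commutator_lin x \<odot> commutator_lin y - commutator_lin y \<odot> commutator_lin x" x])
      (intro lin_intros | simp)+
qed

lemma unbracket_lin_brk: "unbracket_lin (brk x y) = unbracket_lin x \<odot> commutator_lin y"
  by (rule linear_ext_bilinear_ext) simp

text \<open>The commutator of an associative product is alternating and satisfies Jacobi; this is
  the canonical map from the free Lie algebra to the free associative algebra.\<close>

lemma commutator_lin_lie_ideal: "u \<in> lie_ideal p \<Longrightarrow> commutator_lin u = 0"
  by (induction rule: lie_ideal.induct)
    (simp_all add: commutator_lin_brk linear_ext_simps bilinear_ext_simps conc_assoc)

lemma unbracket_comb: "w \<noteq> [] \<Longrightarrow> unbracket (comb w) = gen w"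
  by (induction w rule: nonempty_snoc_induct) simp_all

lemma subspace_lie_ideal: "pm.subspace (lie_ideal p :: (nat monomial \<Rightarrow>\<^sub>0 'k::field) set)"
  unfolding pm.subspace_def
proof (intro conjI ballI allI)
  \<comment> \<open>The inductive definition has no clause for zero, which arises as
    \<open>[0, 0]\<close>.\<close>
  have "brk 0 0 \<in> (lie_ideal p :: (nat monomial \<Rightarrow>\<^sub>0 'k) set)"
    by (rule lie_ideal.alternating) (simp add: free_on_def)
  then show "0 \<in> (lie_ideal p :: (nat monomial \<Rightarrow>\<^sub>0 'k) set)" by (simp add: bilinear_ext_simps)
qed (auto intro: lie_ideal.add lie_ideal.scale)

lemma brk_in_free_on:
  "x \<in> free_on (monomials p) \<Longrightarrow> y \<in> free_on (monomials p) \<Longrightarrow> brk x y \<in> free_on (monomials p)"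
  by (rule bilinear_ext_in_free_on) (auto simp: monomials_def)

lemma lie_ideal_in_free_on: "u \<in> lie_ideal p \<Longrightarrow> u \<in> free_on (monomials p)"
  by (induction rule: lie_ideal.induct)
    (auto intro!: brk_in_free_on pm.subspace_add pm.subspace_scale subspace_free_on)

lemma lie_ideal_antisym:
  assumes "x \<in> free_on (monomials p)" "y \<in> free_on (monomials p)"
  shows "brk x y + brk y x \<in> lie_ideal p"
proof -
  have "brk (x + y) (x + y) - brk x x - brk y y \<in> lie_ideal p"
    using assms by (intro pm.subspace_diff subspace_lie_ideal lie_ideal.alternating pm.subspace_add subspace_free_on)
  then show ?thesis by (simp add: bilinear_ext_simps algebra_simps)
qed

text \<open>Jacobi in the shape of IHX, where bracketing with \<open>z\<close> on the right is a
  derivation. It differs from the cyclic form by three uses of antisymmetry, one of them inside the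
  bracket with \<open>y\<close>.\<close>

lemma lie_ideal_jacobi:
  assumes "x \<in> free_on (monomials p)" "y \<in> free_on (monomials p)" "z \<in> free_on (monomials p)"
  shows "brk (brk x y) z - (brk x (brk y z) + brk (brk x z) y) \<in> lie_ideal p"
proof -
  have 1: "brk (brk x y) z + brk z (brk x y) \<in> lie_ideal p" "brk (brk x z) y + brk y (brk x z) \<in> lie_ideal p"
    by (intro lie_ideal_antisym brk_in_free_on assms)+
  have "brk y (brk x z + brk z x) \<in> lie_ideal p"
    using assms by (intro lie_ideal.bracket_left lie_ideal_antisym)
  then have 2: "brk y (brk x z) + brk y (brk z x) \<in> lie_ideal p" by (simp add: bilinear_ext_simps)
  have 3: "brk x (brk y z) + brk y (brk z x) + brk z (brk x y) \<in> lie_ideal p"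
    using assms by (intro lie_ideal.jacobi)
  have "(brk (brk x y) z + brk z (brk x y)) - (brk (brk x z) y + brk y (brk x z))
    + (brk y (brk x z) + brk y (brk z x)) - (brk x (brk y z) + brk y (brk z x) + brk z (brk x y)) \<in> lie_ideal p"
    by (intro pm.subspace_diff pm.subspace_add subspace_lie_ideal 1 2 3)
  then show ?thesis by (simp add: algebra_simps)
qed

section \<open>Alphabet and degree under the maps between trees and words\<close>

lemma conc_in_ASS: "x \<in> ASS p \<Longrightarrow> y \<in> ASS p \<Longrightarrow> x \<odot> y \<in> ASS p"
  by (erule bilinear_ext_in_free_on[rotated 1]) (auto simp: words_def)

lemma conc_in_graded:
  assumes "x \<in> free_on {w \<in> words p. length w = m}" "y \<in> free_on {w \<in> words p. length w = n}"
  shows "x \<odot> y \<in> free_on {w \<in> words p. length w = m + n}"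
  using assms by (rule bilinear_ext_in_free_on[rotated 1]) (auto simp: words_def)

lemma commutator_graded:
  "t \<in> monomials p \<Longrightarrow> commutator t \<in> free_on {w \<in> words p. length w = degree_mono t}"
proof (induction t)
  case (Br s t)
  then have "s \<in> monomials p" "t \<in> monomials p" by (auto simp: monomials_def)
  with Br.IH show ?case
    using conc_in_graded[of "commutator s" p "degree_mono s" "commutator t" "degree_mono t"]
      conc_in_graded[of "commutator t" p "degree_mono t" "commutator s" "degree_mono s"]
    by (auto simp: add.commute intro!: pm.subspace_diff[OF subspace_free_on])
qed (auto simp: monomials_def words_def)

lemma unbracket_graded:
  "t \<in> monomials p \<Longrightarrow> unbracket t \<in> free_on {w \<in> words p. length w = degree_mono t}"
proof (induction t)
  case (Br s t)
  then have "s \<in> monomials p" "t \<in> monomials p" by (auto simp: monomials_def)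
  with Br.IH show ?case by (auto intro!: conc_in_graded commutator_graded)
qed (auto simp: monomials_def words_def)

lemma graded_in_ASS: "x \<in> free_on {w \<in> words p. length w = n} \<Longrightarrow> x \<in> ASS p"
  by (auto simp: free_on_def)

lemma comb_graded:
  assumes "w \<in> words p"
  shows "comb w \<in> {t \<in> monomials p. degree_mono t = length w}"
proof -
  have "w \<noteq> [] \<Longrightarrow> set w \<subseteq> {1..p} \<Longrightarrow> comb w \<in> monomials p \<and> degree_mono (comb w) = length w"
    by (induction w rule: nonempty_snoc_induct) (auto simp: monomials_def)
  then show ?thesis using assms by (simp add: words_def)
qed

lemma comb_in_monomials: "w \<in> words p \<Longrightarrow> comb w \<in> monomials p"
  using comb_graded by blast

lemma comb_lin_in: "x \<in> ASS p \<Longrightarrow> comb_lin x \<in> free_on (monomials p)"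
  by (erule linear_ext_in_free_on[rotated]) (simp add: comb_in_monomials)

lemma commutator_in_ASS: "t \<in> monomials p \<Longrightarrow> commutator t \<in> ASS p"
  using commutator_graded graded_in_ASS by blast

lemma unbracket_in_ASS: "t \<in> monomials p \<Longrightarrow> unbracket t \<in> ASS p"
  using unbracket_graded graded_in_ASS by blast

section \<open>Left-normed words represent all brackets modulo the Lie relations\<close>

lemma comb_lin_conc_letter:
  assumes "x \<in> ASS p" shows "comb_lin (x \<odot> gen [a]) = brk (comb_lin x) (gen (Atom a))"
proof -
  have "comb_lin (x \<odot> gen [a]) - brk (comb_lin x) (gen (Atom a)) \<in> {0}"
    by (rule lin_into_subspace[OF _ _ _ assms,
          of "\<lambda>x. comb_lin (x \<odot> gen [a]) - brk (comb_lin x) (gen (Atom a))"])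
      (intro lin_intros pm.subspace_single_0 | simp add: words_def)+
  then show ?thesis by simp
qed

text \<open>By Jacobi \<open>[x, [s, t]] = [[x, s], t] - [[x, t], s]\<close>, which matches the
  expansion of \<open>x \<odot> commutator (Br s t)\<close>. The element \<open>x\<close> varies in
  the induction because the hypothesis for \<open>t\<close> is applied to
  \<open>x \<odot> commutator s\<close>.\<close>

lemma comb_lin_conc_commutator:
  fixes x :: "nat list \<Rightarrow>\<^sub>0 'k::field"
  assumes "t \<in> monomials p" "x \<in> ASS p"
  shows "comb_lin (x \<odot> commutator t) - brk (comb_lin x) (gen t) \<in> lie_ideal p"
  using assms
proof (induction t arbitrary: x)
  case (Atom a)
  then show ?case by (simp add: comb_lin_conc_letter subspace_lie_ideal pm.subspace_0)
next
  case (Br s t)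
  then have st: "s \<in> monomials p" "t \<in> monomials p" by (auto simp: monomials_def)
  \<comment> \<open>Stated for fresh \<open>s\<close> and \<open>t\<close>, because the commutator
    contains the product in both orders.\<close>
  have *: "comb_lin (x \<odot> commutator s \<odot> commutator t) - brk (brk (comb_lin x) (gen s)) (gen t) \<in> lie_ideal p"
    if "s \<in> monomials p" "t \<in> monomials p"
      and "\<And>x :: nat list \<Rightarrow>\<^sub>0 'k. x \<in> ASS p \<Longrightarrow> comb_lin (x \<odot> commutator s) - brk (comb_lin x) (gen s) \<in> lie_ideal p"
      and "\<And>x :: nat list \<Rightarrow>\<^sub>0 'k. x \<in> ASS p \<Longrightarrow> comb_lin (x \<odot> commutator t) - brk (comb_lin x) (gen t) \<in> lie_ideal p" for s t
  proof -
    have "brk (comb_lin (x \<odot> commutator s) - brk (comb_lin x) (gen s)) (gen t) \<in> lie_ideal p"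
      using that Br.prems by (intro lie_ideal.bracket_right) auto
    moreover have "comb_lin (x \<odot> commutator s \<odot> commutator t) - brk (comb_lin (x \<odot> commutator s)) (gen t) \<in> lie_ideal p"
      using that Br.prems by (auto intro: conc_in_ASS commutator_in_ASS)
    ultimately show ?thesis
      using pm.subspace_add[OF subspace_lie_ideal] by (fastforce simp: bilinear_ext_simps)
  qed
  have "brk (brk (comb_lin x) (gen s)) (gen t) - (brk (comb_lin x) (brk (gen s) (gen t)) + brk (brk (comb_lin x) (gen t)) (gen s)) \<in> lie_ideal p"
    using st Br.prems by (intro lie_ideal_jacobi comb_lin_in) auto
  from pm.subspace_add[OF subspace_lie_ideal this
      pm.subspace_diff[OF subspace_lie_ideal *[OF st Br.IH(1)[OF st(1)] Br.IH(2)[OF st(2)]] *[OF st(2,1) Br.IH(2)[OF st(2)] Br.IH(1)[OF st(1)]]]]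
  show ?case by (simp add: bilinear_ext_simps linear_ext_simps conc_assoc algebra_simps)
qed

lemma comb_unbracket:
  "t \<in> monomials p \<Longrightarrow> comb_lin (unbracket t) - gen t \<in> (lie_ideal p :: (_ \<Rightarrow>\<^sub>0 'k::field) set)"
proof (induction t)
  case (Atom a)
  then show ?case by (simp add: subspace_lie_ideal pm.subspace_0)
next
  case (Br s t)
  then have st: "s \<in> monomials p" "t \<in> monomials p" by (auto simp: monomials_def)
  have "brk (comb_lin (unbracket s) - gen s) (gen t) \<in> (lie_ideal p :: (_ \<Rightarrow>\<^sub>0 'k) set)"
    using Br st by (intro lie_ideal.bracket_right) auto
  from pm.subspace_add[OF subspace_lie_ideal this comb_lin_conc_commutator[OF st(2) unbracket_in_ASS[OF st(1)]]]
  show ?case by (simp add: bilinear_ext_simps)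
qed

section \<open>The fold relations\<close>

lemma subspace_H_l: "pm.subspace (H_l p)"
  by (simp add: H_l_def pm.subspace_span)

lemma subspace_H': "pm.subspace (H' p)"
  by (simp add: H'_def pm.subspace_span)

lemma span_linear_ext_minus_id:
  "pm.span {linear_ext (f n) x - x | n x. 2 \<le> n \<and> x \<in> free_on B}
    = pm.span {f n w - gen w | n w. 2 \<le> (n::nat) \<and> w \<in> B}" (is "pm.span ?A = pm.span ?B")
proof (intro subset_antisym pm.span_minimal pm.subspace_span subsetI)
  fix y assume "y \<in> ?A"
  then obtain n x where y: "y = linear_ext (f n) x - x" "2 \<le> n" "x \<in> free_on B" by blast
  show "y \<in> pm.span ?B" unfolding y(1)
    using y(2)
    by (intro lin_into_subspace[OF _ _ _ y(3), of "\<lambda>x. linear_ext (f n) x - x"] lin_intros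
        pm.subspace_span pm.span_base) auto
next
  fix y assume "y \<in> ?B"
  then obtain n w where y: "y = linear_ext (f n) (gen w) - gen w" "2 \<le> n" "w \<in> B" by auto
  then have "gen w \<in> free_on B" by simp
  then show "y \<in> pm.span ?A" unfolding y(1) using y(2) by (intro pm.span_base) blast
qed

text \<open>The sign \<open>(-1)^(n-1)\<close> of the fold and the sign \<open>(-1)^(n-2)\<close> of
  \<open>eta\<close> on a prefix of length \<open>n-1\<close> multiply to -1, whatever
  \<open>n\<close> is.\<close>

lemma fold_l_eq:
  assumes "2 \<le> n" "n \<le> length w"
  obtains u a v where "u \<noteq> []" "w = u @ a # v" "n = Suc (length u)"
    "fold_l n w = - (gen [a] \<odot> commutator (comb u) \<odot> gen v :: nat list \<Rightarrow>\<^sub>0 'k::field)"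
proof
  define u a v where "u = take (n - 1) w" and "a = w ! (n - 1)" and "v = drop n w"
  show u: "u \<noteq> []" using assms by (cases w) (auto simp: u_def)
  show "w = u @ a # v"
    unfolding u_def a_def v_def using assms id_take_nth_drop[of "n - 1" w] by simp
  have "length u = n - 1" using assms by (simp add: u_def)
  then show "n = Suc (length u)" using assms by simp
  obtain m where m: "n = Suc (Suc m)" using assms(1) by (metis Suc_le_D numeral_2_eq_2 Suc_le_mono)
  show "fold_l n w = - (gen [a] \<odot> commutator (comb u) \<odot> gen v :: nat list \<Rightarrow>\<^sub>0 'k)"
    using assms \<open>length u = n - 1\<close> m
    unfolding fold_l_def u_def[symmetric] a_def[symmetric] v_def[symmetric] eta_eq_commutator_comb[OF u]
    by (simp add: bilinear_ext_simps flip: power_mult_distrib)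
qed

lemma fold_l_snoc:
  assumes "u \<noteq> []"
  shows "fold_l (Suc (length u)) (u @ a # v) = - (gen [a] \<odot> commutator (comb u) \<odot> gen v)"
proof -
  have "2 \<le> Suc (length u)" "Suc (length u) \<le> length (u @ a # v)" using assms by (cases u; simp)+
  from fold_l_eq[OF this] show ?thesis by (metis append_eq_append_conv list.inject nat.inject)
qed

text \<open>The Lie-theoretic form of the fold moves:
  \<open>gen [a] \<odot> commutator (comb u)\<close> is the unbracketing of \<open>[a, u]\<close>
  and \<open>u @ [a]\<close> that of \<open>[u, a]\<close>, and the tail \<open>v\<close> acts by
  further brackets with letters.\<close>

lemma H_l_eq:
  "H_l p = pm.span {gen [a] \<odot> commutator (comb u) \<odot> gen v + gen (u @ a # v) | u a v.
    u \<noteq> [] \<and> u @ a # v \<in> words p}" (is "_ = pm.span ?A")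
  unfolding H_l_def span_linear_ext_minus_id
proof (intro subset_antisym pm.span_minimal pm.subspace_span subsetI)
  fix y :: "nat list \<Rightarrow>\<^sub>0 'a" assume "y \<in> {fold_l n w - gen w |n w. 2 \<le> n \<and> w \<in> words p}"
  then obtain n w where y: "y = fold_l n w - gen w" "2 \<le> n" "w \<in> words p" by blast
  show "y \<in> pm.span ?A"
  proof (cases "n \<le> length w")
    case True
    obtain u a v where uav: "u \<noteq> []" "w = u @ a # v"
      "fold_l n w = - (gen [a] \<odot> commutator (comb u) \<odot> gen v :: nat list \<Rightarrow>\<^sub>0 'a)"
      using fold_l_eq[OF y(2) True] by metis
    then have "gen [a] \<odot> commutator (comb u) \<odot> gen v + gen (u @ a # v) \<in> ?A" using y(3) by blast
    then have "- (gen [a] \<odot> commutator (comb u) \<odot> gen v + gen (u @ a # v)) \<in> pm.span ?A"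
      by (intro pm.span_neg pm.span_base)
    then show ?thesis unfolding y(1) uav(3) by (simp add: uav(2))
  qed (simp add: y fold_l_def pm.span_zero)
next
  fix y :: "nat list \<Rightarrow>\<^sub>0 'a" assume "y \<in> ?A"
  then obtain u a v where y: "y = gen [a] \<odot> commutator (comb u) \<odot> gen v + gen (u @ a # v)"
    "u \<noteq> []" "u @ a # v \<in> words p" by blast
  then have eq: "- (fold_l (Suc (length u)) (u @ a # v) - gen (u @ a # v)) = y"
    by (simp add: fold_l_snoc)
  have "2 \<le> Suc (length u)" using y(2) by (cases u) auto
  then have "fold_l (Suc (length u)) (u @ a # v) - gen (u @ a # v)
    \<in> pm.span {fold_l n w - gen w :: _ \<Rightarrow>\<^sub>0 'a |n w. 2 \<le> n \<and> w \<in> words p}"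
    using y(3) by (intro pm.span_base) blast
  then show "y \<in> pm.span {fold_l n w - gen w |n w. 2 \<le> n \<and> w \<in> words p}"
    unfolding eq[symmetric] by (rule pm.span_neg)
qed

text \<open>The antipode of the free associative algebra, a Hopf algebra with primitive letters. On
  words of length at least 2 it is the fold move of \<open>H'\<close> at the last letter.\<close>

definition antipode :: "'a list \<Rightarrow> 'a list \<Rightarrow>\<^sub>0 'k::field"
  where "antipode w = smul ((- 1) ^ length w) (gen (rev w))"

abbreviation "antipode_lin \<equiv> linear_ext antipode"

lemma fold'_cases:
  assumes "w \<in> words p"
  shows "fold' n w = (if length w = 1 then 0 else if n = length w then antipode w else fold_l n w)"
  using assms by (cases w) (auto simp: fold'_def antipode_def words_def)

lemma letter_in_H': "a \<in> {1..p} \<Longrightarrow> gen [a] \<in> H' p"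
proof -
  assume "a \<in> {1..p}"
  then have "fold' 2 [a] - gen [a] \<in> H' p"
    unfolding H'_def span_linear_ext_minus_id
    \<comment> \<open>Any \<open>n\<close> from 2 on would serve, as \<open>fold'\<close> tests for
      length 1 before it looks at \<open>n\<close>.\<close>
    by (intro pm.span_base CollectI exI[of _ 2] exI[of _ "[a]"]) (auto simp: words_def)
  then have "- (fold' 2 [a] - gen [a]) \<in> H' p" by (rule pm.subspace_neg[OF subspace_H'])
  then show ?thesis by (simp add: fold'_def)
qed

lemma antipode_in_H':
  assumes "w \<in> words p" "2 \<le> length w"
  shows "antipode w - gen w \<in> H' p"
proof -
  have "fold' (length w) w - gen w \<in> H' p"
    unfolding H'_def span_linear_ext_minus_id using assms by (intro pm.span_base) blast
  then show ?thesis using assms by (simp add: fold'_cases)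
qed

lemma antipode_lin_in_H':
  assumes "x \<in> free_on {w \<in> words p. 2 \<le> length w}"
  shows "antipode_lin x - x \<in> H' p"
  by (rule lin_into_subspace[OF _ subspace_H' _ assms, of "\<lambda>x. antipode_lin x - x"])
    (intro lin_intros | simp add: antipode_in_H')+

text \<open>Appending letters only lengthens the tail of a generator.\<close>

lemma H_l_conc:
  assumes "h \<in> H_l p" "set v \<subseteq> {1..p}"
  shows "h \<odot> gen v \<in> H_l p"
  using assms(1) unfolding H_l_eq
proof (rule lin_span_into_subspace[rotated 3, where F = "\<lambda>h. h \<odot> gen v"])
  fix h :: "nat list \<Rightarrow>\<^sub>0 'a"
  assume "h \<in> {gen [a] \<odot> commutator (comb u) \<odot> gen v + gen (u @ a # v) |u a v. u \<noteq> [] \<and> u @ a # v \<in> words p}"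
  then obtain u a v' where h: "h = gen [a] \<odot> commutator (comb u) \<odot> gen v' + gen (u @ a # v')"
    "u \<noteq> []" "u @ a # v' \<in> words p" by blast
  have "h \<odot> gen v = gen [a] \<odot> commutator (comb u) \<odot> gen (v' @ v) + gen (u @ a # (v' @ v))"
    by (simp add: h bilinear_ext_simps conc_assoc)
  moreover have "u @ a # (v' @ v) \<in> words p" using h assms(2) by (auto simp: words_def)
  ultimately show "h \<odot> gen v \<in> pm.span {gen [a] \<odot> commutator (comb u) \<odot> gen v + gen (u @ a # v) |u a v. u \<noteq> [] \<and> u @ a # v \<in> words p}"
    using h(2) by (intro pm.span_base) blast
qed (intro lin_intros pm.subspace_span)+

lemma H_l_conc_ASS:
  assumes "h \<in> H_l p" "y \<in> ASS p"
  shows "h \<odot> y \<in> H_l p"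
  by (rule lin_into_subspace[OF _ subspace_H_l _ assms(2), of "\<lambda>y. h \<odot> y"])
    (intro lin_intros | auto simp: words_def intro!: H_l_conc assms(1))+

text \<open>A nonempty word behind a generator of \<open>H_l\<close> keeps the folded letter away
  from the last position, and there \<open>fold'\<close> and \<open>fold_l\<close> agree.\<close>

lemma H_l_conc_in_H':
  assumes "h \<in> H_l p" "y \<in> ASS p"
  shows "h \<odot> y \<in> H' p"
proof (rule lin_into_subspace[OF _ subspace_H' _ assms(2), of "\<lambda>y. h \<odot> y"])
  fix v assume v: "v \<in> words p"
  show "h \<odot> gen v \<in> H' p"
    using assms(1) unfolding H_l_eq
  proof (rule lin_span_into_subspace[OF _ subspace_H', rotated 2, where F = "\<lambda>h. h \<odot> gen v"])
    fix h :: "nat list \<Rightarrow>\<^sub>0 'a"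
    assume "h \<in> {gen [a] \<odot> commutator (comb u) \<odot> gen v + gen (u @ a # v) |u a v. u \<noteq> [] \<and> u @ a # v \<in> words p}"
    then obtain u a v' where h: "h = gen [a] \<odot> commutator (comb u) \<odot> gen v' + gen (u @ a # v')"
      "u \<noteq> []" "u @ a # v' \<in> words p" by blast
    let ?w = "u @ a # (v' @ v)"
    have w: "?w \<in> words p" "Suc (length u) \<noteq> length ?w" "length ?w \<noteq> 1" "2 \<le> Suc (length u)"
      using h v by (cases u; auto simp: words_def)+
    have "fold' (Suc (length u)) ?w - gen ?w \<in> (H' p :: (_ \<Rightarrow>\<^sub>0 'a) set)"
      unfolding H'_def span_linear_ext_minus_id using w(1,4) by (intro pm.span_base) blast
    moreover have "fold' (Suc (length u)) ?w = (fold_l (Suc (length u)) ?w :: _ \<Rightarrow>\<^sub>0 'a)"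
      by (simp only: fold'_cases[OF w(1)] w(2,3) if_False)
    ultimately have "- (fold_l (Suc (length u)) ?w - gen ?w) \<in> (H' p :: (_ \<Rightarrow>\<^sub>0 'a) set)"
      by (intro pm.subspace_neg[OF subspace_H']) simp
    then show "h \<odot> gen v \<in> H' p"
      by (simp add: h fold_l_snoc bilinear_ext_simps conc_assoc add.commute)
  qed (intro lin_intros)
qed (intro lin_intros)

text \<open>Besides single letters and reversals, the generators of \<open>H'\<close> are those of
  \<open>H_l\<close> followed by a letter. For diagrams the three kinds mean that none has just one
  leg, that an edge can be turned around, and that Lie relations hold in the tree attached to a
  leg.\<close>

lemma H'_induct:
  fixes x :: "nat list \<Rightarrow>\<^sub>0 'k::field"
  assumes "x \<in> H' p" "lin F" "pm.subspace S"
    and letter: "\<And>a. a \<in> {1..p} \<Longrightarrow> F (gen [a]) \<in> S"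
    and antipode: "\<And>w. w \<in> words p \<Longrightarrow> 2 \<le> length w \<Longrightarrow> F (antipode w) - F (gen w) \<in> S"
    and fold: "\<And>h b. h \<in> H_l p \<Longrightarrow> b \<in> {1..p} \<Longrightarrow> F (h \<odot> gen [b]) \<in> S"
  shows "F x \<in> S"
  using assms(1) unfolding H'_def span_linear_ext_minus_id
proof (rule lin_span_into_subspace[OF assms(2,3), rotated])
  fix y :: "nat list \<Rightarrow>\<^sub>0 'k"
  assume "y \<in> {fold' n w - gen w |n w. 2 \<le> n \<and> w \<in> words p}"
  then obtain n w where y: "y = fold' n w - gen w" "2 \<le> n" "w \<in> words p" by blast
  consider (1) "length w = 1" | (2) "length w \<noteq> 1" "n = length w" | (3) "n < length w" | (4) "length w \<noteq> 1" "length w < n"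
    using y(2) by linarith
  then show "F y \<in> S"
  proof cases
    case 1
    then obtain a where "w = [a]" by (cases w) auto
    then show ?thesis using letter[of a] y assms(2,3) fold'_cases[OF y(3), where 'a='k]
      by (simp add: words_def lin_neg pm.subspace_neg)
  next
    case 2
    then show ?thesis using antipode[of w] y assms(2) fold'_cases[OF y(3), where 'a='k] by (simp add: lin_diff)
  next
    case 3
    obtain u a v where uav: "u \<noteq> []" "w = u @ a # v" "n = Suc (length u)"
      "fold_l n w = - (gen [a] \<odot> commutator (comb u) \<odot> gen v :: nat list \<Rightarrow>\<^sub>0 'k)"
      using fold_l_eq[of n w] y(2) 3 by (metis less_imp_le)
    then obtain v' b where v: "v = v' @ [b]" using 3 by (cases v rule: rev_cases) auto
    have w: "set w \<subseteq> {1..p}" using y(3) by (simp add: words_def)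
    have "gen [a] \<odot> commutator (comb u) \<odot> gen v' + gen (u @ a # v') \<in> (H_l p :: (_ \<Rightarrow>\<^sub>0 'k) set)"
      unfolding H_l_eq using w uav(1,2) v by (intro pm.span_base) (auto simp: words_def)
    moreover have "y = - ((gen [a] \<odot> commutator (comb u) \<odot> gen v' + gen (u @ a # v')) \<odot> gen [b])"
      using fold'_cases[OF y(3), of n, where 'a='k] 3 y(2)
      by (simp add: y(1) uav(4)) (simp add: uav(2) v bilinear_ext_simps conc_assoc)
    ultimately show ?thesis using fold[of "gen [a] \<odot> commutator (comb u) \<odot> gen v' + gen (u @ a # v')" b] w uav(2) v assms(2,3)
      by (simp add: lin_neg pm.subspace_neg)
  next
    case 4
    then show ?thesis using y fold'_cases[OF y(3), of n, where 'a='k] assms(2,3)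
      by (simp add: fold_l_def lin_0 pm.subspace_0)
  qed
qed

lemma H_l_in_ASS: "x \<in> H_l p \<Longrightarrow> x \<in> ASS p"
  unfolding H_l_eq
proof (rule lin_span_into_subspace[OF lin_id subspace_free_on, rotated])
  fix x :: "nat list \<Rightarrow>\<^sub>0 'a"
  assume "x \<in> {gen [a] \<odot> commutator (comb u) \<odot> gen v + gen (u @ a # v) |u a v. u \<noteq> [] \<and> u @ a # v \<in> words p}"
  then obtain u a v where x: "x = gen [a] \<odot> (commutator (comb u) \<odot> gen v) + gen (u @ a # v)"
    "u \<noteq> []" "u @ a # v \<in> words p" by (auto simp: conc_assoc)
  then have u: "u \<in> words p" and v: "set v \<subseteq> {1..p}" and a: "a \<in> {1..p}" by (auto simp: words_def)
  have 1: "commutator (comb u) \<odot> gen v \<in> (ASS p :: (_ \<Rightarrow>\<^sub>0 'a) set)"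
    by (rule bilinear_ext_in_free_on[OF _ commutator_in_ASS[OF comb_in_monomials[OF u]], of "{v}"])
      (use v in \<open>auto simp: words_def\<close>)
  have "[a] \<in> words p" using a by (simp add: words_def)
  then show "x \<in> ASS p" unfolding x(1)
    using x(3) by (intro pm.subspace_add[OF subspace_free_on] conc_in_ASS[OF _ 1]) simp_all
qed

text \<open>By definition \<open>H_l\<close> contains these elements if \<open>y\<close> is a letter.\<close>

lemma dynkin_antisym:
  assumes "x \<in> ASS p" "y \<in> ASS p"
  shows "x \<odot> dynkin y + y \<odot> dynkin x \<in> H_l p"
proof -
  have word: "x \<odot> dynkin (gen v) + gen v \<odot> dynkin x \<in> H_l p"
    if "v \<in> words p" "x \<in> ASS p" for v and x :: "nat list \<Rightarrow>\<^sub>0 'a"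
  proof -
    have "v \<noteq> []" using that by (auto simp: words_def)
    then show ?thesis using that
    proof (induction v arbitrary: x rule: nonempty_snoc_induct)
      case (single a)
      show ?case
      proof (rule lin_into_subspace[OF _ subspace_H_l _ single(2)])
        fix u assume u: "u \<in> words p"
        with single(1) have "u @ a # [] \<in> words p" "u \<noteq> []" by (auto simp: words_def)
        then have "gen [a] \<odot> commutator (comb u) \<odot> gen [] + gen (u @ a # []) \<in> H_l p"
          unfolding H_l_eq by (intro pm.span_base) blast
        then show "gen u \<odot> dynkin (gen [a]) + gen [a] \<odot> dynkin (gen u) \<in> H_l p"
          by (simp add: add.commute)
      qed (intro lin_intros)
    next
      case (snoc v b)
      then have v: "v \<in> words p" and b: "[b] \<in> words p" by (auto simp: words_def)
      have xb: "x \<odot> gen [b] \<in> ASS p" using snoc.prems(2) b by (intro conc_in_ASS) auto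
      \<comment> \<open>The claim for \<open>x\<close> and \<open>v @ [b]\<close> is this claim for
        \<open>x\<close> and \<open>v\<close>, multiplied by \<open>b\<close>, minus the claim for
        \<open>x \<odot> gen [b]\<close> and \<open>v\<close>: the two copies of
        \<open>gen v \<odot> dynkin x \<odot> gen [b]\<close> cancel. Hence \<open>x\<close> varies
        in the induction.\<close>
      have 1: "(x \<odot> dynkin (gen v) + gen v \<odot> dynkin x) \<odot> gen [b] \<in> H_l p"
        using snoc.IH[OF v snoc.prems(2)] b by (intro H_l_conc_ASS) auto
      have 2: "x \<odot> gen [b] \<odot> dynkin (gen v) + gen v \<odot> dynkin (x \<odot> gen [b]) \<in> H_l p"
        by (rule snoc.IH[OF v xb])
      have "dynkin (x \<odot> gen [b]) - (dynkin x \<odot> gen [b] - gen [b] \<odot> dynkin x) \<in> {0}"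
        by (rule lin_into_subspace[OF _ _ _ snoc.prems(2),
              of "\<lambda>x. dynkin (x \<odot> gen [b]) - (dynkin x \<odot> gen [b] - gen [b] \<odot> dynkin x)"])
          (intro lin_intros pm.subspace_single_0 | simp add: words_def)+
      then have 3: "dynkin (x \<odot> gen [b]) = dynkin x \<odot> gen [b] - gen [b] \<odot> dynkin x" by simp
      have 4: "gen (v @ [b]) = gen v \<odot> gen [b]" by simp
      have 5: "dynkin (gen (v @ [b])) = dynkin (gen v) \<odot> gen [b] - gen [b] \<odot> dynkin (gen v)"
        using snoc.hyps by simp
      show ?case using pm.subspace_diff[OF subspace_H_l 1 2]
        unfolding 3 5 unfolding 4 by (simp add: bilinear_ext_simps conc_assoc diff_diff_eq2 add_diff_eq diff_add_eq del: bilinear_ext_gen)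
    qed
  qed
  show ?thesis
    by (rule lin_into_subspace[OF _ subspace_H_l _ assms(2)]) (intro lin_intros word assms(1))+
qed

text \<open>\<open>dynkin\<close> is \<open>commutator_lin\<close> after \<open>comb_lin\<close>;
  the latter inverts \<open>unbracket\<close> up to the Lie ideal, which
  \<open>commutator_lin\<close> annihilates.\<close>

lemma dynkin_unbracket:
  assumes "t \<in> monomials p"
  shows "dynkin (unbracket t) = (commutator t :: nat list \<Rightarrow>\<^sub>0 'k::field)"
proof -
  have "commutator_lin (comb_lin x) = dynkin x" for x :: "nat list \<Rightarrow>\<^sub>0 'k"
    by (rule lin_eqI[of "\<lambda>x. commutator_lin (comb_lin x)" dynkin]) (intro lin_intros | simp)+
  then show ?thesis
    using commutator_lin_lie_ideal[OF comb_unbracket[OF assms], where 'a='k] by (simp add: linear_ext_simps)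
qed

lemma unbracket_lin_in: "x \<in> free_on (monomials p) \<Longrightarrow> unbracket_lin x \<in> ASS p"
  by (erule linear_ext_in_free_on[rotated]) (rule unbracket_in_ASS)

lemma commutator_lin_in: "x \<in> free_on (monomials p) \<Longrightarrow> commutator_lin x \<in> ASS p"
  by (erule linear_ext_in_free_on[rotated]) (rule commutator_in_ASS)

lemma dynkin_unbracket_lin:
  assumes "x \<in> free_on (monomials p)"
  shows "dynkin (unbracket_lin x) = commutator_lin x"
proof -
  have "dynkin (unbracket_lin x) - commutator_lin x \<in> {0}"
    by (rule lin_into_subspace[OF _ _ _ assms, of "\<lambda>x. dynkin (unbracket_lin x) - commutator_lin x"])
      (intro lin_intros pm.subspace_single_0 | simp add: dynkin_unbracket)+
  then show ?thesis by simp
qed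

lemma unbracket_lin_antisym:
  assumes "x \<in> free_on (monomials p)" "y \<in> free_on (monomials p)"
  shows "unbracket_lin x \<odot> commutator_lin y + unbracket_lin y \<odot> commutator_lin x \<in> H_l p"
  using dynkin_antisym[OF assms[THEN unbracket_lin_in]] assms by (simp add: dynkin_unbracket_lin)

text \<open>The characteristic enters here: antisymmetry applied to \<open>x\<close> and
  \<open>x\<close> gives only twice the relation \<open>[x, x]\<close>.\<close>

lemma subspace_halve:
  assumes "pm.subspace S" "x + x \<in> (S :: ('a \<Rightarrow>\<^sub>0 'k::field) set)" "CHAR('k) \<noteq> 2"
  shows "x \<in> S"
proof -
  have "(2::'k) \<noteq> 0"
  proof
    assume "(2::'k) = 0"
    then have "of_nat 2 = (0::'k)" by simp
    then have "CHAR('k) dvd 2" by (simp only: of_nat_eq_0_iff_char_dvd)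
    moreover from this have "CHAR('k) \<le> 2" by (rule dvd_imp_le) simp
    ultimately have "CHAR('k) \<noteq> 0" "CHAR('k) \<le> 2" by (metis dvd_0_left_iff zero_neq_numeral)+
    then show False using assms(3) CHAR_not_1'[where 'a='k] by linarith
  qed
  moreover have "x + x = smul 2 x"
    by (metis one_add_one pm.scale_left_distrib pm.scale_one)
  ultimately have "smul (1/2) (x + x) = x" by simp
  then show ?thesis using pm.subspace_scale[OF assms(1,2)] by metis
qed

text \<open>A bracket whose right factor lies in the ideal is sent to 0, because the commutator
  polynomial of that factor vanishes. If the left factor lies in the ideal, closure of
  \<open>H_l\<close> under right multiplication suffices.\<close>

lemma unbracket_lin_lie_ideal:
  assumes char: "CHAR('k::field) \<noteq> 2" and u: "u \<in> (lie_ideal p :: (_ \<Rightarrow>\<^sub>0 'k) set)"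
  shows "unbracket_lin u \<in> H_l p"
  using u
proof (induction rule: lie_ideal.induct)
  case (alternating x)
  then show ?case
    using subspace_halve[OF subspace_H_l unbracket_lin_antisym char] by (simp add: unbracket_lin_brk)
next
  case (jacobi x y z)
  let ?U = "\<lambda>x y z. unbracket_lin x \<odot> commutator_lin y \<odot> commutator_lin z"
  \<comment> \<open>By antisymmetry \<open>[x, [y, z]]\<close> is minus \<open>[[y, z], x]\<close>,
    and \<open>[z, [x, y]]\<close> is minus \<open>[[x, y], z]\<close>. Trading
    \<open>[[x, y], z]\<close> for minus \<open>[[y, x], z]\<close> makes what remains equal to
    \<open>[y, [z, x]]\<close>.\<close>
  have 1: "unbracket_lin x \<odot> commutator_lin (brk y z) + ?U y z x \<in> H_l p"
    using unbracket_lin_antisym[OF jacobi(1) brk_in_free_on[OF jacobi(2,3)]] by (simp add: unbracket_lin_brk)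
  have 2: "unbracket_lin z \<odot> commutator_lin (brk x y) + ?U x y z \<in> H_l p"
    using unbracket_lin_antisym[OF jacobi(3) brk_in_free_on[OF jacobi(1,2)]] by (simp add: unbracket_lin_brk)
  have 3: "(unbracket_lin x \<odot> commutator_lin y + unbracket_lin y \<odot> commutator_lin x) \<odot> commutator_lin z \<in> H_l p"
    by (intro H_l_conc_ASS unbracket_lin_antisym commutator_lin_in jacobi)
  show ?case using pm.subspace_diff[OF subspace_H_l pm.subspace_add[OF subspace_H_l 1 2] 3]
    by (simp add: unbracket_lin_brk linear_ext_simps commutator_lin_brk bilinear_ext_simps conc_assoc algebra_simps)
next
  case (bracket_left u x)
  then show ?case
    by (simp add: unbracket_lin_brk commutator_lin_lie_ideal bilinear_ext_simps subspace_H_l pm.subspace_0)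
next
  case (bracket_right u x)
  then show ?case by (simp add: unbracket_lin_brk H_l_conc_ASS commutator_lin_in)
qed (simp_all add: linear_ext_simps subspace_H_l pm.subspace_add pm.subspace_scale)

lemma comb_lin_conc_word:
  assumes "comb_lin x \<in> lie_ideal p" "x \<in> ASS p" "set v \<subseteq> {1..p}"
  shows "comb_lin (x \<odot> gen v) \<in> lie_ideal p"
  using assms(3)
proof (induction v rule: rev_induct)
  case Nil then show ?case using assms(1) by simp
next
  case (snoc b v)
  have "x \<odot> gen v \<in> ASS p"
    using snoc.prems by (intro bilinear_ext_in_free_on[OF _ assms(2), of "{v}"]) (auto simp: words_def)
  then have "comb_lin (x \<odot> gen v \<odot> gen [b]) = brk (comb_lin (x \<odot> gen v)) (gen (Atom b))"
    by (rule comb_lin_conc_letter)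
  moreover have "brk (comb_lin (x \<odot> gen v)) (gen (Atom b)) \<in> lie_ideal p"
    using snoc by (intro lie_ideal.bracket_right) (auto simp: monomials_def)
  ultimately show ?case by (simp add: conc_assoc)
qed

text \<open>With its tail split off, a generator is sent to \<open>[a, u] + [u, a]\<close> modulo
  the Lie ideal; the tail then only adds brackets with letters, under which the ideal is
  closed.\<close>

lemma comb_lin_H_l:
  assumes "h \<in> H_l p"
  shows "comb_lin h \<in> lie_ideal p"
  using assms unfolding H_l_eq
proof (rule lin_span_into_subspace[OF lin_linear_ext subspace_lie_ideal, rotated])
  fix h :: "nat list \<Rightarrow>\<^sub>0 'a"
  assume "h \<in> {gen [a] \<odot> commutator (comb u) \<odot> gen v + gen (u @ a # v) |u a v. u \<noteq> [] \<and> u @ a # v \<in> words p}"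
  then obtain u a v where h: "h = (gen [a] \<odot> commutator (comb u) + gen (u @ [a])) \<odot> gen v"
    and w: "u \<noteq> []" "u @ a # v \<in> words p" by (auto simp: bilinear_ext_simps)
  have u: "u \<in> words p" and a: "[a] \<in> words p" "Atom a \<in> monomials p" using w by (auto simp: words_def monomials_def)
  note cu = comb_in_monomials[OF u]
  show "comb_lin h \<in> lie_ideal p" unfolding h
  proof (rule comb_lin_conc_word)
    have "comb_lin (gen [a] \<odot> commutator (comb u)) - brk (gen (Atom a)) (gen (comb u)) \<in> (lie_ideal p :: (_ \<Rightarrow>\<^sub>0 'a) set)"
      using comb_lin_conc_commutator[OF cu, of "gen [a]"] a by simp
    moreover have "brk (gen (Atom a)) (gen (comb u)) + brk (gen (comb u)) (gen (Atom a)) \<in> (lie_ideal p :: (_ \<Rightarrow>\<^sub>0 'a) set)"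
      using a cu by (intro lie_ideal_antisym) auto
    ultimately have "comb_lin (gen [a] \<odot> commutator (comb u)) - brk (gen (Atom a)) (gen (comb u))
      + (brk (gen (Atom a)) (gen (comb u)) + brk (gen (comb u)) (gen (Atom a))) \<in> (lie_ideal p :: (_ \<Rightarrow>\<^sub>0 'a) set)"
      by (rule lie_ideal.add)
    then show "comb_lin (gen [a] \<odot> commutator (comb u) + gen (u @ [a])) \<in> (lie_ideal p :: (_ \<Rightarrow>\<^sub>0 'a) set)"
      using w(1) by (simp add: linear_ext_simps)
    show "gen [a] \<odot> commutator (comb u) + gen (u @ [a]) \<in> ASS p"
      using u a cu by (intro pm.subspace_add[OF subspace_free_on] conc_in_ASS commutator_in_ASS) (auto simp: words_def)
  qed (use w in \<open>auto simp: words_def\<close>)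
qed

theorem lie_algebra_iso_words:
  fixes p :: nat
  assumes "CHAR('k::field) \<noteq> 2"
  shows "\<exists>\<psi> :: (nat monomial \<Rightarrow>\<^sub>0 'k) set \<Rightarrow> (nat list \<Rightarrow>\<^sub>0 'k) set.
    quot_linear_iso (free_on (monomials p)) (lie_ideal p) (ASS p) (H_l p) \<psi> \<and>
    (\<forall>n. \<psi> ` quot (free_on {t \<in> monomials p. degree_mono t = n}) (lie_ideal p)
       = quot (free_on {w \<in> words p. length w = n}) (H_l p))"
proof -
  let ?F = "unbracket_lin :: (nat monomial \<Rightarrow>\<^sub>0 'k) \<Rightarrow> _" and ?G = "comb_lin :: (nat list \<Rightarrow>\<^sub>0 'k) \<Rightarrow> _"
  have GF: "?G (?F x) - x \<in> lie_ideal p" if "x \<in> free_on (monomials p)" for x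
    by (rule lin_into_subspace[OF _ subspace_lie_ideal _ that, of "\<lambda>x. ?G (?F x) - x"])
      (intro lin_intros | simp add: comb_unbracket)+
  have FG: "?F (?G y) - y \<in> H_l p" if "y \<in> ASS p" for y
    by (rule lin_into_subspace[OF _ subspace_H_l _ that, of "\<lambda>y. ?F (?G y) - y"])
      (intro lin_intros | simp add: words_def unbracket_comb subspace_H_l pm.subspace_0)+
  have "?F ` free_on (monomials p) \<subseteq> ASS p" "?F ` lie_ideal p \<subseteq> H_l p"
    "?G ` ASS p \<subseteq> free_on (monomials p)" "?G ` H_l p \<subseteq> lie_ideal p"
    by (auto simp: unbracket_lin_in comb_lin_in unbracket_lin_lie_ideal[OF assms] comb_lin_H_l)
  note iso = quot_linear_isoI[OF lin_linear_ext this(1,2) lin_linear_ext this(3,4)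
      subspace_free_on subspace_free_on subspace_lie_ideal subspace_H_l GF FG]
  have "(\<lambda>X. ?F ` X + H_l p) ` quot (free_on {t \<in> monomials p. degree_mono t = n}) (lie_ideal p)
       = quot (free_on {w \<in> words p. length w = n}) (H_l p)" for n
    by (rule iso(2); (intro free_on_mono)?)
      (auto intro: linear_ext_in_free_on unbracket_graded dest: comb_graded
        intro!: linear_ext_in_free_on[of "{w \<in> words p. length w = n}" "\<lambda>w. gen (comb w)"]
         linear_ext_in_free_on[of "{t \<in> monomials p. degree_mono t = n}" unbracket])
  with iso(1) show ?thesis by blast
qed

section \<open>Gluing two rooted trees\<close>

lemma antipode_lin_conc: "antipode_lin (x \<odot> y) = antipode_lin y \<odot> antipode_lin x"
proof -
  have "antipode_lin (gen u \<odot> y) = antipode_lin y \<odot> antipode_lin (gen u)" for u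
    by (rule lin_eqI[of "\<lambda>y. antipode_lin (gen u \<odot> y)" "\<lambda>y. antipode_lin y \<odot> antipode_lin (gen u)"])
      (intro lin_intros | simp add: antipode_def bilinear_ext_simps power_add)+
  then show ?thesis
    by (intro lin_eqI[of "\<lambda>x. antipode_lin (x \<odot> y)" "\<lambda>x. antipode_lin y \<odot> antipode_lin x" x])
      (intro lin_intros | simp)+
qed

lemma antipode_lin_antipode_lin [simp]: "antipode_lin (antipode_lin x) = x"
  by (rule lin_eqI[of "\<lambda>x. antipode_lin (antipode_lin x)" "\<lambda>x. x"])
    (intro lin_intros | simp add: antipode_def linear_ext_simps flip: power_mult_distrib)+

text \<open>Lie polynomials are primitive elements, on which an antipode is -1; here this is an
  induction from the fact that the antipode reverses products.\<close>

lemma antipode_commutator: "antipode_lin (commutator t) = - commutator t"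
proof (induction t)
  case (Atom a) then show ?case by (simp add: antipode_def)
next
  case (Br s t)
  then show ?case by (simp add: linear_ext_simps antipode_lin_conc bilinear_ext_simps)
qed

lemma antipode_commutator_lin: "antipode_lin (commutator_lin x) = - commutator_lin x"
  by (rule lin_eqI[of "\<lambda>x. antipode_lin (commutator_lin x)" "\<lambda>x. - commutator_lin x"])
    (intro lin_intros | simp add: antipode_commutator)+

lemma antipode_lin_in_ASS: "x \<in> ASS p \<Longrightarrow> antipode_lin x \<in> ASS p"
  by (erule linear_ext_in_free_on[rotated])
    (auto simp: antipode_def words_def intro!: pm.subspace_scale[OF subspace_free_on])

text \<open>
  The word class of the diagram obtained by joining the roots of \<open>x\<close> and \<open>y\<close> by an edge: the
  antipode turns the word of \<open>y\<close> around.
\<close>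

definition glue :: "('a monomial \<Rightarrow>\<^sub>0 'k::field) \<Rightarrow> ('a monomial \<Rightarrow>\<^sub>0 'k) \<Rightarrow> 'a list \<Rightarrow>\<^sub>0 'k"
  where "glue x y = - (unbracket_lin x \<odot> antipode_lin (unbracket_lin y))"

lemma lin_glue_left: "lin F \<Longrightarrow> lin (\<lambda>x. glue (F x) y)"
  unfolding glue_def by (intro lin_intros | assumption)+

lemma lin_glue_right: "lin F \<Longrightarrow> lin (\<lambda>y. glue x (F y))"
  unfolding glue_def by (intro lin_intros | assumption)+

lemma long_conc:
  assumes "x \<in> ASS p" "y \<in> ASS p"
  shows "x \<odot> y \<in> free_on {w \<in> words p. 2 \<le> length w}"
proof (rule bilinear_ext_in_free_on[OF _ assms])
  fix u v assume "u \<in> words p" "v \<in> words p"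
  then show "u @ v \<in> {w \<in> words p. 2 \<le> length w}"
    by (cases u; cases v) (auto simp: words_def)
qed

text \<open>The antipode is an involution that reverses products, so it exchanges the two factors of
  \<open>glue\<close>. Each factor has positive length, hence the reversal move applies to their
  product.\<close>

lemma glue_sym:
  assumes "x \<in> free_on (monomials p)" "y \<in> free_on (monomials p)"
  shows "glue x y - glue y x \<in> H' p"
  using antipode_lin_in_H'[OF long_conc[OF unbracket_lin_in[OF assms(1)] antipode_lin_in_ASS[OF unbracket_lin_in[OF assms(2)]]]]
  by (simp add: glue_def antipode_lin_conc)

lemma glue_lie_ideal_left:
  assumes "CHAR('k::field) \<noteq> 2" "u \<in> (lie_ideal p :: (_ \<Rightarrow>\<^sub>0 'k) set)" "y \<in> free_on (monomials p)"
  shows "glue u y \<in> H' p"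
  unfolding glue_def using assms
  by (intro pm.subspace_neg[OF subspace_H'] H_l_conc_in_H' unbracket_lin_lie_ideal
      antipode_lin_in_ASS unbracket_lin_in)

lemma glue_lie_ideal_right:
  assumes "CHAR('k::field) \<noteq> 2" "u \<in> (lie_ideal p :: (_ \<Rightarrow>\<^sub>0 'k) set)" "y \<in> free_on (monomials p)"
  shows "glue y u \<in> H' p"
  using pm.subspace_add[OF subspace_H' glue_sym[OF assms(3) lie_ideal_in_free_on[OF assms(2)]] glue_lie_ideal_left[OF assms]]
  by simp

text \<open>Moving the edge across a vertex: \<open>y\<close> passes from the near side to the far
  side.\<close>

lemma glue_assoc:
  assumes "CHAR('k::field) \<noteq> 2" "x \<in> free_on (monomials p)" "y \<in> free_on (monomials p)"
    and "z \<in> (free_on (monomials p) :: (_ \<Rightarrow>\<^sub>0 'k) set)"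
  shows "glue (brk x y) z - glue x (brk y z) \<in> H' p"
proof -
  have *: "glue x (brk y z + brk z y) \<in> H' p"
    using assms by (intro glue_lie_ideal_right lie_ideal_antisym)
  \<comment> \<open>An exact cancellation: the antipode of
    \<open>unbracket_lin z \<odot> commutator_lin y\<close> brings the second factor to the front
    and negates it. Only the order of \<open>z\<close> and \<open>y\<close> remains to be corrected
    by antisymmetry.\<close>
  have "glue (brk x y) z + glue x (brk z y) = 0"
    by (simp add: glue_def unbracket_lin_brk antipode_lin_conc antipode_commutator_lin bilinear_ext_simps conc_assoc)
  then have "glue (brk x y) z - glue x (brk y z) = - glue x (brk y z + brk z y)"
    by (simp add: lin_add[OF lin_glue_right[OF lin_id]] eq_neg_iff_add_eq_0)
  with * show ?thesis by (simp add: pm.subspace_neg[OF subspace_H'])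
qed

lemma glue_graded:
  assumes "s \<in> monomials p" "t \<in> monomials p"
  shows "glue (gen s) (gen t) \<in> free_on {w \<in> words p. length w = degree_mono s + degree_mono t}"
proof -
  have "antipode_lin (unbracket t) \<in> free_on {w \<in> words p. length w = degree_mono t}"
    by (rule linear_ext_in_free_on[OF _ unbracket_graded[OF assms(2)]])
      (auto simp: antipode_def words_def intro!: pm.subspace_scale[OF subspace_free_on])
  then show ?thesis unfolding glue_def
    using unbracket_graded[OF assms(1)]
    by (auto intro!: pm.subspace_neg[OF subspace_free_on] conc_in_graded)
qed

text \<open>The minus sign in \<open>glue\<close> is chosen to cancel the sign of the antipode on a
  letter.\<close>

lemma glue_comb_letter: "w \<noteq> [] \<Longrightarrow> glue (gen (comb w)) (gen (Atom b)) = gen (w @ [b])"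
  by (simp add: glue_def unbracket_comb antipode_def bilinear_ext_simps)

section \<open>Diagrams with vertices of valence one and three\<close>

lemma permutesI_funpow:
  assumes "\<And>x. x \<in> S \<Longrightarrow> f x \<in> S" "\<And>x. x \<notin> S \<Longrightarrow> f x = x"
    and "\<And>x. x \<in> S \<Longrightarrow> g (f x) = x \<and> f (g x) = x \<and> g x \<in> S"
  shows "f permutes S"
  using assms by (intro bij_imp_permutes bij_betw_byWitness[where f' = g]) auto

text \<open>The valence condition becomes the equation that \<open>rot\<close> cubed is the
  identity, so orbits have size 1 or 3. Connectivity and acyclicity are left out, because they have
  to be re-established after a change of the cyclic orders.\<close>

locale cubic_diagram =
  fixes D :: diagram
  assumes finite_darts: "finite (darts D)"
    and opp_permutes: "opp D permutes darts D"
    and rot_permutes: "rot D permutes darts D"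
    and opp_neq: "x \<in> darts D \<Longrightarrow> opp D x \<noteq> x"
    and opp_opp [simp]: "x \<in> darts D \<Longrightarrow> opp D (opp D x) = x"
    and rot_rot_rot [simp]: "x \<in> darts D \<Longrightarrow> rot D (rot D (rot D x)) = x"

lemma cubic_diagramI:
  assumes "finite (darts D)"
    and "\<And>x. x \<in> darts D \<Longrightarrow> opp D x \<in> darts D \<and> opp D x \<noteq> x \<and> opp D (opp D x) = x"
    and "\<And>x. x \<notin> darts D \<Longrightarrow> opp D x = x \<and> rot D x = x"
    and "\<And>x. x \<in> darts D \<Longrightarrow> rot D x \<in> darts D \<and> rot D (rot D (rot D x)) = x"
  shows "cubic_diagram D"
proof
  show "opp D permutes darts D"
    by (rule permutesI_funpow[where g = "opp D"]) (use assms in auto)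
  show "rot D permutes darts D"
    by (rule permutesI_funpow[where g = "\<lambda>x. rot D (rot D x)"]) (use assms in auto)
qed (use assms in auto)

text \<open>The steps of non-backtracking walks; each dart is taken at the vertex that the walk enters.\<close>

definition away :: "diagram \<Rightarrow> (nat \<times> nat) set"
  where "away D = {(x, opp D z) | x z. x \<in> darts D \<and> z \<in> vertex D x \<and> z \<noteq> x}"

context cubic_diagram
begin

lemma opp_in [simp]: "opp D x \<in> darts D \<longleftrightarrow> x \<in> darts D"
  using permutes_in_image[OF opp_permutes] .

lemma rot_in [simp]: "rot D x \<in> darts D \<longleftrightarrow> x \<in> darts D"
  using permutes_in_image[OF rot_permutes] .

lemma rot_outside: "x \<notin> darts D \<Longrightarrow> rot D x = x"
  using permutes_not_in[OF rot_permutes] .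

lemma rot_rot_eq_iff [simp]: "x \<in> darts D \<Longrightarrow> rot D (rot D x) = x \<longleftrightarrow> rot D x = x"
  by (metis rot_rot_rot)

lemma rot_rot_eq_rot_iff [simp]: "x \<in> darts D \<Longrightarrow> rot D (rot D x) = rot D x \<longleftrightarrow> rot D x = x"
  by (metis rot_rot_rot)

lemma vertex_eq: "x \<in> darts D \<Longrightarrow> vertex D x = {x, rot D x, rot D (rot D x)}"
proof -
  assume x: "x \<in> darts D"
  then have "(rot D ^^ 3) x = x" by (simp add: numeral_3_eq_3)
  then have "vertex D x = {(rot D ^^ m) x | m. m < 3}"
    unfolding vertex_def by (rule orbit_altdef_bounded) simp
  also have "\<dots> = (\<lambda>m. (rot D ^^ m) x) ` {..<3}" by auto
  also have "{..<3::nat} = {0, 1, 2}" by auto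
  finally show ?thesis by (simp add: numeral_2_eq_2)
qed

lemma vertex_self: "x \<in> darts D \<Longrightarrow> x \<in> vertex D x"
  by (simp add: vertex_eq)

lemma vertex_in_darts: "x \<in> darts D \<Longrightarrow> z \<in> vertex D x \<Longrightarrow> z \<in> darts D"
  by (auto simp: vertex_eq)

lemma vertex_cong: "x \<in> darts D \<Longrightarrow> z \<in> vertex D x \<Longrightarrow> vertex D z = vertex D x"
  by (auto simp: vertex_eq)

lemma vertex_rot [simp]: "x \<in> darts D \<Longrightarrow> vertex D (rot D x) = vertex D x"
  by (rule vertex_cong) (simp_all add: vertex_eq)

lemma valence_eq: "x \<in> darts D \<Longrightarrow> valence D x = (if rot D x = x then 1 else 3)"
proof (cases "rot D x = x")
  case False
  moreover assume x: "x \<in> darts D"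
  ultimately have "x \<noteq> rot D x" "x \<noteq> rot D (rot D x)" "rot D x \<noteq> rot D (rot D x)"
    by (metis rot_rot_eq_iff rot_rot_eq_rot_iff)+
  then show ?thesis using False x by (simp add: valence_def vertex_eq)
qed (simp add: valence_def vertex_eq)

lemma legs_eq: "legs D = {x \<in> darts D. rot D x = x}"
  by (auto simp: legs_def valence_eq split: if_splits)

lemma away_iff: "(x, y) \<in> away D \<longleftrightarrow>
    x \<in> darts D \<and> rot D x \<noteq> x \<and> (y = opp D (rot D x) \<or> y = opp D (rot D (rot D x)))"
  by (auto simp: away_def vertex_eq)

lemma awayI: "x \<in> darts D \<Longrightarrow> z \<in> vertex D x \<Longrightarrow> z \<noteq> x \<Longrightarrow> (x, opp D z) \<in> away D"
  by (auto simp: away_def)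

lemma away_in: "(x, y) \<in> away D \<Longrightarrow> x \<in> darts D \<and> y \<in> darts D"
  by (auto simp: away_iff)

lemma away_rtrancl_in: "(x, y) \<in> (away D)\<^sup>* \<Longrightarrow> x \<in> darts D \<Longrightarrow> y \<in> darts D"
  by (induction rule: rtrancl_induct) (auto dest: away_in)

lemma away_vertex: "(x, y) \<in> away D \<Longrightarrow> vertex D (opp D y) = vertex D x \<and> opp D y \<noteq> x"
proof -
  assume "(x, y) \<in> away D"
  then obtain z where z: "x \<in> darts D" "z \<in> vertex D x" "z \<noteq> x" "y = opp D z"
    by (auto simp: away_def)
  then have "opp D y = z" using vertex_in_darts by simp
  then show ?thesis using z vertex_cong by simp
qed

lemma away_reverse: "(x, y) \<in> away D \<Longrightarrow> (opp D y, opp D x) \<in> away D"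
  by (frule away_vertex, frule away_in) (metis awayI opp_in vertex_self)

lemma away_rtrancl_reverse: "(x, y) \<in> (away D)\<^sup>* \<Longrightarrow> (opp D y, opp D x) \<in> (away D)\<^sup>*"
  by (induction rule: rtrancl_induct) (auto dest: away_reverse)

lemma away_trancl_reverse: "(x, y) \<in> (away D)\<^sup>+ \<Longrightarrow> (opp D y, opp D x) \<in> (away D)\<^sup>+"
  by (induction rule: trancl_induct) (auto dest: away_reverse)

lemma closed_vertex:
  assumes "\<And>x. x \<in> Z \<Longrightarrow> x \<in> darts D \<Longrightarrow> rot D x \<in> Z" "x \<in> Z" "x \<in> darts D"
  shows "vertex D x \<subseteq> Z"
  using assms by (auto simp: vertex_eq)

text \<open>Connectivity as an induction principle on darts: a property that holds at one dart and
  passes along \<open>opp\<close> and \<open>rot\<close> holds everywhere.\<close>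

lemma connected_diagram_iff:
  "connected_diagram D \<longleftrightarrow> darts D \<noteq> {} \<and> (\<forall>Z. Z \<inter> darts D \<noteq> {} \<longrightarrow>
    (\<forall>x\<in>Z \<inter> darts D. opp D x \<in> Z \<and> rot D x \<in> Z) \<longrightarrow> darts D \<subseteq> Z)" (is "_ \<longleftrightarrow> _ \<and> (\<forall>Z. ?P Z)")
proof (intro iffI conjI allI impI)
  assume "connected_diagram D"
  then show "darts D \<noteq> {}" by (simp add: connected_diagram_def)
  fix Z assume Z: "Z \<inter> darts D \<noteq> {}" "\<forall>x\<in>Z \<inter> darts D. opp D x \<in> Z \<and> rot D x \<in> Z"
  then obtain x where x: "x \<in> Z" "x \<in> darts D" by blast
  have "v \<subseteq> Z" if "(vertex D x, v) \<in> (adjacency D)\<^sup>*" for v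
    using that
  proof (induction rule: rtrancl_induct)
    case base then show ?case using x Z(2) by (intro closed_vertex) auto
  next
    case (step u v)
    then obtain d where "d \<in> darts D" "u = vertex D d" "v = vertex D (opp D d)"
      by (auto simp: adjacency_def)
    moreover from this step(3) Z(2) have "opp D d \<in> Z" using vertex_self by blast
    ultimately show ?case using closed_vertex[of Z "opp D d"] Z(2) by auto
  qed
  moreover have "(vertex D x, vertex D y) \<in> (adjacency D)\<^sup>*" if "y \<in> darts D" for y
    using \<open>connected_diagram D\<close> x that by (auto simp: connected_diagram_def vertices_def)
  ultimately show "darts D \<subseteq> Z" using vertex_self by blast
next
  assume *: "darts D \<noteq> {} \<and> (\<forall>Z. ?P Z)"
  have "(vertex D x, vertex D y) \<in> (adjacency D)\<^sup>*" if "x \<in> darts D" "y \<in> darts D" for x y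
  proof -
    let ?Z = "{y \<in> darts D. (vertex D x, vertex D y) \<in> (adjacency D)\<^sup>*}"
    have "(vertex D y, vertex D (opp D y)) \<in> adjacency D" if "y \<in> darts D" for y
      using that by (auto simp: adjacency_def)
    then have "\<forall>y\<in>?Z \<inter> darts D. opp D y \<in> ?Z \<and> rot D y \<in> ?Z"
      by (auto intro: rtrancl_into_rtrancl)
    moreover have "x \<in> ?Z \<inter> darts D" using that by simp
    ultimately have "darts D \<subseteq> ?Z" using * by blast
    then show ?thesis using that by blast
  qed
  then show "connected_diagram D" using * by (auto simp: connected_diagram_def vertices_def)
qed

end

text \<open>\<open>reads D x t\<close>: the branch that begins at the dart \<open>x\<close> of its root vertex is the tree \<open>t\<close>.\<close>

inductive reads :: "diagram \<Rightarrow> nat \<Rightarrow> nat monomial \<Rightarrow> bool" for D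
  where
    leaf: "rot D x = x \<Longrightarrow> reads D x (Atom (lab D x))"
  | node: "rot D x \<noteq> x \<Longrightarrow> reads D (opp D (rot D x)) s \<Longrightarrow>
      reads D (opp D (rot D (rot D x))) t \<Longrightarrow> reads D x (Br s t)"

lemma reads_unique: "reads D x s \<Longrightarrow> reads D x t \<Longrightarrow> s = t"
proof (induction arbitrary: t rule: reads.induct)
  case (leaf x) from leaf(2) show ?case by cases (use leaf(1) in auto)
next
  case (node x s s')
  from node.prems show ?case by cases (use node.hyps node.IH in blast)+
qed

definition branch :: "diagram \<Rightarrow> nat \<Rightarrow> nat monomial"
  where "branch D x = (THE t. reads D x t)"

lemma branch_eqI: "reads D x t \<Longrightarrow> branch D x = t"
  unfolding branch_def by (blast intro: reads_unique)

section \<open>Acyclicity in terms of non-backtracking walks and finite trees\<close>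

locale tree_diagram = cubic_diagram +
  assumes no_cycle: "\<nexists>ds. is_cycle D ds"
    and connected: "connected_diagram D"
begin

lemma connected_induct:
  assumes "d \<in> darts D" "P d" "\<And>x. x \<in> darts D \<Longrightarrow> P x \<Longrightarrow> P (opp D x) \<and> P (rot D x)"
    and "x \<in> darts D"
  shows "P x"
proof -
  have "Collect P \<inter> darts D \<noteq> {} \<longrightarrow> (\<forall>x\<in>Collect P \<inter> darts D. opp D x \<in> Collect P \<and> rot D x \<in> Collect P)
      \<longrightarrow> darts D \<subseteq> Collect P"
    using conjunct2[OF connected[unfolded connected_diagram_iff]] by (rule spec)
  then show ?thesis using assms by auto
qed

text \<open>A first repetition of a vertex on a non-backtracking walk closes a cycle.\<close>

lemma walk_distinct_vertices:
  assumes walk: "\<And>i. i < n \<Longrightarrow> (f i, f (Suc i)) \<in> away D" and "0 < (n::nat)"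
  shows "vertex D (f 0) \<noteq> vertex D (f n)"
proof
  assume eq: "vertex D (f 0) = vertex D (f n)"
  let ?P = "\<lambda>k. k \<le> n \<and> (\<exists>j<k. vertex D (f j) = vertex D (f k))"
  \<comment> \<open>The first index at which a vertex is repeated, so that the vertices before it
    are distinct.\<close>
  define k where "k = (LEAST k. ?P k)"
  have "?P k" unfolding k_def by (rule LeastI[of ?P n]) (use eq \<open>0 < n\<close> in blast)
  then obtain j where j: "k \<le> n" "j < k" "vertex D (f j) = vertex D (f k)" by blast
  have dist: "vertex D (f i) \<noteq> vertex D (f i')" if "i < i'" "i' < k" for i i'
    using not_less_Least[of i' ?P] that j(1) unfolding k_def by auto
  have dart: "f i \<in> darts D" if "i \<le> k" for i
    using that j(1,2) away_in[OF walk] by (cases i) (force, metis Suc_le_lessD le_trans)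
  have v: "vertex D (opp D (f (Suc i))) = vertex D (f i)" if "i < k" for i
    using away_vertex[OF walk] that j(1) by auto
  \<comment> \<open>The dart \<open>f (Suc i)\<close> lies at the vertex being entered; a cycle is
    listed by the darts through which it leaves its vertices, hence \<open>opp\<close>.\<close>
  define g where "g i = opp D (f (Suc i))" for i
  define ds where "ds = map g [j..<k]"
  have len: "length ds = k - j" by (simp add: ds_def)
  have "is_cycle D ds"
    unfolding is_cycle_def
  proof (intro conjI allI impI)
    show "ds \<noteq> []" using j by (simp add: ds_def)
    show "set ds \<subseteq> darts D" using dart by (auto simp: ds_def g_def)
    fix i assume i: "i < length ds"
    then have "vertex D (opp D (ds ! i)) = vertex D (f (Suc (j + i)))"
      using dart by (simp add: ds_def g_def)
    moreover have "vertex D (ds ! (Suc i mod length ds)) = vertex D (f (Suc (j + i)))"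
    proof (cases "Suc i < length ds")
      case True
      then show ?thesis using v by (simp add: ds_def g_def)
    next
      case False
      with i have "Suc i = length ds" by simp
      then have "Suc (j + i) = k" "Suc i mod length ds = 0" using len j by auto
      then show ?thesis using v[OF j(2)] j by (simp add: ds_def g_def)
    qed
    ultimately show "vertex D (opp D (ds ! i)) = vertex D (ds ! (Suc i mod length ds))" by simp
  next
    have "inj_on (\<lambda>i. vertex D (g i)) {j..<k}"
      by (rule linorder_inj_onI) (use dist v in \<open>auto simp: g_def\<close>)
    then show "distinct (map (vertex D) ds)" by (simp add: ds_def distinct_map comp_def)
    have "inj_on (\<lambda>i. {g i, opp D (g i)}) {j..<k}"
    proof (rule linorder_inj_onI)
      fix i m assume im: "i < m" "i \<in> {j..<k}" "m \<in> {j..<k}"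
      show "{g i, opp D (g i)} \<noteq> {g m, opp D (g m)}"
      proof
        assume "{g i, opp D (g i)} = {g m, opp D (g m)}"
        then consider "g m = g i" | "opp D (g i) = g m" by (auto simp: doubleton_eq_iff)
        then show False
        proof cases
          case 1
          then have "vertex D (f i) = vertex D (f m)" using v[of i] v[of m] im by (simp add: g_def)
          then show False using dist im by auto
        next
          case 2
          \<comment> \<open>The edge would be traversed again in the opposite direction. As the
            vertices are distinct this can only happen at the very next step, which is
            backtracking.\<close>
          then have *: "opp D (f (Suc m)) = f (Suc i)" using dart im by (simp add: g_def)
          then have "vertex D (f (Suc i)) = vertex D (f m)" using v[of m] im by simp
          then have "m = Suc i" using dist[of "Suc i" m] im by (cases "Suc i < m") auto
          then show False using away_vertex[OF walk[of m]] * im j(1) by auto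
        qed
      qed
    qed auto
    then show "distinct (map (\<lambda>d. {d, opp D d}) ds)" by (simp add: ds_def distinct_map comp_def)
  qed
  then show False using no_cycle by blast
qed

lemma away_trancl_vertex: "(x, y) \<in> (away D)\<^sup>+ \<Longrightarrow> vertex D x \<noteq> vertex D y"
  unfolding trancl_power relpow_fun_conv using walk_distinct_vertices by blast

lemma away_trancl_irrefl: "(x, x) \<notin> (away D)\<^sup>+"
  using away_trancl_vertex by blast

text \<open>The last step of such a walk starts at another dart of the vertex of \<open>x\<close>,
  so the walk has already returned to that vertex.\<close>

lemma away_trancl_opp: "(x, opp D x) \<notin> (away D)\<^sup>+"
proof
  assume *: "(x, opp D x) \<in> (away D)\<^sup>+"
  then have x: "x \<in> darts D" by (meson away_in tranclD)
  from * obtain w where w: "(x, w) \<in> (away D)\<^sup>*" "(w, opp D x) \<in> away D" by (meson tranclD2)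
  from away_vertex[OF w(2)] x have "vertex D x = vertex D w" "x \<noteq> w" by auto
  with w(1) away_trancl_vertex show False by (metis rtranclD)
qed

text \<open>A walk into the branch behind \<open>x\<close> can be prolonged backwards by a step from
  \<open>rot D x\<close> across \<open>x\<close>, so a return to the vertex would be a
  repetition.\<close>

lemma branch_avoids:
  assumes "x \<in> darts D" "rot D x \<noteq> x" "(opp D x, y) \<in> (away D)\<^sup>*"
  shows "vertex D y \<noteq> vertex D x"
proof -
  have "(rot D x, opp D x) \<in> away D"
    using assms(1,2) by (intro awayI) (auto simp: vertex_eq)
  then have "(rot D x, y) \<in> (away D)\<^sup>+" using assms(3) by (rule rtrancl_into_trancl2)
  then show ?thesis using away_trancl_vertex assms(1) by (metis insertCI vertex_cong vertex_eq)
qed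

text \<open>The step relation is finite and acyclic, hence its converse is well-founded and permits
  recursion into the branches.\<close>

lemma reads_exists: "x \<in> darts D \<Longrightarrow> \<exists>t. reads D x t"
proof -
  have "finite (away D)"
    by (rule finite_subset[of _ "darts D \<times> darts D"]) (auto simp: finite_darts dest: away_in)
  then have "wf ((away D)\<inverse>)"
    by (rule finite_acyclic_wf_converse) (simp add: acyclic_def away_trancl_irrefl)
  then show "x \<in> darts D \<Longrightarrow> \<exists>t. reads D x t"
  proof (induction x rule: wf_induct_rule)
    case (less x)
    show ?case
    proof (cases "rot D x = x")
      case False
      then have "\<exists>s. reads D (opp D (rot D x)) s" "\<exists>t. reads D (opp D (rot D (rot D x))) t"
        using less by (auto simp: away_iff)
      then show ?thesis using reads.node[OF False] by blast
    qed (blast intro: reads.leaf)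
  qed
qed

lemma reads_branch: "x \<in> darts D \<Longrightarrow> reads D x (branch D x)"
  using reads_exists branch_eqI by metis

lemma branch_node:
  "x \<in> darts D \<Longrightarrow> rot D x \<noteq> x \<Longrightarrow>
    branch D x = Br (branch D (opp D (rot D x))) (branch D (opp D (rot D (rot D x))))"
  by (intro branch_eqI reads.node reads_branch) auto

end

text \<open>The converse direction: a derivation of \<open>reads\<close> is finite, and every walk
  from \<open>x\<close> descends in it.\<close>

lemma reads_no_closed_walk:
  assumes "cubic_diagram D" "reads D x t" "x \<in> darts D" "(x, y) \<in> (away D)\<^sup>*"
  shows "(y, y) \<notin> (away D)\<^sup>+"
  using assms(2-)
proof (induction arbitrary: y rule: reads.induct)
  interpret cubic_diagram D by (rule assms(1))
  case (leaf x)
  then have "(x, z) \<notin> away D" for z by (simp add: away_iff)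
  then show ?case using leaf(3) by (metis converse_rtranclE tranclD)
next
  interpret cubic_diagram D by (rule assms(1))
  case (node x s t)
  then have *: "(z, z) \<notin> (away D)\<^sup>+" if "(x, c) \<in> away D" "(c, z) \<in> (away D)\<^sup>*" for c z
    using that by (auto simp: away_iff)
  show ?case
  proof (cases "x = y")
    case True
    show ?thesis
    proof
      assume "(y, y) \<in> (away D)\<^sup>+"
      then obtain c where c: "(x, c) \<in> away D" "(c, x) \<in> (away D)\<^sup>*" using True tranclD by metis
      \<comment> \<open>A closed walk at \<open>x\<close> is shifted by one step to a closed walk at
        a child of \<open>x\<close>, where the induction hypothesis applies.\<close>
      then have "(c, c) \<in> (away D)\<^sup>+" by (meson rtrancl_into_trancl1)
      then show False using *[OF c(1)] by blast
    qed
  next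
    case False
    then obtain c where "(x, c) \<in> away D" "(c, y) \<in> (away D)\<^sup>*"
      using node.prems by (metis converse_rtranclE)
    then show ?thesis by (rule *)
  qed
qed

text \<open>The criterion by which all constructed diagrams are shown to be acyclic: trees on both
  sides of one edge, together with connectivity, exclude cycles everywhere.\<close>

lemma tree_diagramI:
  assumes "cubic_diagram D" "connected_diagram D" "d \<in> darts D" "reads D d s" "reads D (opp D d) t"
  shows "tree_diagram D"
proof -
  interpret cubic_diagram D by (rule assms(1))
  define R where "R = {x. (d, x) \<in> (away D)\<^sup>* \<or> (opp D d, x) \<in> (away D)\<^sup>*}"
  have RD: "x \<in> darts D" if "x \<in> R" for x
    using that assms(3) by (auto simp: R_def dest: away_rtrancl_in)
  have irrefl: "(x, x) \<notin> (away D)\<^sup>+" if "x \<in> R" for x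
    using that reads_no_closed_walk[OF assms(1) assms(4)] reads_no_closed_walk[OF assms(1) assms(5)] assms(3)
    by (auto simp: R_def)
  have R_step: "opp D y \<in> R" if "x \<in> R" "y \<in> vertex D x" "y \<noteq> x" for x y
    using awayI[OF RD[OF that(1)] that(2,3)] that(1) by (auto simp: R_def intro: rtrancl_into_rtrancl)
  have R_pred: "x = d \<or> x = opp D d \<or> (\<exists>w\<in>R. (w, x) \<in> away D)" if "x \<in> R" for x
    using that unfolding R_def by (auto elim: rtranclE)
  \<comment> \<open>Walks from the edge reach each further edge at its far end only, so
    \<open>R\<close> is completed by the opposite darts; the result is closed under
    \<open>opp\<close> and \<open>rot\<close> and hence everything.\<close>
  let ?Z = "{x \<in> darts D. x \<in> R \<or> opp D x \<in> R}"
  have R_vertex: "vertex D x \<subseteq> ?Z" if "x \<in> R" for x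
    using R_step[OF that] that RD[OF that] vertex_in_darts[OF RD[OF that]] by blast
  have "\<forall>x\<in>?Z \<inter> darts D. opp D x \<in> ?Z \<and> rot D x \<in> ?Z"
  proof (intro ballI conjI)
    fix x assume x: "x \<in> ?Z \<inter> darts D"
    then show "opp D x \<in> ?Z" by auto
    show "rot D x \<in> ?Z"
    proof (cases "x \<in> R")
      case True
      then show ?thesis using R_vertex[OF True] x by (auto simp: vertex_eq)
    next
      case False
      then have o: "opp D x \<in> R" using x by blast
      have d: "d \<in> R" "opp D d \<in> R" by (auto simp: R_def)
      have "opp D x \<noteq> d" "opp D x \<noteq> opp D d" using False d x assms(3) opp_opp by (metis Int_iff)+
      then obtain w where w: "w \<in> R" "(w, opp D x) \<in> away D" using R_pred[OF o] by blast
      from away_vertex[OF w(2)] x have "vertex D x = vertex D w" by auto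
      then have "rot D x \<in> vertex D w" using x vertex_eq by auto
      then show ?thesis using R_vertex[OF w(1)] by blast
    qed
  qed
  moreover have "d \<in> ?Z \<inter> darts D" using assms(3) by (auto simp: R_def)
  ultimately have Z: "darts D \<subseteq> ?Z" using assms(2) unfolding connected_diagram_iff by blast
  have "\<not> is_cycle D ds" for ds
  proof
    assume c: "is_cycle D ds"
    define m where "m = length ds"
    define f where "f i = opp D (ds ! (i mod m))" for i
    have m: "0 < m" using c by (simp add: m_def is_cycle_def)
    have ds: "ds ! i \<in> darts D" if "i < m" for i using c that by (auto simp: is_cycle_def m_def)
    have "(f i, f (Suc i)) \<in> away D" for i
    proof -
      define a where "a = i mod m"
      have a: "a < m" "Suc i mod m = Suc a mod m" using m by (auto simp: a_def mod_Suc_eq)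
      let ?b = "Suc a mod m"
      have b: "?b < m" using m by simp
      have v: "vertex D (opp D (ds ! a)) = vertex D (ds ! ?b)" using c a by (auto simp: is_cycle_def m_def)
      have "ds ! ?b \<noteq> opp D (ds ! a)"
      \<comment> \<open>If the next dart were the opposite of the present one, two entries would
        represent the same edge, against the distinctness of the edges.\<close>
      proof
        assume eq: "ds ! ?b = opp D (ds ! a)"
        then have "?b \<noteq> a" using opp_neq[OF ds[OF a(1)]] by auto
        moreover have "distinct (map (\<lambda>d. {d, opp D d}) ds)" using c by (simp add: is_cycle_def)
        moreover have "map (\<lambda>d. {d, opp D d}) ds ! ?b = map (\<lambda>d. {d, opp D d}) ds ! a"
          using a(1) b ds[OF a(1)] by (simp add: m_def[symmetric] eq insert_commute)
        ultimately show False
          using a(1) b nth_eq_iff_index_eq[of "map (\<lambda>d. {d, opp D d}) ds" ?b a] by (simp add: m_def[symmetric])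
      qed
      moreover have "ds ! ?b \<in> vertex D (opp D (ds ! a))" using v vertex_self ds[OF b] by simp
      ultimately show ?thesis unfolding f_def a(2) a_def[symmetric]
        using ds[OF a(1)] by (intro awayI) auto
    qed
    then have "(f 0, f m) \<in> away D ^^ m" unfolding relpow_fun_conv by blast
    moreover have "f m = f 0" by (simp add: f_def)
    ultimately have 1: "(f 0, f 0) \<in> (away D)\<^sup>+" using m trancl_power by metis
    \<comment> \<open>Only one of \<open>f 0\<close> and its opposite need lie in \<open>R\<close>;
      the reversed walk covers the second case.\<close>
    then have 2: "(opp D (f 0), opp D (f 0)) \<in> (away D)\<^sup>+" by (rule away_trancl_reverse)
    have "f 0 \<in> darts D" using ds m by (simp add: f_def)
    then show False using Z irrefl 1 2 by blast
  qed
  then show ?thesis using assms(2) by unfold_locales auto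
qed

text \<open>The valence is the period of \<open>rot\<close> at \<open>x\<close>, and both 1 and 3
  divide 3.\<close>

lemma rot_rot_rot_of_valence:
  assumes "rot D permutes darts D" "finite (darts D)" "valence D x = 1 \<or> valence D x = 3"
  shows "rot D (rot D (rot D x)) = x"
proof -
  let ?n = "funpow_dist1 (rot D) x x"
  have x: "x \<in> orbit (rot D) x"
    using assms(1,2) by (intro permutation_self_in_orbit) (auto simp: permutation_permutes)
  have "valence D x = ?n"
    unfolding valence_def vertex_def orbit_conv_funpow_dist1[OF x]
    by (simp add: card_image[OF inj_on_funpow_dist1[OF x]])
  moreover have "(rot D ^^ ?n) x = x" by (rule funpow_dist1_prop[OF x])
  ultimately show ?thesis using assms(3) by (auto simp: numeral_3_eq_3)
qed

lemma jacobi_diagrams_iff: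
  "D \<in> jacobi_diagrams p \<longleftrightarrow> tree_diagram D \<and> (\<forall>x\<in>darts D. rot D x = x \<longrightarrow> lab D x \<in> {1..p})"
proof
  assume D: "D \<in> jacobi_diagrams p"
  then interpret cubic_diagram D
    by unfold_locales (auto simp: jacobi_diagrams_def rot_rot_rot_of_valence)
  show "tree_diagram D \<and> (\<forall>x\<in>darts D. rot D x = x \<longrightarrow> lab D x \<in> {1..p})"
    using D legs_eq by (auto simp: jacobi_diagrams_def intro!: tree_diagram.intro tree_diagram_axioms.intro cubic_diagram_axioms)
next
  assume D: "tree_diagram D \<and> (\<forall>x\<in>darts D. rot D x = x \<longrightarrow> lab D x \<in> {1..p})"
  then interpret tree_diagram D by blast
  show "D \<in> jacobi_diagrams p"
    using D finite_darts opp_permutes rot_permutes opp_neq no_cycle connected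
    by (auto simp: jacobi_diagrams_def valence_eq legs_eq)
qed

section \<open>Changing the cyclic orders\<close>

text \<open>Here \<open>rot\<close> changes only on a union \<open>U\<close> of vertices. The
  hypothesis \<open>linked\<close> says that the new maps still hold \<open>U\<close> together; a
  set closed under the new maps is then closed under the old ones, which preserves
  connectivity.\<close>

lemma rot_surgery:
  assumes "cubic_diagram D" "connected_diagram D"
    and D': "darts D' = darts D" "opp D' = opp D" "\<And>x. x \<notin> U \<Longrightarrow> rot D' x = rot D x"
    and U: "U \<subseteq> darts D" "\<And>x. x \<in> U \<Longrightarrow> rot D x \<in> U"
    and U': "\<And>x. x \<in> U \<Longrightarrow> rot D' x \<in> U \<and> rot D' (rot D' (rot D' x)) = x"
    and linked: "\<And>Z. (\<forall>x\<in>Z \<inter> darts D. opp D x \<in> Z \<and> rot D' x \<in> Z) \<Longrightarrow> U \<inter> Z \<noteq> {} \<Longrightarrow> U \<subseteq> Z"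
  shows "cubic_diagram D'" "connected_diagram D'"
proof -
  interpret cubic_diagram D by (rule assms(1))
  have notU: "rot D x \<notin> U" if "x \<in> darts D" "x \<notin> U" for x
    using U(2) that rot_rot_rot by metis
  show cubic: "cubic_diagram D'"
  proof (rule cubic_diagramI)
    show "finite (darts D')" by (simp add: D' finite_darts)
    show "opp D' x \<in> darts D' \<and> opp D' x \<noteq> x \<and> opp D' (opp D' x) = x" if "x \<in> darts D'" for x
      using that opp_neq by (simp add: D')
    show "opp D' x = x \<and> rot D' x = x" if "x \<notin> darts D'" for x
    proof -
      have "x \<notin> darts D" "x \<notin> U" using that U(1) D'(1) by auto
      then show ?thesis using permutes_not_in[OF opp_permutes] by (simp add: D' rot_outside)
    qed
    show "rot D' x \<in> darts D' \<and> rot D' (rot D' (rot D' x)) = x" if "x \<in> darts D'" for x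
    proof (cases "x \<in> U")
      case True
      then show ?thesis using U' U(1) D'(1) by blast
    next
      case False
      then show ?thesis using that notU by (simp add: D')
    qed
  qed
  show "connected_diagram D'"
    unfolding cubic_diagram.connected_diagram_iff[OF cubic] D'(1,2)
  proof (intro conjI allI impI)
    show "darts D \<noteq> {}" using assms(2) connected_diagram_iff by blast
    fix Z assume Z: "Z \<inter> darts D \<noteq> {}" "\<forall>x\<in>Z \<inter> darts D. opp D x \<in> Z \<and> rot D' x \<in> Z"
    have "rot D x \<in> Z" if x: "x \<in> Z" "x \<in> darts D" for x
    proof (cases "x \<in> U")
      case True
      then have "U \<subseteq> Z" using linked[OF Z(2)] x by blast
      then show ?thesis using U(2) True by blast
    next
      case False
      have "rot D' x \<in> Z" using Z(2) x by blast
      then show ?thesis by (simp add: D'(3)[OF False])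
    qed
    then have "\<forall>x\<in>Z \<inter> darts D. opp D x \<in> Z \<and> rot D x \<in> Z" using Z(2) by blast
    then show "darts D \<subseteq> Z" using assms(2) Z(1) connected_diagram_iff by blast
  qed
qed

text \<open>A branch whose walks never enter the altered region reads the same.\<close>

lemma reads_cong:
  assumes "cubic_diagram D" "reads D x t" "x \<in> darts D"
    and "opp D' = opp D" "lab D' = lab D" "\<And>x. x \<notin> U \<Longrightarrow> rot D' x = rot D x"
    and U: "\<And>x. x \<in> U \<Longrightarrow> rot D x \<in> U"
    and avoid: "\<And>y. (x, y) \<in> (away D)\<^sup>* \<Longrightarrow> y \<notin> U"
  shows "reads D' x t"
  using assms(2,3) avoid
proof (induction rule: reads.induct)
  case (leaf x)
  then have "rot D' x = x" using assms(6) by auto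
  from reads.leaf[OF this] show ?case by (simp add: assms(5))
next
  interpret cubic_diagram D by (rule assms(1))
  case (node x s t)
  have x: "x \<notin> U" using node.prems by blast
  then have "rot D x \<notin> U" using U node.prems(1) rot_rot_rot by metis
  then have r: "rot D' x = rot D x" "rot D' (rot D x) = rot D (rot D x)" using x assms(6) by auto
  have "(x, opp D (rot D x)) \<in> away D" "(x, opp D (rot D (rot D x))) \<in> away D"
    using node by (auto simp: away_iff)
  then have "reads D' (opp D (rot D x)) s" "reads D' (opp D (rot D (rot D x))) t"
    using node by (auto intro: converse_rtrancl_into_rtrancl)
  then show ?case using node.hyps(1) by (intro reads.node) (simp_all add: r assms(4))
qed

text \<open>The branches at the flipped vertex never return to it, so they survive unchanged;
  reversing the cyclic order only exchanges the two that are read from \<open>d\<close>.\<close>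

lemma
  assumes D: "D \<in> jacobi_diagrams p" and d: "d \<in> darts D" "rot D d \<noteq> d"
  defines "D' \<equiv> flip_vertex D d"
  shows flip_vertex_jacobi: "D' \<in> jacobi_diagrams p"
    and branch_flip_vertex: "branch D' d = Br (branch D (opp D (rot D (rot D d)))) (branch D (opp D (rot D d)))"
    and branch_flip_vertex_opp: "branch D' (opp D' d) = branch D (opp D d)"
proof -
  interpret tree_diagram D using D by (simp add: jacobi_diagrams_iff)
  let ?U = "vertex D d"
  have U: "?U = {d, rot D d, rot D (rot D d)}" using d by (simp add: vertex_eq)
  have inv: "inv (rot D) x = rot D (rot D x)" if "x \<in> darts D" for x
    using that by (simp add: permutes_inv_eq[OF rot_permutes])
  have neq: "rot D d \<noteq> d" "rot D (rot D d) \<noteq> d" "rot D (rot D d) \<noteq> rot D d" using d by simp_all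
  have D': "darts D' = darts D" "opp D' = opp D" "lab D' = lab D"
    "\<And>x. x \<notin> ?U \<Longrightarrow> rot D' x = rot D x"
    by (simp_all add: D'_def flip_vertex_def)
  have rot': "rot D' d = rot D (rot D d)" "rot D' (rot D d) = d" "rot D' (rot D (rot D d)) = rot D d"
    using d by (simp_all add: D'_def flip_vertex_def inv U)
  have U_rot: "rot D x \<in> ?U" if "x \<in> ?U" for x using that d by (auto simp: U)
  have "?U \<subseteq> Z" if Z: "\<forall>x\<in>Z \<inter> darts D. opp D x \<in> Z \<and> rot D' x \<in> Z" "?U \<inter> Z \<noteq> {}" for Z
  proof -
    have *: "rot D' x \<in> Z" if "x \<in> Z" "x \<in> ?U" for x using Z(1) that vertex_in_darts d by blast
    have "d \<in> Z \<or> rot D d \<in> Z \<or> rot D (rot D d) \<in> Z" using Z(2) by (auto simp: U)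
    then show ?thesis using *[of d] *[of "rot D d"] *[of "rot D (rot D d)"] by (auto simp: U rot')
  qed
  note cc = rot_surgery[OF cubic_diagram_axioms connected D'(1,2,4) _ U_rot _ this]
  have cubic': "cubic_diagram D'" and connected': "connected_diagram D'"
    by (rule cc; use d in \<open>auto simp: U rot'\<close>)+
  have reads': "reads D' (opp D x) (branch D (opp D x))" if "x \<in> ?U" for x
  proof (rule reads_cong[OF cubic_diagram_axioms _ _ D'(2,3,4) U_rot])
    have x: "x \<in> darts D" "rot D x \<noteq> x"
      using that d neq unfolding U by (metis empty_iff insert_iff rot_in rot_rot_rot)+
    then show "reads D (opp D x) (branch D (opp D x))" "opp D x \<in> darts D"
      by (simp_all add: reads_branch)
    fix y assume "(opp D x, y) \<in> (away D)\<^sup>*"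
    from branch_avoids[OF x this] show "y \<notin> ?U" using vertex_cong that d by metis
  qed
  have r1: "reads D' d (Br (branch D (opp D (rot D (rot D d)))) (branch D (opp D (rot D d))))"
    by (rule reads.node) (use reads' d in \<open>auto simp: rot' D'(2) U\<close>)
  have r2: "reads D' (opp D' d) (branch D (opp D d))" using reads'[of d] by (simp add: U D'(2))
  show "branch D' d = Br (branch D (opp D (rot D (rot D d)))) (branch D (opp D (rot D d)))"
    "branch D' (opp D' d) = branch D (opp D d)"
    using r1 r2 by (simp_all add: branch_eqI)
  have "tree_diagram D'"
    by (rule tree_diagramI[OF cubic' connected' _ r1 r2]) (simp add: D' d)
  moreover have "lab D' x \<in> {1..p}" if "x \<in> darts D'" "rot D' x = x" for x
  proof -
    have "x \<notin> ?U" using that(2) neq unfolding U by (metis empty_iff insert_iff rot')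
    then show ?thesis using that D by (simp add: D' jacobi_diagrams_iff)
  qed
  ultimately show "D' \<in> jacobi_diagrams p" by (simp add: jacobi_diagrams_iff)
qed

text \<open>The walk into the branch behind \<open>w\<close> extends backwards to a walk from
  \<open>e\<close>, and further across the edge to a walk from the other end, so both end vertices
  are left for good.\<close>

lemma (in tree_diagram) branch_avoids_edge:
  assumes "e \<in> darts D" "rot D (opp D e) \<noteq> opp D e" "w \<in> vertex D e" "w \<noteq> e"
    and "(opp D w, y) \<in> (away D)\<^sup>*"
  shows "y \<notin> vertex D e" "y \<notin> vertex D (opp D e)"
proof -
  let ?c = "rot D (opp D e)"
  have "(e, opp D w) \<in> away D" using assms by (intro awayI)
  then have 1: "(e, y) \<in> (away D)\<^sup>+" using assms(5) by (rule rtrancl_into_trancl2)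
  have "opp D e \<in> vertex D ?c" "?c \<in> darts D" "vertex D ?c = vertex D (opp D e)"
    using assms(1) vertex_self by simp_all
  then have "(?c, opp D (opp D e)) \<in> away D" using assms(2) by (intro awayI) auto
  then have 2: "(?c, y) \<in> (away D)\<^sup>+" using 1 assms(1) by simp
  from away_trancl_vertex[OF 1] away_trancl_vertex[OF 2]
  show "y \<notin> vertex D e" "y \<notin> vertex D (opp D e)"
    using assms(1) vertex_cong[of e y] vertex_cong[of "opp D e" y] by auto
qed

text \<open>This covers both regroupings of the six darts \<open>U\<close> around the edge of an IHX triple.\<close>

lemma regroup_jacobi:
  assumes D: "D \<in> jacobi_diagrams p" and e: "e \<in> darts D" "rot D e \<noteq> e" "rot D (opp D e) \<noteq> opp D e"
    and U: "U = vertex D e \<union> vertex D (opp D e)"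
    and D': "darts D' = darts D" "opp D' = opp D" "lab D' = lab D" "\<And>x. x \<notin> U \<Longrightarrow> rot D' x = rot D x"
    and U': "\<And>x. x \<in> U \<Longrightarrow> rot D' x \<in> U \<and> rot D' x \<noteq> x \<and> rot D' (rot D' (rot D' x)) = x"
    and E: "U \<subseteq> {e, rot D' e, rot D' (rot D' e), opp D e, rot D' (opp D e), rot D' (rot D' (opp D e))}"
  shows "\<And>w. w \<in> U \<Longrightarrow> w \<noteq> e \<Longrightarrow> w \<noteq> opp D e \<Longrightarrow> reads D' (opp D w) (branch D (opp D w))"
    and "d \<in> darts D \<Longrightarrow> reads D' d s \<Longrightarrow> reads D' (opp D d) t \<Longrightarrow> D' \<in> jacobi_diagrams p"
proof -
  interpret tree_diagram D using D by (simp add: jacobi_diagrams_iff)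
  have Ud: "U \<subseteq> darts D" 
    using e(1) vertex_in_darts[of e] vertex_in_darts[of "opp D e"] unfolding U opp_in by blast
  have U_rot: "rot D x \<in> U" if "x \<in> U" for x using that e by (auto simp: U vertex_eq)
  show r: "reads D' (opp D w) (branch D (opp D w))" if w: "w \<in> U" "w \<noteq> e" "w \<noteq> opp D e" for w
  proof (rule reads_cong[OF cubic_diagram_axioms _ _ D'(2,3,4) U_rot])
    show "reads D (opp D w) (branch D (opp D w))" "opp D w \<in> darts D"
      using w(1) Ud by (auto intro!: reads_branch)
    fix y assume y: "(opp D w, y) \<in> (away D)\<^sup>*"
    consider "w \<in> vertex D e" | "w \<in> vertex D (opp D e)" using w(1) U by blast
    then show "y \<notin> U"
      using branch_avoids_edge[of e w y] branch_avoids_edge[of "opp D e" w y] w e y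
      by cases (auto simp: U)
  qed
  assume d: "d \<in> darts D" "reads D' d s" "reads D' (opp D d) t"
  have "U \<subseteq> Z" if Z: "\<forall>x\<in>Z \<inter> darts D. opp D x \<in> Z \<and> rot D' x \<in> Z" "U \<inter> Z \<noteq> {}" for Z
  proof -
    have *: "rot D' x \<in> Z" if "x \<in> Z" "x \<in> U" for x using Z(1) that Ud by blast
    have pull: "x \<in> Z" if "rot D' x \<in> Z" "x \<in> U" for x
      using *[of "rot D' x"] *[of "rot D' (rot D' x)"] that U' by metis
    have eU: "e \<in> U" "opp D e \<in> U" using e vertex_self by (auto simp: U)
    have oe: "e \<in> Z \<longleftrightarrow> opp D e \<in> Z" using Z(1) e(1) by (metis IntI opp_in opp_opp)
    from Z(2) obtain x where x: "x \<in> U" "x \<in> Z" by blast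
    \<comment> \<open>By \<open>E\<close> the dart \<open>x\<close> lies on the new vertex of
      \<open>e\<close> or of \<open>opp D e\<close>. Going backwards along \<open>rot D'\<close>
      reaches that end of the edge, and \<open>opp\<close> leads to the other.\<close>
    have "e \<in> Z"
      using x E pull[of e] pull[of "rot D' e"] pull[of "opp D e"] pull[of "rot D' (opp D e)"] eU U' oe
      by blast
    then show ?thesis using E oe * eU U' by blast
  qed
  note cc = rot_surgery[OF cubic_diagram_axioms connected D'(1,2,4) Ud U_rot _ this]
  have "cubic_diagram D'" "connected_diagram D'" using cc U' by blast+
  then have "tree_diagram D'" by (rule tree_diagramI[of D' d s t]) (use d in \<open>simp_all add: D'\<close>)
  moreover have "lab D' x \<in> {1..p}" if "x \<in> darts D'" "rot D' x = x" for x
    using that D U'[of x] D'(4)[of x] by (cases "x \<in> U") (auto simp: D' jacobi_diagrams_iff)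
  ultimately show "D' \<in> jacobi_diagrams p" by (simp add: jacobi_diagrams_iff)
qed

text \<open>The edge \<open>e\<close> and its four branches persist in all three diagrams. Read from
  the root side \<open>r\<close>, they give the three terms of the Jacobi identity, with the same
  tree \<open>R\<close> across \<open>r\<close>.\<close>

lemma ihx_branches:
  assumes D: "D \<in> jacobi_diagrams p" and e: "e \<in> darts D" "rot D e \<noteq> e" "rot D (opp D e) \<noteq> opp D e"
  defines "a \<equiv> rot D e" and "b \<equiv> rot D (rot D e)" and "e' \<equiv> opp D e"
    and "c \<equiv> rot D (opp D e)" and "r \<equiv> rot D (rot D (opp D e))"
  defines "H \<equiv> D\<lparr>rot := cyc3 (cyc3 (rot D) b c e) a e' r\<rparr>"
    and "X \<equiv> D\<lparr>rot := cyc3 (cyc3 (rot D) a c e) e' b r\<rparr>"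
    and "A \<equiv> branch D (opp D a)" and "B \<equiv> branch D (opp D b)" and "C \<equiv> branch D (opp D c)"
    and "R \<equiv> branch D (opp D r)"
  shows "ihx_triple D H X" "H \<in> jacobi_diagrams p" "X \<in> jacobi_diagrams p"
    and "r \<in> darts D" "branch D r = Br (Br A B) C"
    and "branch H r = Br A (Br B C)" "branch H (opp H r) = R"
    and "branch X r = Br (Br A C) B" "branch X (opp X r) = R"
proof -
  interpret tree_diagram D using D by (simp add: jacobi_diagrams_iff)
  have e': "e' \<in> darts D" using e by (simp add: e'_def)
  have rots: "rot D e = a" "rot D a = b" "rot D b = e" "rot D e' = c" "rot D c = r" "rot D r = e'"
    using e by (simp_all add: a_def b_def c_def r_def e'_def)
  have opps: "opp D e = e'" "opp D e' = e" using e by (simp_all add: e'_def)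
  have darts: "a \<in> darts D" "b \<in> darts D" "c \<in> darts D" "r \<in> darts D"
    using e by (simp_all add: a_def b_def c_def r_def)
  then show "r \<in> darts D" by simp
  have vs: "vertex D e = {e, a, b}" "vertex D e' = {e', c, r}"
    using e e' by (auto simp: vertex_eq rots)
  have n1: "a \<noteq> e" "b \<noteq> e" "a \<noteq> b" "c \<noteq> e'" "r \<noteq> e'" "c \<noteq> r"
    using rot_rot_eq_iff[of e] rot_rot_eq_rot_iff[of e] rot_rot_eq_iff[of e'] rot_rot_eq_rot_iff[of e'] e e'
    by (auto simp: rots e'_def[symmetric])
  \<comment> \<open>A step across the edge shows that its end vertices differ; so the six darts are
    distinct, and the nested updates by \<open>cyc3\<close> can be evaluated.\<close>
  have "(c, e) \<in> away D" using awayI[of c e'] darts n1 opps vertex_rot[OF e'] by (simp add: rots vs)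
  then have "vertex D c \<noteq> vertex D e" using away_trancl_vertex by blast
  then have "vertex D e' \<noteq> vertex D e" using vertex_rot[OF e'] by (simp add: rots)
  then have "x \<noteq> y" if "x \<in> vertex D e" "y \<in> vertex D e'" for x y
    using vertex_cong[OF e(1), of x] vertex_cong[OF e', of y] that by auto
  then have n2: "e \<noteq> e'" "e \<noteq> c" "e \<noteq> r" "a \<noteq> e'" "a \<noteq> c" "a \<noteq> r" "b \<noteq> e'" "b \<noteq> c" "b \<noteq> r"
    unfolding vs by blast+
  note n = n1 n2 n1[symmetric] n2[symmetric]
  show "ihx_triple D H X"
    unfolding ihx_triple_def Let_def H_def X_def a_def b_def c_def r_def e'_def
    using e by (intro bexI[of _ e]) (auto simp: valence_eq)
  define U where "U = vertex D e \<union> vertex D (opp D e)"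
  have U_eq: "U = {e, a, b, e', c, r}" by (auto simp: U_def opps vs)
  show "branch D r = Br (Br A B) C"
    using branch_node[of r] branch_node[of e] e darts n by (simp add: rots opps A_def B_def C_def)
  have H: "darts H = darts D" "opp H = opp D" "lab H = lab D" "\<And>x. x \<notin> U \<Longrightarrow> rot H x = rot D x"
    by (auto simp: H_def U_eq cyc3_def)
  have rotH: "rot H e = b" "rot H b = c" "rot H c = e" "rot H a = e'" "rot H e' = r" "rot H r = a"
    using n by (simp_all add: H_def cyc3_def)
  have X: "darts X = darts D" "opp X = opp D" "lab X = lab D" "\<And>x. x \<notin> U \<Longrightarrow> rot X x = rot D x"
    by (auto simp: X_def U_eq cyc3_def)
  have rotX: "rot X e = a" "rot X a = c" "rot X c = e" "rot X e' = b" "rot X b = r" "rot X r = e'"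
    using n by (simp_all add: X_def cyc3_def)
  have UH: "rot H x \<in> U \<and> rot H x \<noteq> x \<and> rot H (rot H (rot H x)) = x"
    and UX: "rot X x \<in> U \<and> rot X x \<noteq> x \<and> rot X (rot X (rot X x)) = x" if "x \<in> U" for x
    using that n unfolding U_eq by (auto simp: rotH rotX)
  have EH: "U \<subseteq> {e, rot H e, rot H (rot H e), opp D e, rot H (opp D e), rot H (rot H (opp D e))}"
    and EX: "U \<subseteq> {e, rot X e, rot X (rot X e), opp D e, rot X (opp D e), rot X (rot X (opp D e))}"
    unfolding U_eq by (auto simp: rotH rotX opps)
  note regroupH = regroup_jacobi[OF D e U_def H UH EH]
  note regroupX = regroup_jacobi[OF D e U_def X UX EX]
  have rH: "reads H (opp D a) A" "reads H (opp D b) B" "reads H (opp D c) C" "reads H (opp D r) R"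
    unfolding A_def B_def C_def R_def by (intro regroupH(1); use n in \<open>simp add: U_eq opps\<close>)+
  have rX: "reads X (opp D a) A" "reads X (opp D b) B" "reads X (opp D c) C" "reads X (opp D r) R"
    unfolding A_def B_def C_def R_def by (intro regroupX(1); use n in \<open>simp add: U_eq opps\<close>)+
  have "reads H e (Br B C)" by (rule reads.node) (use rH n in \<open>simp_all add: rotH H\<close>)
  then have rH': "reads H r (Br A (Br B C))"
    by (intro reads.node) (use rH n in \<open>simp_all add: rotH H opps\<close>)
  have "reads X e (Br A C)" by (rule reads.node) (use rX n in \<open>simp_all add: rotX X\<close>)
  then have rX': "reads X r (Br (Br A C) B)"
    by (intro reads.node) (use rX n in \<open>simp_all add: rotX X opps\<close>)
  show "H \<in> jacobi_diagrams p" by (rule regroupH(2)[OF _ _ darts(4) rH' rH(4)])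
  show "X \<in> jacobi_diagrams p" by (rule regroupX(2)[OF _ _ darts(4) rX' rX(4)])
  show "branch H r = Br A (Br B C)" "branch H (opp H r) = R"
    "branch X r = Br (Br A C) B" "branch X (opp X r) = R"
    using rH' rH(4) rX' rX(4) by (simp_all add: branch_eqI H X)
qed

section \<open>The diagram of two rooted trees joined by an edge\<close>

text \<open>
  Paths are read from the end: the head of the list is the last step, \<open>True\<close> leading to the left.
\<close>

fun at_path :: "'a monomial \<Rightarrow> bool list \<Rightarrow> 'a monomial option"
  where
    "at_path m [] = Some m"
  | "at_path m (b # q) =
      (case at_path m q of Some (Br s t) \<Rightarrow> Some (if b then s else t) | _ \<Rightarrow> None)"

lemma at_path_Cons_iff: "at_path m (b # q) = Some u \<longleftrightarrow>
    (\<exists>s t. at_path m q = Some (Br s t) \<and> u = (if b then s else t))"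
  by (auto split: option.splits monomial.splits)

lemma at_path_Atom: "at_path (Atom a) q = (if q = [] then Some (Atom a) else None)"
  by (induction q) auto

lemma at_path_snoc: "at_path (Br s t) (q @ [b]) = at_path (if b then s else t) q"
  by (induction q) auto

lemma atoms_at_path: "at_path m q = Some u \<Longrightarrow> atoms u \<subseteq> atoms m"
proof (induction q arbitrary: u)
  case (Cons b q)
  then obtain s t where "at_path m q = Some (Br s t)" "u = (if b then s else t)"
    unfolding at_path_Cons_iff by blast
  with Cons.IH show ?case by auto
qed simp

lemma finite_paths: "finite {q. at_path m q \<noteq> None}"
proof (induction m)
  case (Br s t)
  have "{q. at_path (Br s t) q \<noteq> None}
    \<subseteq> insert [] ((\<lambda>q. q @ [True]) ` {q. at_path s q \<noteq> None} \<union> (\<lambda>q. q @ [False]) ` {q. at_path t q \<noteq> None})"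
  proof
    fix q assume q: "q \<in> {q. at_path (Br s t) q \<noteq> None}"
    show "q \<in> insert [] ((\<lambda>q. q @ [True]) ` {q. at_path s q \<noteq> None} \<union> (\<lambda>q. q @ [False]) ` {q. at_path t q \<noteq> None})"
    proof (cases q rule: rev_cases)
      case (snoc q' b)
      then show ?thesis using q by (cases b) (simp_all add: at_path_snoc)
    qed simp
  qed
  then show ?case by (rule finite_subset) (use Br in simp)
qed (auto simp: at_path_Atom)

lemma card_leaf_paths: "card {q. \<exists>a. at_path m q = Some (Atom a)} = degree_mono m"
proof (induction m)
  case (Atom a)
  have "{q. \<exists>b. at_path (Atom a) q = Some (Atom b)} = {[]}" by (auto simp: at_path_Atom)
  then show ?case by simp
next
  case (Br s t)
  let ?L = "\<lambda>m. {q. \<exists>a. at_path m q = Some (Atom a)}"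
  have "?L (Br s t) = (\<lambda>q. q @ [True]) ` ?L s \<union> (\<lambda>q. q @ [False]) ` ?L t"
  proof (intro set_eqI iffI)
    fix q assume q: "q \<in> ?L (Br s t)"
    show "q \<in> (\<lambda>q. q @ [True]) ` ?L s \<union> (\<lambda>q. q @ [False]) ` ?L t"
    proof (cases q rule: rev_cases)
      case (snoc q' b)
      then show ?thesis using q by (cases b) (simp_all add: at_path_snoc)
    qed (use q in simp)
  qed (auto simp: at_path_snoc)
  moreover have "finite (?L m)" for m :: "'a monomial"
    by (rule finite_subset[OF _ finite_paths[of m]]) auto
  ultimately have "card (?L (Br s t)) = card ((\<lambda>q. q @ [True]) ` ?L s) + card ((\<lambda>q. q @ [False]) ` ?L t)"
    by (simp only:) (rule card_Un_disjoint, auto)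
  then show ?case using Br by (simp add: card_image inj_on_def)
qed

text \<open>
  In the diagram of \<open>Br s t\<close> the root vertex is suppressed, so that the two edges there become one.
  The edge above the subtree at \<open>q\<close> has the dart \<open>(q, True)\<close> at the root of that subtree and, unless
  the path \<open>q\<close> has length one, the dart \<open>(q, False)\<close> at the vertex above.
\<close>

type_synonym path_dart = "bool list \<times> bool"

definition path_darts :: "'a monomial \<Rightarrow> path_dart set"
  where "path_darts m = {(q, u). at_path m q \<noteq> None \<and> q \<noteq> [] \<and> (u \<or> tl q \<noteq> [])}"

fun path_opp :: "path_dart \<Rightarrow> path_dart"
  where "path_opp (q, u) = (if tl q = [] then ([\<not> hd q], True) else (q, \<not> u))"

text \<open>The cyclic order at a trivalent vertex is parent, left, right, as \<open>reads\<close>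
  expects it.\<close>

fun path_rot :: "'a monomial \<Rightarrow> path_dart \<Rightarrow> path_dart"
  where
    "path_rot m (q, True) = (case at_path m q of Some (Br s t) \<Rightarrow> (True # q, False) | _ \<Rightarrow> (q, True))"
  | "path_rot m (True # q, False) = (False # q, False)"
  | "path_rot m (False # q, False) = (q, True)"
  | "path_rot m ([], False) = ([], False)"

text \<open>The path darts are encoded as natural numbers, the type that \<open>diagram\<close>
  requires; \<open>opp\<close> and \<open>rot\<close> are the identity elsewhere, so that they
  permute the darts.\<close>

definition joined :: "nat monomial \<Rightarrow> diagram"
  where "joined m = \<lparr>darts = to_nat ` path_darts m,
    opp = (\<lambda>n. if n \<in> to_nat ` path_darts m then to_nat (path_opp (from_nat n)) else n),
    rot = (\<lambda>n. if n \<in> to_nat ` path_darts m then to_nat (path_rot m (from_nat n)) else n),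
    lab = (\<lambda>n. case at_path m (fst (from_nat n :: path_dart)) of Some (Atom a) \<Rightarrow> a | _ \<Rightarrow> 0)\<rparr>"

lemma joined_simps:
  "darts (joined m) = to_nat ` path_darts m"
  "x \<in> path_darts m \<Longrightarrow> opp (joined m) (to_nat x) = to_nat (path_opp x)"
  "x \<in> path_darts m \<Longrightarrow> rot (joined m) (to_nat x) = to_nat (path_rot m x)"
  "n \<notin> to_nat ` path_darts m \<Longrightarrow> opp (joined m) n = n \<and> rot (joined m) n = n"
  by (simp_all add: joined_def)

lemma path_darts_cases:
  assumes "x \<in> path_darts m"
  obtains (leaf) q a where "x = (q, True)" "q \<noteq> []" "at_path m q = Some (Atom a)"
    | (node) q s t where "q \<noteq> []" "at_path m q = Some (Br s t)"
        "x = (q, True) \<or> x = (True # q, False) \<or> x = (False # q, False)"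
proof -
  obtain q u where x: "x = (q, u)" by force
  show thesis
  proof (cases u)
    case True
    obtain t where t: "at_path m q = Some t" "q \<noteq> []" using assms by (auto simp: x path_darts_def)
    show thesis
    proof (cases t)
      case (Atom a) then show ?thesis using leaf x True t by simp
    next
      case (Br l r) then show ?thesis using node[of q l r] x True t by simp
    qed
  next
    case False
    then obtain b q' where q: "q = b # q'" "q' \<noteq> []" "at_path m q \<noteq> None"
      using assms by (cases q) (auto simp: x path_darts_def)
    then obtain s t where "at_path m q' = Some (Br s t)"
      by (auto split: option.splits monomial.splits)
    then show thesis using node[of q' s t] x q False by (cases b) auto
  qed
qed

lemma path_dart_node:
  assumes "q \<noteq> []" "at_path m q = Some (Br s t)"
  shows "(q, True) \<in> path_darts m" "(b # q, u) \<in> path_darts m"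
    "path_rot m (q, True) = (True # q, False)" "path_rot m (True # q, False) = (False # q, False)"
    "path_rot m (False # q, False) = (q, True)" "path_opp (b # q, u) = (b # q, \<not> u)"
  using assms by (auto simp: path_darts_def)

lemma path_dart_leaf:
  assumes "q \<noteq> []" "at_path m q = Some (Atom a)"
  shows "(q, True) \<in> path_darts m" "path_rot m (q, True) = (q, True)"
  using assms by (auto simp: path_darts_def)

lemma path_opp_in:
  assumes "x \<in> path_darts m"
  shows "path_opp x \<in> path_darts m \<and> path_opp x \<noteq> x \<and> path_opp (path_opp x) = x"
proof -
  obtain q u where x: "x = (q, u)" by force
  show ?thesis
  proof (cases "tl q = []")
    case True
    then obtain b where "q = [b]" "u" "at_path m [b] \<noteq> None"
      using assms by (cases q) (auto simp: x path_darts_def)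
    then show ?thesis by (auto simp: x path_darts_def split: option.splits monomial.splits)
  next
    case False
    then show ?thesis using assms by (auto simp: x path_darts_def)
  qed
qed

lemma path_rot_in:
  assumes "x \<in> path_darts m"
  shows "path_rot m x \<in> path_darts m \<and> path_rot m (path_rot m (path_rot m x)) = x"
  using assms
proof (cases rule: path_darts_cases)
  case (leaf q a)
  then show ?thesis using path_dart_leaf[of q m a] by auto
next
  case (node q s t)
  then show ?thesis using path_dart_node[OF node(1,2)] by metis
qed

lemma cubic_joined: "cubic_diagram (joined m)"
proof (rule cubic_diagramI)
  have "path_darts m \<subseteq> {q. at_path m q \<noteq> None} \<times> UNIV" by (auto simp: path_darts_def)
  then have "finite (path_darts m)" by (rule finite_subset) (use finite_paths[of m] in simp)
  then show "finite (darts (joined m))" by (simp add: joined_simps)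
  show "opp (joined m) x = x \<and> rot (joined m) x = x" if "x \<notin> darts (joined m)" for x
    using that by (simp add: joined_simps)
  show "opp (joined m) x \<in> darts (joined m) \<and> opp (joined m) x \<noteq> x \<and> opp (joined m) (opp (joined m) x) = x"
    if x: "x \<in> darts (joined m)" for x
  proof -
    obtain y where "x = to_nat y" "y \<in> path_darts m" using x by (auto simp: joined_simps)
    then show ?thesis using path_opp_in[of y m] by (simp add: joined_simps)
  qed
  show "rot (joined m) x \<in> darts (joined m) \<and> rot (joined m) (rot (joined m) (rot (joined m) x)) = x"
    if x: "x \<in> darts (joined m)" for x
  proof -
    obtain y where y: "x = to_nat y" "y \<in> path_darts m" using x by (auto simp: joined_simps)
    then show ?thesis using path_rot_in[of y m] path_rot_in[of "path_rot m y" m] by (simp add: joined_simps)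
  qed
qed

abbreviation path_dart :: "bool list \<Rightarrow> nat"
  where "path_dart q \<equiv> to_nat (q, True)"

text \<open>Every dart is linked to the root edge by following its path upwards, one letter at a
  time.\<close>

lemma connected_joined: "connected_diagram (joined (Br s t))"
proof -
  let ?m = "Br s t" and ?D = "joined (Br s t)"
  interpret cubic_diagram ?D by (rule cubic_joined)
  have root: "([b], True) \<in> path_darts ?m" for b by (simp add: path_darts_def)
  show ?thesis
    unfolding connected_diagram_iff
  proof (intro conjI allI impI)
    show "darts ?D \<noteq> {}" using root by (auto simp: joined_simps)
    fix Z assume Z: "Z \<inter> darts ?D \<noteq> {}" "\<forall>x\<in>Z \<inter> darts ?D. opp ?D x \<in> Z \<and> rot ?D x \<in> Z"
    have opp: "opp ?D x \<in> Z \<longleftrightarrow> x \<in> Z" if "x \<in> darts ?D" for x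
      using Z(2) that by (metis IntI opp_in opp_opp)
    have rot: "rot ?D x \<in> Z \<longleftrightarrow> x \<in> Z" if "x \<in> darts ?D" for x
      using Z(2) that by (metis IntI rot_in rot_rot_rot)
    have opp': "to_nat (path_opp x) \<in> Z \<longleftrightarrow> to_nat x \<in> Z" if "x \<in> path_darts ?m" for x
      using opp[of "to_nat x"] that by (simp add: joined_simps)
    have rot': "to_nat (path_rot ?m x) \<in> Z \<longleftrightarrow> to_nat x \<in> Z" if "x \<in> path_darts ?m" for x
      using rot[of "to_nat x"] that by (simp add: joined_simps)
    have all: "path_dart q \<in> Z \<longleftrightarrow> path_dart [True] \<in> Z" if "q \<noteq> []" "at_path ?m q \<noteq> None" for q
      using that
    proof (induction q)
      case (Cons b q)
      show ?case
      proof (cases "q = []")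
        case True
        then show ?thesis using opp'[OF root[of True]] by (cases b) auto
      next
        case False
        with Cons.prems obtain l r where q: "at_path ?m q = Some (Br l r)"
          by (auto split: option.splits monomial.splits simp del: at_path.simps(1))
        note n = path_dart_node[OF False q]
        have "path_dart (b # q) \<in> Z \<longleftrightarrow> to_nat (b # q, False) \<in> Z"
          using opp'[OF n(2)[of b True]] n(6)[of b True] by simp
        also have "\<dots> \<longleftrightarrow> path_dart q \<in> Z"
          using rot'[OF n(1)] rot'[OF n(2)[of True False]] n by (cases b) simp_all
        also have "\<dots> \<longleftrightarrow> path_dart [True] \<in> Z" using Cons.IH False q by simp
        finally show ?thesis .
      qed
    qed simp
    have all': "to_nat x \<in> Z \<longleftrightarrow> path_dart [True] \<in> Z" if x: "x \<in> path_darts ?m" for x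
    proof -
      obtain q u where qu: "x = (q, u)" by force
      have q: "q \<noteq> []" "at_path ?m q \<noteq> None" using x by (auto simp: qu path_darts_def)
      show ?thesis
      proof (cases u)
        case False
        then have "path_opp x = (q, True)" using x by (auto simp: qu path_darts_def)
        then show ?thesis using opp'[OF x] all[OF q] by simp
      qed (use all[OF q] qu in simp)
    qed
    then have "path_dart [True] \<in> Z" using Z(1) by (auto simp: joined_simps)
    then show "darts ?D \<subseteq> Z" using all' by (auto simp: joined_simps)
  qed
qed

lemma reads_joined:
  assumes "q \<noteq> []" "at_path m q = Some t"
  shows "reads (joined m) (path_dart q) t"
  using assms
proof (induction t arbitrary: q)
  case (Atom a)
  have "reads (joined m) (path_dart q) (Atom (lab (joined m) (path_dart q)))"
    by (rule reads.leaf) (simp add: joined_simps path_dart_leaf[OF Atom] Atom)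
  then show ?case by (simp add: joined_def Atom)
next
  case (Br s t)
  note n = path_dart_node[OF Br.prems]
  have "reads (joined m) (path_dart (True # q)) s" "reads (joined m) (path_dart (False # q)) t"
    using Br by simp_all
  then show ?case
    by (intro reads.node) (simp_all only: joined_simps n not_False_eq_True, simp)
qed

lemma
  assumes "Br s t \<in> monomials p"
  shows joined_jacobi: "joined (Br s t) \<in> jacobi_diagrams p"
    and joined_dart: "path_dart [True] \<in> darts (joined (Br s t))"
    and branch_joined: "branch (joined (Br s t)) (path_dart [True]) = s"
    and branch_joined_opp: "branch (joined (Br s t)) (opp (joined (Br s t)) (path_dart [True])) = t"
proof -
  let ?m = "Br s t" and ?D = "joined (Br s t)"
  have root: "([True], True) \<in> path_darts ?m" by (simp add: path_darts_def)
  then show d: "path_dart [True] \<in> darts ?D" by (simp add: joined_simps)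
  have r1: "reads ?D (path_dart [True]) s" by (rule reads_joined) simp_all
  have "reads ?D (path_dart [False]) t" by (rule reads_joined) simp_all
  then have r2: "reads ?D (opp ?D (path_dart [True])) t" using root by (simp add: joined_simps)
  show "branch ?D (path_dart [True]) = s" "branch ?D (opp ?D (path_dart [True])) = t"
    using r1 r2 by (simp_all add: branch_eqI)
  have "tree_diagram ?D" by (rule tree_diagramI[OF cubic_joined connected_joined d r1 r2])
  moreover have "lab ?D x \<in> {1..p}" if x: "x \<in> darts ?D" "rot ?D x = x" for x
  proof -
    obtain y where y: "x = to_nat y" "y \<in> path_darts ?m" using x(1) by (auto simp: joined_simps)
    then have fixed: "path_rot ?m y = y" using x(2) by (simp add: joined_simps)
    from y(2) show ?thesis
    proof (cases rule: path_darts_cases)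
      case (leaf q a)
      then have "lab ?D x = a" "a \<in> atoms ?m" using atoms_at_path[OF leaf(3)] by (auto simp: joined_def y(1))
      then show ?thesis using assms by (auto simp: monomials_def)
    next
      case (node q l r)
      then show ?thesis using fixed path_dart_node[OF node(1,2)] by auto
    qed
  qed
  ultimately show "?D \<in> jacobi_diagrams p" by (simp add: jacobi_diagrams_iff)
qed

lemma card_legs_joined: "card (legs (joined (Br s t))) = degree_mono s + degree_mono t"
proof -
  let ?m = "Br s t" and ?D = "joined (Br s t)"
  interpret cubic_diagram ?D by (rule cubic_joined)
  have "legs ?D = path_dart ` {q. \<exists>a. at_path ?m q = Some (Atom a)}"
  proof (intro set_eqI iffI)
    fix x assume "x \<in> legs ?D"
    then obtain y where y: "x = to_nat y" "y \<in> path_darts ?m" "path_rot ?m y = y"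
      by (auto simp: legs_eq joined_simps)
    from y(2) show "x \<in> path_dart ` {q. \<exists>a. at_path ?m q = Some (Atom a)}"
    proof (cases rule: path_darts_cases)
      case (node q l r)
      then show ?thesis using y path_dart_node[OF node(1,2)] by auto
    qed (auto simp: y(1))
  next
    fix x assume "x \<in> path_dart ` {q. \<exists>a. at_path ?m q = Some (Atom a)}"
    then obtain q a where q: "x = path_dart q" "at_path ?m q = Some (Atom a)" by blast
    then have "q \<noteq> []" by auto
    from path_dart_leaf[OF this q(2)] show "x \<in> legs ?D" by (simp add: legs_eq joined_simps q(1))
  qed
  moreover have "inj_on path_dart A" for A by (auto simp: inj_on_def)
  ultimately show ?thesis using card_leaf_paths[of ?m] by (simp add: card_image)
qed

section \<open>A tree is determined by the two branches at an edge\<close>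

text \<open>The isomorphism from the model \<open>joined\<close> on the darts
  \<open>(q, True)\<close>: the path \<open>q\<close> is followed in \<open>D\<close>, starting from
  the edge of \<open>d\<close>. The two paths of length one denote its ends, since the root vertex
  is suppressed.\<close>

fun locate :: "diagram \<Rightarrow> nat \<Rightarrow> bool list \<Rightarrow> nat"
  where
    "locate D d [] = d"
  | "locate D d [b] = (if b then d else opp D d)"
  | "locate D d (b # q) = opp D (if b then rot D (locate D d q) else rot D (rot D (locate D d q)))"

lemma locate_Cons: "q \<noteq> [] \<Longrightarrow> locate D d (b # q) =
    opp D (if b then rot D (locate D d q) else rot D (rot D (locate D d q)))"
  by (cases q) auto

context tree_diagram
begin

context
  fixes d assumes d: "d \<in> darts D"
begin

definition root_dart :: "bool \<Rightarrow> nat"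
  where "root_dart b = (if b then d else opp D d)"

abbreviation full_tree :: "nat monomial"
  where "full_tree \<equiv> Br (branch D d) (branch D (opp D d))"

lemma locate_reads:
  "q \<noteq> [] \<Longrightarrow> at_path full_tree q = Some t \<Longrightarrow> locate D d q \<in> darts D \<and> reads D (locate D d q) t"
proof (induction q arbitrary: t)
  case (Cons b q)
  show ?case
  proof (cases "q = []")
    case True
    then show ?thesis using Cons.prems d by (auto simp: reads_branch)
  next
    case False
    obtain l r where q: "at_path full_tree q = Some (Br l r)" "t = (if b then l else r)"
      using Cons.prems(2) unfolding at_path_Cons_iff by blast
    from Cons.IH[OF False q(1)] have x: "locate D d q \<in> darts D" "reads D (locate D d q) (Br l r)" by auto
    from x(2) have "reads D (opp D (rot D (locate D d q))) l" "reads D (opp D (rot D (rot D (locate D d q)))) r"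
      by (auto elim: reads.cases)
    then show ?thesis using x(1) by (simp add: locate_Cons[OF False] q(2))
  qed
qed simp

lemma locate_in: "q \<noteq> [] \<Longrightarrow> at_path full_tree q \<noteq> None \<Longrightarrow> locate D d q \<in> darts D"
  using locate_reads by blast

lemma locate_node:
  "q \<noteq> [] \<Longrightarrow> at_path full_tree q = Some (Br l r) \<Longrightarrow> rot D (locate D d q) \<noteq> locate D d q"
  using locate_reads by (blast elim: reads.cases)

lemma locate_leaf:
  "q \<noteq> [] \<Longrightarrow> at_path full_tree q = Some (Atom a) \<Longrightarrow>
    rot D (locate D d q) = locate D d q \<and> lab D (locate D d q) = a"
  using locate_reads by (blast elim: reads.cases)

lemma locate_away:
  assumes "q \<noteq> []" "at_path full_tree (b # q) \<noteq> None"
  shows "(locate D d q, locate D d (b # q)) \<in> away D"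
proof -
  obtain l r where q: "at_path full_tree q = Some (Br l r)"
    using assms(2) by (auto split: option.splits monomial.splits)
  then show ?thesis
    using locate_node[OF assms(1) q] locate_in[OF assms(1)] by (simp add: locate_Cons[OF assms(1)] away_iff)
qed

lemma locate_reach:
  "q \<noteq> [] \<Longrightarrow> at_path full_tree q \<noteq> None \<Longrightarrow> (root_dart (last q), locate D d q) \<in> (away D)\<^sup>*"
proof (induction q)
  case (Cons b q)
  show ?case
  proof (cases "q = []")
    case False
    moreover have "at_path full_tree q \<noteq> None" using Cons.prems by (auto split: option.splits)
    ultimately show ?thesis using Cons locate_away[of q b] by (auto intro: rtrancl_into_rtrancl)
  qed (simp add: root_dart_def)
qed simp

lemma locate_reach_proper:
  assumes "q \<noteq> []" "at_path full_tree (b # q) \<noteq> None"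
  shows "(root_dart (last q), locate D d (b # q)) \<in> (away D)\<^sup>+"
proof -
  have "at_path full_tree q \<noteq> None" using assms by (auto split: option.splits)
  from rtrancl_into_trancl1[OF locate_reach[OF assms(1) this] locate_away[OF assms]] show ?thesis .
qed

lemma root_dart_trancl: "(root_dart b, root_dart c) \<notin> (away D)\<^sup>+"
  using away_trancl_irrefl[of d] away_trancl_irrefl[of "opp D d"] away_trancl_opp[of d]
    away_trancl_opp[of "opp D d"] d
  by (cases b; cases c) (simp_all add: root_dart_def)

text \<open>Reversing the second walk and appending it to the first gives a walk between ends of the
  root edge, which must be trivial.\<close>

lemma root_dart_reach_opp:
  assumes "(root_dart b, x) \<in> (away D)\<^sup>*" "(root_dart c, opp D x) \<in> (away D)\<^sup>*"
  shows "x = root_dart b"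
proof -
  have "opp D (root_dart c) = root_dart (\<not> c)" using d by (simp add: root_dart_def)
  moreover have x: "x \<in> darts D" using away_rtrancl_in[OF assms(1)] d by (simp add: root_dart_def)
  ultimately have *: "(x, root_dart (\<not> c)) \<in> (away D)\<^sup>*" using away_rtrancl_reverse[OF assms(2)] by simp
  show ?thesis using rtranclD[OF assms(1)] * root_dart_trancl[of b "\<not> c"]
    by (meson trancl_rtrancl_trancl)
qed

lemma locate_neq_opp:
  assumes "p \<noteq> []" "at_path full_tree p \<noteq> None" "q \<noteq> []" "at_path full_tree (b # q) \<noteq> None"
  shows "locate D d p \<noteq> opp D (locate D d (b # q))"
proof
  assume eq: "locate D d p = opp D (locate D d (b # q))"
  note r = locate_reach_proper[OF assms(3,4)]
  have "locate D d (b # q) = root_dart (last q)"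
    by (rule root_dart_reach_opp[OF trancl_into_rtrancl[OF r]]) (use locate_reach[OF assms(1,2)] eq in simp)
  then show False using r away_trancl_irrefl by metis
qed

text \<open>Induction along the paths: equal darts are entered from the same vertex, so the task is
  to show that their parent darts there agree too.\<close>

lemma locate_inj:
  assumes "p \<noteq> []" "at_path full_tree p \<noteq> None" "q \<noteq> []" "at_path full_tree q \<noteq> None"
    and "locate D d p = locate D d q"
  shows "p = q"
  using assms
proof (induction p arbitrary: q)
  case (Cons b p)
  obtain c r where q: "q = c # r" using Cons.prems(3) by (cases q) auto
  have singleton: False if "y \<noteq> []" "at_path full_tree (e # y) \<noteq> None" "locate D d [c'] = locate D d (e # y)" for c' e y
  proof -
    have "root_dart c' = locate D d (e # y)" using that(3) by (simp add: root_dart_def)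
    then show False using locate_reach_proper[OF that(1,2)] root_dart_trancl by metis
  qed
  consider "p = []" "r = []" | "p = []" "r \<noteq> []" | "p \<noteq> []" "r = []" | "p \<noteq> []" "r \<noteq> []" by blast
  then show ?case
  proof cases
    case 1
    then show ?thesis using Cons.prems(5) opp_neq[OF d] by (auto simp: q split: if_splits)
  next
    case 2
    then show ?thesis using singleton[of r c b] Cons.prems by (simp add: q)
  next
    case 3
    then show ?thesis using singleton[of p b c] Cons.prems by (simp add: q)
  next
    case 4
    obtain l1 r1 where p1: "at_path full_tree p = Some (Br l1 r1)"
      using Cons.prems(2) by (auto split: option.splits monomial.splits)
    obtain l2 r2 where r1: "at_path full_tree r = Some (Br l2 r2)"
      using Cons.prems(4) by (auto simp: q split: option.splits monomial.splits)
    have in1: "locate D d p \<in> darts D" and in2: "locate D d r \<in> darts D"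
      using locate_in 4 p1 r1 by simp_all
    have n: "rot D (locate D d p) \<noteq> locate D d p" using locate_node[OF 4(1) p1] .
    have a1: "(locate D d p, locate D d (b # p)) \<in> away D" using locate_away[OF 4(1) Cons.prems(2)] .
    have a2: "(locate D d r, locate D d (c # r)) \<in> away D" using locate_away 4(2) Cons.prems(4) by (simp add: q)
    have same: "vertex D (locate D d p) = vertex D (locate D d r)"
      using away_vertex[OF a1] away_vertex[OF a2] Cons.prems(5) by (simp add: q)
    show ?thesis
    proof (cases "locate D d p = locate D d r")
      case True
      then have pr: "p = r" using Cons.IH[OF 4(1) _ 4(2) _ True] p1 r1 by simp
      moreover have "b = c"
      proof (rule ccontr)
        assume "b \<noteq> c"
        then have "opp D (rot D (locate D d p)) = opp D (rot D (rot D (locate D d p)))"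
          using Cons.prems(5) pr by (cases b; cases c) (simp_all add: q locate_Cons[OF 4(2)])
        then have "rot D (locate D d p) = rot D (rot D (locate D d p))" using in1 opp_opp rot_in by metis
        then show False using n in1 by (metis rot_rot_eq_rot_iff)
      qed
      ultimately show ?thesis by (simp add: q)
    next
      \<comment> \<open>Two different parents at one vertex: a walk from the root edge would then
        leave through the second parent, backwards along the walk that leads to it. Hence the second
        parent is itself an end of the root edge, and the first walk would return to that
        edge.\<close>
      case False
      have "locate D d r \<in> vertex D (locate D d p)" using same vertex_self[OF in2] by simp
      then have "(locate D d p, opp D (locate D d r)) \<in> away D" using in1 False by (intro awayI) auto
      then have r: "(root_dart (last p), opp D (locate D d r)) \<in> (away D)\<^sup>+"
        using locate_reach[OF 4(1)] p1 by (simp add: rtrancl_into_trancl1)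
      have "locate D d r = root_dart (last r)"
        by (rule root_dart_reach_opp[OF locate_reach[OF 4(2)] trancl_into_rtrancl[OF r]]) (simp add: r1)
      then have "opp D (locate D d r) = root_dart (\<not> last r)" using d by (simp add: root_dart_def)
      then show ?thesis using r root_dart_trancl by simp
    qed
  qed
qed simp

lemma joined_iso: "diagram_iso (joined full_tree) D"
proof -
  let ?J = "joined full_tree" and ?S = "path_darts full_tree"
  interpret J: cubic_diagram ?J by (rule cubic_joined)
  define g :: "path_dart \<Rightarrow> nat"
    where "g x = (if snd x then locate D d (fst x) else opp D (locate D d (fst x)))" for x
  have g_in: "g x \<in> darts D" if "x \<in> ?S" for x
    using that locate_in by (auto simp: g_def path_darts_def)
  have g_opp: "g (path_opp x) = opp D (g x)" if x: "x \<in> ?S" for x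
  proof -
    obtain q u where qu: "x = (q, u)" by force
    have q: "q \<noteq> []" "at_path full_tree q \<noteq> None" using x by (auto simp: qu path_darts_def)
    show ?thesis
    proof (cases "tl q = []")
      case True
      then obtain b where "q = [b]" "u" using x by (cases q) (auto simp: qu path_darts_def)
      then show ?thesis using d by (simp add: qu g_def)
    next
      case False
      then show ?thesis using locate_in[OF q] by (simp add: qu g_def)
    qed
  qed
  have g_rot: "g (path_rot full_tree x) = rot D (g x)" if x: "x \<in> ?S" for x
    using x
  proof (cases rule: path_darts_cases)
    case (leaf q a)
    then show ?thesis using locate_leaf[OF leaf(2,3)] path_dart_leaf[OF leaf(2,3)] by (simp add: g_def)
  next
    case (node q l r)
    have "locate D d q \<in> darts D" using locate_in node by simp
    then show ?thesis using node(3) path_dart_node[OF node(1,2)]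
      by (auto simp: g_def locate_Cons[OF node(1)] simp del: path_rot.simps)
  qed
  have "inj_on g ?S"
  proof (rule inj_onI)
    fix x y assume xy: "x \<in> ?S" "y \<in> ?S" "g x = g y"
    obtain p u where x: "x = (p, u)" by force
    obtain q v where y: "y = (q, v)" by force
    have p: "p \<noteq> []" "at_path full_tree p \<noteq> None" "\<not> u \<Longrightarrow> \<exists>b p'. p = b # p' \<and> p' \<noteq> []"
      using xy(1) by (cases p; auto simp: x path_darts_def)+
    have q: "q \<noteq> []" "at_path full_tree q \<noteq> None" "\<not> v \<Longrightarrow> \<exists>b p'. q = b # p' \<and> p' \<noteq> []"
      using xy(2) by (cases q; auto simp: y path_darts_def)+
    have "locate D d p = locate D d q \<and> u = v"
    proof (cases u; cases v)
      assume "u" "v" then show ?thesis using xy(3) by (simp add: x y g_def)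
    next
      assume "\<not> u" "\<not> v" then show ?thesis using xy(3) locate_in[OF p(1,2)] locate_in[OF q(1,2)]
        by (simp add: x y g_def) (metis opp_opp)
    next
      assume uv: "u" "\<not> v"
      then obtain b q' where "q = b # q'" "q' \<noteq> []" using q(3) by blast
      then show ?thesis using xy(3) uv locate_neq_opp[of p q' b] p q by (simp add: x y g_def)
    next
      assume uv: "\<not> u" "v"
      then obtain b p' where "p = b # p'" "p' \<noteq> []" using p(3) by blast
      then show ?thesis using xy(3) uv locate_neq_opp[of q p' b] p q by (simp add: x y g_def)
    qed
    then show "x = y" using locate_inj[OF p(1,2) q(1,2)] by (simp add: x y)
  qed
  moreover have "g ` ?S = darts D"
  proof
    show "g ` ?S \<subseteq> darts D" using g_in by blast
    \<comment> \<open>The image contains \<open>d\<close> and is closed under \<open>opp\<close> and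
      \<open>rot\<close>, so connectivity gives surjectivity.\<close>
    have "x \<in> g ` ?S" if x: "x \<in> darts D" for x
    proof (rule connected_induct[of d "\<lambda>x. x \<in> g ` ?S", OF d _ _ x])
      have "([True], True) \<in> ?S" "g ([True], True) = d" by (simp_all add: path_darts_def g_def)
      then show "d \<in> g ` ?S" by force
      fix y assume "y \<in> darts D" "y \<in> g ` ?S"
      then obtain z where z: "z \<in> ?S" "y = g z" by blast
      then show "opp D y \<in> g ` ?S \<and> rot D y \<in> g ` ?S"
        using g_opp[OF z(1)] g_rot[OF z(1)] path_opp_in[OF z(1)] path_rot_in[OF z(1)]
        by (metis imageI)
    qed
    then show "darts D \<subseteq> g ` ?S" by blast
  qed
  ultimately have "bij_betw g ?S (darts D)" by (simp add: bij_betw_def)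
  moreover have "bij_betw from_nat (to_nat ` ?S) ?S"
    by (rule bij_betw_byWitness[where f' = to_nat]) auto
  ultimately have "bij_betw (g \<circ> from_nat) (darts ?J) (darts D)"
    unfolding joined_simps by (rule bij_betw_trans[rotated])
  moreover have "\<forall>x\<in>darts ?J. (g \<circ> from_nat) (opp ?J x) = opp D ((g \<circ> from_nat) x)
      \<and> (g \<circ> from_nat) (rot ?J x) = rot D ((g \<circ> from_nat) x)"
    using g_opp g_rot by (auto simp: joined_simps)
  moreover have "\<forall>x\<in>legs ?J. lab D ((g \<circ> from_nat) x) = lab ?J x"
  proof
    fix x assume "x \<in> legs ?J"
    then obtain y where y: "x = to_nat y" "y \<in> ?S" "path_rot full_tree y = y"
      by (auto simp: J.legs_eq joined_simps)
    from y(2) show "lab D ((g \<circ> from_nat) x) = lab ?J x"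
    proof (cases rule: path_darts_cases)
      case (leaf q a)
      then show ?thesis using locate_leaf[OF leaf(2,3)] by (simp add: y(1) g_def joined_def)
    next
      case (node q l r)
      then show ?thesis using y(3) path_dart_node[OF node(1,2)] by auto
    qed
  qed
  ultimately show ?thesis unfolding diagram_iso_def by blast
qed

end

end

section \<open>From diagrams to words\<close>

lemma reads_in_monomials:
  assumes "D \<in> jacobi_diagrams p" "reads D x t" "x \<in> darts D"
  shows "t \<in> monomials p"
proof -
  interpret tree_diagram D using assms(1) by (simp add: jacobi_diagrams_iff)
  show ?thesis
    using assms(2,3)
  proof (induction rule: reads.induct)
    case (leaf x)
    then show ?case using assms(1) by (simp add: monomials_def jacobi_diagrams_iff)
  next
    case (node x s t)
    then show ?case by (simp add: monomials_def)
  qed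
qed

lemma branch_in_monomials:
  assumes "D \<in> jacobi_diagrams p" "x \<in> darts D"
  shows "branch D x \<in> monomials p"
proof -
  interpret tree_diagram D using assms(1) by (simp add: jacobi_diagrams_iff)
  show ?thesis using reads_in_monomials[OF assms(1) reads_branch] assms(2) by simp
qed

lemma branch_opp_in_monomials:
  assumes "D \<in> jacobi_diagrams p" "x \<in> darts D"
  shows "branch D (opp D x) \<in> monomials p"
proof -
  interpret tree_diagram D using assms(1) by (simp add: jacobi_diagrams_iff)
  show ?thesis using branch_in_monomials[OF assms(1)] assms(2) by simp
qed

lemma subspace_trans:
  "pm.subspace S \<Longrightarrow> a - b \<in> S \<Longrightarrow> b - c \<in> S \<Longrightarrow> a - c \<in> S"
  using pm.subspace_add[of S "a - b" "b - c"] by simp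

lemma subspace_sym: "pm.subspace S \<Longrightarrow> a - b \<in> S \<Longrightarrow> b - a \<in> S"
  using pm.subspace_neg[of S "a - b"] by simp

definition edge_word :: "diagram \<Rightarrow> nat \<Rightarrow> nat list \<Rightarrow>\<^sub>0 'k::field"
  where "edge_word D x = glue (gen (branch D x)) (gen (branch D (opp D x)))"

definition diagram_word :: "diagram \<Rightarrow> nat list \<Rightarrow>\<^sub>0 'k::field"
  where "diagram_word D = edge_word D (SOME x. x \<in> darts D)"

lemma edge_word_opp:
  assumes "D \<in> jacobi_diagrams p" "x \<in> darts D"
  shows "edge_word D (opp D x) - edge_word D x \<in> H' p"
proof -
  interpret tree_diagram D using assms(1) by (simp add: jacobi_diagrams_iff)
  show ?thesis using assms by (simp add: edge_word_def glue_sym branch_in_monomials)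
qed

text \<open>With branches \<open>s\<close>, \<open>t\<close>, \<open>u\<close> at the vertex, the
  two words are those of \<open>[t, u]\<close> glued to \<open>s\<close> and \<open>[u, s]\<close>
  glued to \<open>t\<close>. Both agree with \<open>t\<close> glued to
  \<open>[u, s]\<close>.\<close>

lemma edge_word_rot:
  assumes "CHAR('k::field) \<noteq> 2" "D \<in> jacobi_diagrams p" "x \<in> darts D"
  shows "edge_word D (rot D x) - edge_word D x \<in> (H' p :: (_ \<Rightarrow>\<^sub>0 'k) set)"
proof (cases "rot D x = x")
  case True
  then show ?thesis by (simp add: subspace_H' pm.subspace_0)
next
  case False
  interpret tree_diagram D using assms(2) by (simp add: jacobi_diagrams_iff)
  define s t u where "s = branch D (opp D x)" and "t = branch D (opp D (rot D x))"
    and "u = branch D (opp D (rot D (rot D x)))"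
  have stu: "s \<in> monomials p" "t \<in> monomials p" "u \<in> monomials p"
    using branch_opp_in_monomials[OF assms(2)] assms(3) by (simp_all add: s_def t_def u_def)
  have b: "branch D x = Br t u" "branch D (rot D x) = Br u s"
    using branch_node[of x] branch_node[of "rot D x"] False assms(3) by (simp_all add: s_def t_def u_def)
  have 1: "glue (gen (Br u s)) (gen t) - glue (gen t) (gen (Br u s)) \<in> (H' p :: (_ \<Rightarrow>\<^sub>0 'k) set)"
    using stu by (intro glue_sym) (auto simp: monomials_def)
  have "glue (gen (Br t u)) (gen s) - glue (gen t) (gen (Br u s)) \<in> (H' p :: (_ \<Rightarrow>\<^sub>0 'k) set)"
    using glue_assoc[OF assms(1), of "gen t" p "gen u" "gen s"] stu by simp
  then have "glue (gen (Br u s)) (gen t) - glue (gen (Br t u)) (gen s) \<in> (H' p :: (_ \<Rightarrow>\<^sub>0 'k) set)"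
    using 1 subspace_sym subspace_trans subspace_H' by metis
  then show ?thesis by (simp add: edge_word_def b s_def t_def)
qed

text \<open>The arbitrary choice of an edge does not matter modulo \<open>H'\<close>: the word is
  invariant along \<open>opp\<close> and \<open>rot\<close>, and the diagram is connected.\<close>

lemma diagram_word_eq:
  assumes "CHAR('k::field) \<noteq> 2" "D \<in> jacobi_diagrams p" "x \<in> darts D"
  shows "diagram_word D - edge_word D x \<in> (H' p :: (_ \<Rightarrow>\<^sub>0 'k) set)"
proof -
  interpret tree_diagram D using assms(2) by (simp add: jacobi_diagrams_iff)
  let ?d = "SOME x. x \<in> darts D"
  have "edge_word D ?d - edge_word D x \<in> (H' p :: (_ \<Rightarrow>\<^sub>0 'k) set)"
  proof (rule connected_induct[of ?d "\<lambda>x. edge_word D ?d - edge_word D x \<in> (H' p :: (_ \<Rightarrow>\<^sub>0 'k) set)", OF _ _ _ assms(3)])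
    show "?d \<in> darts D" using assms(3) by (rule someI)
    show "edge_word D ?d - edge_word D ?d \<in> (H' p :: (_ \<Rightarrow>\<^sub>0 'k) set)"
      by (simp add: subspace_H' pm.subspace_0)
    fix y assume y: "y \<in> darts D" "edge_word D ?d - edge_word D y \<in> (H' p :: (_ \<Rightarrow>\<^sub>0 'k) set)"
    show "edge_word D ?d - edge_word D (opp D y) \<in> (H' p :: (_ \<Rightarrow>\<^sub>0 'k) set) \<and>
      edge_word D ?d - edge_word D (rot D y) \<in> (H' p :: (_ \<Rightarrow>\<^sub>0 'k) set)"
      using subspace_trans[OF subspace_H' y(2) subspace_sym[OF subspace_H' edge_word_opp[OF assms(2) y(1)]]]
        subspace_trans[OF subspace_H' y(2) subspace_sym[OF subspace_H' edge_word_rot[OF assms(1,2) y(1)]]] by blast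
  qed
  then show ?thesis by (simp add: diagram_word_def)
qed

lemma reads_diagram_iso:
  assumes "cubic_diagram D" and f: "bij_betw f (darts D) (darts D')"
    "\<And>x. x \<in> darts D \<Longrightarrow> f (opp D x) = opp D' (f x) \<and> f (rot D x) = rot D' (f x)"
    "\<And>x. x \<in> legs D \<Longrightarrow> lab D' (f x) = lab D x"
    and "reads D x t" "x \<in> darts D"
  shows "reads D' (f x) t"
  using assms(5,6)
proof (induction rule: reads.induct)
  interpret cubic_diagram D by (rule assms(1))
  case (leaf x)
  then have "rot D' (f x) = f x" "lab D' (f x) = lab D x" using f(2)[of x] f(3)[of x] by (simp_all add: legs_eq)
  then show ?case using reads.leaf by metis
next
  interpret cubic_diagram D by (rule assms(1))
  case (node x s t)
  then have "f (rot D x) \<noteq> f x" using f(1) by (metis bij_betw_imp_inj_on inj_onD rot_in)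
  moreover have "f (rot D x) = rot D' (f x)" "f (opp D (rot D x)) = opp D' (rot D' (f x))"
    "f (opp D (rot D (rot D x))) = opp D' (rot D' (rot D' (f x)))"
    using f(2)[of x] f(2)[of "rot D x"] f(2)[of "rot D (rot D x)"] node.prems by simp_all
  ultimately show ?case using node by (intro reads.node) auto
qed

lemma card_legs_diagram_iso:
  assumes "cubic_diagram D" "cubic_diagram D'" "diagram_iso D D'"
  shows "card (legs D) = card (legs D')"
proof -
  interpret D: cubic_diagram D by (rule assms(1))
  interpret D': cubic_diagram D' by (rule assms(2))
  obtain f where f: "bij_betw f (darts D) (darts D')" "\<forall>x\<in>darts D. f (rot D x) = rot D' (f x)"
    using assms(3) by (auto simp: diagram_iso_def)
  have eq: "rot D' (f x) = f x \<longleftrightarrow> rot D x = x" if "x \<in> darts D" for x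
    using f that by (metis D.rot_in bij_betw_imp_inj_on inj_onD)
  have "f ` legs D = legs D'"
  proof (intro set_eqI iffI)
    fix y assume "y \<in> f ` legs D"
    then show "y \<in> legs D'" using eq f(1) by (auto simp: D.legs_eq D'.legs_eq dest: bij_betwE)
  next
    fix y assume y: "y \<in> legs D'"
    then obtain x where x: "x \<in> darts D" "y = f x"
      using f(1) by (auto simp: D'.legs_eq bij_betw_def)
    then show "y \<in> f ` legs D" using y eq by (auto simp: D.legs_eq D'.legs_eq)
  qed
  moreover have "inj_on f (legs D)" using f(1) by (auto simp: D.legs_eq bij_betw_def inj_on_def)
  ultimately show ?thesis using card_image by metis
qed

text \<open>The legs are counted in the isomorphic model, where they are the leaves of the two
  trees.\<close>

lemma card_legs_eq:
  assumes "D \<in> jacobi_diagrams p" "x \<in> darts D"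
  shows "card (legs D) = degree_mono (branch D x) + degree_mono (branch D (opp D x))"
proof -
  interpret tree_diagram D using assms(1) by (simp add: jacobi_diagrams_iff)
  show ?thesis
    using card_legs_diagram_iso[OF cubic_joined cubic_diagram_axioms joined_iso[OF assms(2)]]
    by (simp add: card_legs_joined)
qed

lemma jacobi_dart:
  assumes "D \<in> jacobi_diagrams p" shows "(SOME x. x \<in> darts D) \<in> darts D"
proof -
  have "darts D \<noteq> {}" using assms by (simp add: jacobi_diagrams_def connected_diagram_def)
  then show ?thesis by (rule some_in_eq[THEN iffD2])
qed

lemma diagram_word_graded:
  assumes "D \<in> jacobi_diagrams p"
  shows "diagram_word D \<in> free_on {w \<in> words p. length w = card (legs D)}"
  unfolding diagram_word_def edge_word_def card_legs_eq[OF assms jacobi_dart[OF assms]]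
  by (rule glue_graded[OF branch_in_monomials[OF assms jacobi_dart[OF assms]]
        branch_opp_in_monomials[OF assms jacobi_dart[OF assms]]])

abbreviation "diagram_word_lin \<equiv> linear_ext diagram_word"

lemma subspace_diagram_relations: "pm.subspace (diagram_relations p)"
  by (simp add: diagram_relations_def pm.subspace_span)

text \<open>Each relation is evaluated at a convenient dart. Isomorphic diagrams give equal words at
  corresponding darts; AS and IHX become antisymmetry and Jacobi in the first argument of
  \<open>glue\<close>.\<close>

lemma diagram_word_lin_relations:
  fixes x :: "diagram \<Rightarrow>\<^sub>0 'k::field"
  assumes char: "CHAR('k) \<noteq> 2" and x: "x \<in> diagram_relations p"
  shows "diagram_word_lin x \<in> H' p"
  using x unfolding diagram_relations_def
proof (rule lin_span_into_subspace[OF lin_linear_ext subspace_H', rotated], elim UnE)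
  note word_eq = diagram_word_eq[OF char]
  fix x :: "diagram \<Rightarrow>\<^sub>0 'k"
  { assume "x \<in> {gen D - gen D' |D D'. D \<in> jacobi_diagrams p \<and> D' \<in> jacobi_diagrams p \<and> diagram_iso D D'}"
    then obtain D D' where x: "x = gen D - gen D'" and D: "D \<in> jacobi_diagrams p" "D' \<in> jacobi_diagrams p"
      and iso: "diagram_iso D D'" by blast
    interpret tree_diagram D using D(1) by (simp add: jacobi_diagrams_iff)
    obtain f where f: "bij_betw f (darts D) (darts D')"
      "\<And>x. x \<in> darts D \<Longrightarrow> f (opp D x) = opp D' (f x) \<and> f (rot D x) = rot D' (f x)"
      "\<And>x. x \<in> legs D \<Longrightarrow> lab D' (f x) = lab D x"
      using iso unfolding diagram_iso_def by blast
    define d where "d = (SOME x. x \<in> darts D)"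
    have d: "d \<in> darts D" using jacobi_dart[OF D(1)] by (simp add: d_def)
    have fd: "f d \<in> darts D'" using d f(1) by (auto dest: bij_betwE)
    have "branch D' (f y) = branch D y" if "y \<in> darts D" for y
      using reads_diagram_iso[OF cubic_diagram_axioms f reads_branch] that by (intro branch_eqI) auto
    from this[of d] this[of "opp D d"] d f(2) have "edge_word D' (f d) = (edge_word D d :: _ \<Rightarrow>\<^sub>0 'k)"
      by (simp add: edge_word_def)
    then have "diagram_word D - diagram_word D' \<in> (H' p :: (_ \<Rightarrow>\<^sub>0 'k) set)"
      using word_eq[OF D(1) d] subspace_sym[OF subspace_H' word_eq[OF D(2) fd]] subspace_trans[OF subspace_H'] by metis
    then show "diagram_word_lin x \<in> H' p" by (simp add: x linear_ext_simps) }
  { assume "x \<in> {gen (flip_vertex D d) + gen D |D d. D \<in> jacobi_diagrams p \<and> d \<in> darts D \<and> valence D d = 3}"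
    then obtain D d where x: "x = gen (flip_vertex D d) + gen D" and D: "D \<in> jacobi_diagrams p" "d \<in> darts D"
      and v: "valence D d = 3" by blast
    interpret tree_diagram D using D(1) by (simp add: jacobi_diagrams_iff)
    have r: "rot D d \<noteq> d" using v D(2) by (auto simp: valence_eq)
    let ?D = "flip_vertex D d"
    define s t u where "s = branch D (opp D (rot D d))" and "t = branch D (opp D (rot D (rot D d)))"
      and "u = branch D (opp D d)"
    have stu: "s \<in> monomials p" "t \<in> monomials p" "u \<in> monomials p"
      using branch_opp_in_monomials[OF D(1)] D(2) by (simp_all add: s_def t_def u_def)
    have "d \<in> darts ?D" using D(2) by (simp add: flip_vertex_def)
    note 1 = word_eq[OF flip_vertex_jacobi[OF D r] this] word_eq[OF D]
    have "edge_word ?D d = (glue (gen (Br t s)) (gen u) :: _ \<Rightarrow>\<^sub>0 'k)"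
      "edge_word D d = (glue (gen (Br s t)) (gen u) :: _ \<Rightarrow>\<^sub>0 'k)"
      using branch_flip_vertex[OF D r] branch_flip_vertex_opp[OF D r] branch_node[OF D(2) r]
      by (simp_all add: edge_word_def s_def t_def u_def)
    moreover have "glue (brk (gen t) (gen s) + brk (gen s) (gen t)) (gen u) \<in> (H' p :: (_ \<Rightarrow>\<^sub>0 'k) set)"
      using stu by (intro glue_lie_ideal_left char lie_ideal_antisym) auto
    ultimately have 2: "edge_word ?D d + edge_word D d \<in> (H' p :: (_ \<Rightarrow>\<^sub>0 'k) set)"
      by (simp add: lin_add[OF lin_glue_left[OF lin_id]])
    have "(diagram_word ?D - edge_word ?D d) + (diagram_word D - edge_word D d)
        + (edge_word ?D d + edge_word D d) \<in> (H' p :: (_ \<Rightarrow>\<^sub>0 'k) set)"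
      by (rule pm.subspace_add[OF subspace_H' pm.subspace_add[OF subspace_H' 1] 2])
    then show "diagram_word_lin x \<in> H' p" by (simp add: x linear_ext_simps) }
  { assume "x \<in> {gen DI - (gen DH + gen DX) |DI DH DX. DI \<in> jacobi_diagrams p \<and> DH \<in> jacobi_diagrams p
        \<and> DX \<in> jacobi_diagrams p \<and> ihx_triple DI DH DX}"
    then obtain D H X where x: "x = gen D - (gen H + gen X)" and D: "D \<in> jacobi_diagrams p" "H \<in> jacobi_diagrams p"
      "X \<in> jacobi_diagrams p" and t: "ihx_triple D H X" by blast
    interpret tree_diagram D using D(1) by (simp add: jacobi_diagrams_iff)
    obtain e where e: "e \<in> darts D" "valence D e = 3" "valence D (opp D e) = 3"
      and HX: "H = D\<lparr>rot := cyc3 (cyc3 (rot D) (rot D (rot D e)) (rot D (opp D e)) e) (rot D e) (opp D e) (rot D (rot D (opp D e)))\<rparr>"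
        "X = D\<lparr>rot := cyc3 (cyc3 (rot D) (rot D e) (rot D (opp D e)) e) (opp D e) (rot D (rot D e)) (rot D (rot D (opp D e)))\<rparr>"
      using t unfolding ihx_triple_def Let_def by blast
    have r: "rot D e \<noteq> e" "rot D (opp D e) \<noteq> opp D e" using e by (auto simp: valence_eq)
    define A B C R where "A = branch D (opp D (rot D e))" and "B = branch D (opp D (rot D (rot D e)))"
      and "C = branch D (opp D (rot D (opp D e)))" and "R = branch D (opp D (rot D (rot D (opp D e))))"
    have ABCR: "A \<in> monomials p" "B \<in> monomials p" "C \<in> monomials p" "R \<in> monomials p"
      using branch_opp_in_monomials[OF D(1)] e(1) by (simp_all add: A_def B_def C_def R_def)
    let ?r = "rot D (rot D (opp D e))"
    note ihx = ihx_branches[OF D(1) e(1) r, folded HX A_def B_def C_def R_def]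
    have rd: "?r \<in> darts D" "?r \<in> darts H" "?r \<in> darts X" using ihx(4) HX by simp_all
    have w: "edge_word D ?r = glue (gen (Br (Br A B) C)) (gen R :: _ \<Rightarrow>\<^sub>0 'k)"
      "edge_word H ?r = glue (gen (Br A (Br B C))) (gen R :: _ \<Rightarrow>\<^sub>0 'k)"
      "edge_word X ?r = glue (gen (Br (Br A C) B)) (gen R :: _ \<Rightarrow>\<^sub>0 'k)"
      using ihx by (simp_all add: edge_word_def R_def)
    have "glue (brk (brk (gen A) (gen B)) (gen C) - (brk (gen A) (brk (gen B) (gen C)) + brk (brk (gen A) (gen C)) (gen B)))
        (gen R) \<in> (H' p :: (_ \<Rightarrow>\<^sub>0 'k) set)"
      using ABCR by (intro glue_lie_ideal_left char lie_ideal_jacobi) auto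
    then have 1: "edge_word D ?r - (edge_word H ?r + edge_word X ?r) \<in> (H' p :: (_ \<Rightarrow>\<^sub>0 'k) set)"
      by (simp add: w lin_add[OF lin_glue_left[OF lin_id]] lin_diff[OF lin_glue_left[OF lin_id]])
    have "(diagram_word D - edge_word D ?r)
        - ((diagram_word H - edge_word H ?r) + (diagram_word X - edge_word X ?r))
        + (edge_word D ?r - (edge_word H ?r + edge_word X ?r)) \<in> (H' p :: (_ \<Rightarrow>\<^sub>0 'k) set)"
      by (rule pm.subspace_add[OF subspace_H' pm.subspace_diff[OF subspace_H' word_eq[OF D(1) rd(1)]
              pm.subspace_add[OF subspace_H' word_eq[OF D(2) rd(2)] word_eq[OF D(3) rd(3)]]] 1])
    then show "diagram_word_lin x \<in> H' p" by (simp add: x linear_ext_simps algebra_simps) }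
qed

section \<open>From words to diagrams\<close>

lemma gen_diagram_iso:
  "D \<in> jacobi_diagrams p \<Longrightarrow> D' \<in> jacobi_diagrams p \<Longrightarrow> diagram_iso D D' \<Longrightarrow>
    gen D - gen D' \<in> diagram_relations p"
  unfolding diagram_relations_def by (intro pm.span_base) blast

lemma gen_joined:
  assumes "D \<in> jacobi_diagrams p" "x \<in> darts D"
  shows "gen (joined (Br (branch D x) (branch D (opp D x)))) - gen D \<in> diagram_relations p"
proof -
  interpret tree_diagram D using assms(1) by (simp add: jacobi_diagrams_iff)
  have "Br (branch D x) (branch D (opp D x)) \<in> monomials p"
    using branch_in_monomials[OF assms] branch_opp_in_monomials[OF assms] by (simp add: monomials_def)
  then show ?thesis by (intro gen_diagram_iso joined_jacobi assms(1) joined_iso[OF assms(2)])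
qed

text \<open>Cutting one diagram at two different edges relates the resulting pairs of trees; turning
  the edge around and moving it across a vertex are instances.\<close>

lemma gen_joined_eq:
  assumes "D \<in> jacobi_diagrams p" "x \<in> darts D" "y \<in> darts D"
  shows "gen (joined (Br (branch D x) (branch D (opp D x))))
    - gen (joined (Br (branch D y) (branch D (opp D y)))) \<in> diagram_relations p"
  using subspace_trans[OF subspace_diagram_relations gen_joined[OF assms(1,2)]
      subspace_sym[OF subspace_diagram_relations gen_joined[OF assms(1,3)]]] .

lemma Br_in_monomials: "Br s t \<in> monomials p \<longleftrightarrow> s \<in> monomials p \<and> t \<in> monomials p"
  by (simp add: monomials_def)

lemma joined_sym:
  assumes "s \<in> monomials p" "t \<in> monomials p"
  shows "gen (joined (Br s t)) - gen (joined (Br t s)) \<in> diagram_relations p"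
proof -
  let ?D = "joined (Br s t)" and ?d = "path_dart [True]"
  have st: "Br s t \<in> monomials p" using assms by (simp add: Br_in_monomials)
  note j = joined_jacobi[OF st] joined_dart[OF st] branch_joined[OF st] branch_joined_opp[OF st]
  interpret tree_diagram ?D using j(1) by (simp add: jacobi_diagrams_iff)
  show ?thesis using gen_joined_eq[OF j(1,2), of "opp ?D ?d"] j(2-4) by simp
qed

text \<open>Both sides are the same diagram, cut at two edges of the vertex where \<open>s\<close>,
  \<open>t\<close> and \<open>u\<close> meet.\<close>

lemma joined_assoc:
  assumes "s \<in> monomials p" "t \<in> monomials p" "u \<in> monomials p"
  shows "gen (joined (Br (Br s t) u)) - gen (joined (Br s (Br t u))) \<in> diagram_relations p"
proof -
  let ?D = "joined (Br (Br s t) u)" and ?d = "path_dart [True]"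
  have m: "Br (Br s t) u \<in> monomials p" using assms by (simp add: Br_in_monomials)
  note j = joined_jacobi[OF m] joined_dart[OF m] branch_joined[OF m] branch_joined_opp[OF m]
  interpret tree_diagram ?D using j(1) by (simp add: jacobi_diagrams_iff)
  have r: "rot ?D ?d \<noteq> ?d" using reads_branch[OF j(2)] unfolding j(3) by (auto elim: reads.cases)
  have b: "branch ?D (opp ?D (rot ?D ?d)) = s" "branch ?D (opp ?D (rot ?D (rot ?D ?d))) = t"
    using branch_node[OF j(2) r] unfolding j(3) by simp_all
  have "branch ?D (rot ?D ?d) = Br t u"
    using branch_node[of "rot ?D ?d"] r j(2) by (simp add: b j(4))
  then show ?thesis
    using gen_joined_eq[OF j(1,2), of "opp ?D (rot ?D ?d)"] j(2-4) b by simp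
qed

lemma joined_antisym:
  assumes "s \<in> monomials p" "t \<in> monomials p" "u \<in> monomials p"
  shows "gen (joined (Br (Br s t) u)) + gen (joined (Br (Br t s) u)) \<in> diagram_relations p"
proof -
  let ?D = "joined (Br (Br s t) u)" and ?d = "path_dart [True]"
  have m: "Br (Br s t) u \<in> monomials p" using assms by (simp add: Br_in_monomials)
  note j = joined_jacobi[OF m] joined_dart[OF m] branch_joined[OF m] branch_joined_opp[OF m]
  interpret tree_diagram ?D using j(1) by (simp add: jacobi_diagrams_iff)
  have r: "rot ?D ?d \<noteq> ?d" using reads_branch[OF j(2)] unfolding j(3) by (auto elim: reads.cases)
  have b: "branch ?D (opp ?D (rot ?D ?d)) = s" "branch ?D (opp ?D (rot ?D (rot ?D ?d))) = t"
    using branch_node[OF j(2) r] unfolding j(3) by simp_all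
  let ?F = "flip_vertex ?D ?d"
  note f = flip_vertex_jacobi[OF j(1,2) r] branch_flip_vertex[OF j(1,2) r] branch_flip_vertex_opp[OF j(1,2) r]
  have "?d \<in> darts ?F" using j(2) by (simp add: flip_vertex_def)
  from gen_joined[OF f(1) this] have 1: "gen (joined (Br (Br t s) u)) - gen ?F \<in> diagram_relations p"
    by (simp add: f b j(4))
  have "gen ?F + gen ?D \<in> diagram_relations p"
    unfolding diagram_relations_def using j(1,2) r valence_eq[OF j(2)]
    by (intro pm.span_base UnI1[OF UnI2]) force
  from pm.subspace_add[OF subspace_diagram_relations 1 this] show ?thesis by (simp add: add.commute)
qed

lemma joined_ihx:
  assumes "s \<in> monomials p" "t \<in> monomials p" "u \<in> monomials p" "v \<in> monomials p"
  shows "gen (joined (Br (Br (Br s t) u) v)) - (gen (joined (Br (Br s (Br t u)) v))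
    + gen (joined (Br (Br (Br s u) t) v))) \<in> diagram_relations p"
proof -
  let ?D = "joined (Br (Br (Br s t) u) v)" and ?d = "path_dart [True]"
  have m: "Br (Br (Br s t) u) v \<in> monomials p" using assms by (simp add: Br_in_monomials)
  note j = joined_jacobi[OF m] joined_dart[OF m] branch_joined[OF m] branch_joined_opp[OF m]
  interpret tree_diagram ?D using j(1) by (simp add: jacobi_diagrams_iff)
  have r: "rot ?D ?d \<noteq> ?d" using reads_branch[OF j(2)] unfolding j(3) by (auto elim: reads.cases)
  \<comment> \<open>The edge from the vertex of \<open>[[s, t], u]\<close> to that of
    \<open>[s, t]\<close>; the root side of the IHX triple is then \<open>?d\<close>, behind which
    lies \<open>v\<close>.\<close>
  define e where "e = opp ?D (rot ?D ?d)"
  have e: "e \<in> darts ?D" "opp ?D e = rot ?D ?d" using j(2) by (simp_all add: e_def)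
  have b: "branch ?D e = Br s t" "branch ?D (opp ?D (rot ?D (opp ?D e))) = u"
    using branch_node[OF j(2) r] j(2) unfolding j(3) by (simp_all add: e_def)
  have re: "rot ?D e \<noteq> e" using reads_branch[OF e(1)] unfolding b by (auto elim: reads.cases)
  have ro: "rot ?D (opp ?D e) \<noteq> opp ?D e" using r j(2) by (simp add: e(2))
  have b': "branch ?D (opp ?D (rot ?D e)) = s" "branch ?D (opp ?D (rot ?D (rot ?D e))) = t"
    using branch_node[OF e(1) re] unfolding b by simp_all
  have d: "rot ?D (rot ?D (opp ?D e)) = ?d" using j(2) by (simp add: e(2))
  note ihx = ihx_branches[OF j(1) e(1) re ro, unfolded b(2) b' d j(4)]
  define H where "H = ?D\<lparr>rot := cyc3 (cyc3 (rot ?D) (rot ?D (rot ?D e)) (rot ?D (opp ?D e)) e) (rot ?D e) (opp ?D e) ?d\<rparr>"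
  define X where "X = ?D\<lparr>rot := cyc3 (cyc3 (rot ?D) (rot ?D e) (rot ?D (opp ?D e)) e) (opp ?D e) (rot ?D (rot ?D e)) ?d\<rparr>"
  note ihx = ihx[folded H_def X_def]
  have "gen ?D - (gen H + gen X) \<in> diagram_relations p"
    unfolding diagram_relations_def using j(1) ihx(1-3) by (intro pm.span_base UnI2) blast
  moreover have "?d \<in> darts H" "?d \<in> darts X" using j(2) by (simp_all add: H_def X_def)
  from gen_joined[OF ihx(2) this(1)] gen_joined[OF ihx(3) this(2)]
  have "gen (joined (Br (Br s (Br t u)) v)) - gen H \<in> diagram_relations p"
    "gen (joined (Br (Br (Br s u) t) v)) - gen X \<in> diagram_relations p"
    by (simp_all add: ihx)
  ultimately have "(gen ?D - (gen H + gen X)) - (gen (joined (Br (Br s (Br t u)) v)) - gen H)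
      - (gen (joined (Br (Br (Br s u) t) v)) - gen X) \<in> diagram_relations p"
    using pm.subspace_diff[OF subspace_diagram_relations] by blast
  then show ?thesis by (simp add: algebra_simps)
qed

section \<open>Joining linear combinations of trees, and the Lie relations there\<close>

definition join :: "(nat monomial \<Rightarrow>\<^sub>0 'k::field) \<Rightarrow> (nat monomial \<Rightarrow>\<^sub>0 'k) \<Rightarrow> diagram \<Rightarrow>\<^sub>0 'k"
  where "join x y = linear_ext (\<lambda>s. linear_ext (\<lambda>t. gen (joined (Br s t))) y) x"

lemma join_gen [simp]: "join (gen s) (gen t) = gen (joined (Br s t))"
  by (simp add: join_def)

lemma lin_join_left: "lin F \<Longrightarrow> lin (\<lambda>x. join (F x) y)"
  unfolding join_def by (rule lin_linear_ext_comp)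

lemma lin_join_right: "lin F \<Longrightarrow> lin (\<lambda>y. join x (F y))"
  unfolding join_def by (intro lin_linear_ext_fun lin_linear_ext_comp)

lemma trilin_into_subspace:
  assumes "\<And>y z. lin (\<lambda>x. T x y z)" "\<And>x z. lin (\<lambda>y. T x y z)" "\<And>x y. lin (\<lambda>z. T x y z)"
    and "pm.subspace S" "\<And>a b c. a \<in> B \<Longrightarrow> b \<in> B \<Longrightarrow> c \<in> B \<Longrightarrow> T (gen a) (gen b) (gen c) \<in> S"
    and "x \<in> free_on B" "y \<in> free_on B" "z \<in> free_on B"
  shows "T x y z \<in> S"
proof -
  have "T (gen a) (gen b) z \<in> S" if "a \<in> B" "b \<in> B" for a b
    by (rule lin_into_subspace[OF assms(3,4) assms(5)[OF that] assms(8)])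
  then have "T (gen a) y z \<in> S" if "a \<in> B" for a
    using that by (intro lin_into_subspace[OF assms(2,4) _ assms(7)])
  then show ?thesis by (rule lin_into_subspace[OF assms(1,4) _ assms(6)])
qed

lemmas join_lin_intros = lin_intros lin_join_left lin_join_right

lemma join_sym:
  assumes "x \<in> free_on (monomials p)" "y \<in> free_on (monomials p)"
  shows "join x y - join y x \<in> diagram_relations p"
proof -
  have "join (gen s) y - join y (gen s) \<in> diagram_relations p" if "s \<in> monomials p" for s
    by (rule lin_into_subspace[OF _ subspace_diagram_relations _ assms(2), of "\<lambda>y. join (gen s) y - join y (gen s)"])
      (intro join_lin_intros | simp add: joined_sym that)+
  then show ?thesis
    by (intro lin_into_subspace[OF _ subspace_diagram_relations _ assms(1), of "\<lambda>x. join x y - join y x"] join_lin_intros)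
qed

lemma join_assoc:
  assumes "x \<in> free_on (monomials p)" "y \<in> free_on (monomials p)" "z \<in> free_on (monomials p)"
  shows "join (brk x y) z - join x (brk y z) \<in> diagram_relations p"
  by (rule trilin_into_subspace[OF _ _ _ subspace_diagram_relations _ assms,
        of "\<lambda>x y z. join (brk x y) z - join x (brk y z)"])
    (intro join_lin_intros | simp add: joined_assoc)+

lemma join_antisym:
  assumes "x \<in> free_on (monomials p)" "y \<in> free_on (monomials p)" "z \<in> free_on (monomials p)"
  shows "join (brk x y) z + join (brk y x) z \<in> diagram_relations p"
  by (rule trilin_into_subspace[OF _ _ _ subspace_diagram_relations _ assms,
        of "\<lambda>x y z. join (brk x y) z + join (brk y x) z"])
    (intro join_lin_intros | simp add: joined_antisym)+

lemma join_ihx: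
  assumes "x \<in> free_on (monomials p)" "y \<in> free_on (monomials p)" "z \<in> free_on (monomials p)"
    and "w \<in> free_on (monomials p)"
  shows "join (brk (brk x y) z) w - (join (brk x (brk y z)) w + join (brk (brk x z) y) w) \<in> diagram_relations p"
proof (rule lin_into_subspace[OF _ subspace_diagram_relations _ assms(4)])
  fix t assume t: "t \<in> monomials p"
  show "join (brk (brk x y) z) (gen t) - (join (brk x (brk y z)) (gen t) + join (brk (brk x z) y) (gen t))
      \<in> diagram_relations p"
    by (rule trilin_into_subspace[OF _ _ _ subspace_diagram_relations _ assms(1-3),
          of "\<lambda>x y z. join (brk (brk x y) z) (gen t) - (join (brk x (brk y z)) (gen t) + join (brk (brk x z) y) (gen t))"])
      (intro join_lin_intros | simp add: joined_ihx t)+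
qed (intro join_lin_intros)

text \<open>For an ideal element \<open>u\<close> inside a bracket, \<open>join (brk u x) y\<close>
  agrees with \<open>join u (brk x y)\<close>: moving the edge makes \<open>u\<close> a whole branch
  again. The other tree grows, hence \<open>y\<close> varies in the induction.\<close>

lemma join_lie_ideal_left:
  assumes char: "CHAR('k::field) \<noteq> 2"
    and u: "u \<in> (lie_ideal p :: (_ \<Rightarrow>\<^sub>0 'k) set)" and y: "y \<in> free_on (monomials p)"
  shows "join u y \<in> diagram_relations p"
  using u y
proof (induction arbitrary: y rule: lie_ideal.induct)
  case (alternating x)
  then show ?case using subspace_halve[OF subspace_diagram_relations join_antisym char] by blast
next
  case (jacobi x y z w)
  note f = jacobi(1-3) brk_in_free_on
  have 1: "join (brk (brk x y) z) w - (join (brk x (brk y z)) w + join (brk (brk x z) y) w) \<in> diagram_relations p"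
    by (rule join_ihx[OF jacobi])
  have 2: "join (brk (brk x y) z) w + join (brk z (brk x y)) w \<in> diagram_relations p"
    "join (brk (brk x z) y) w + join (brk y (brk x z)) w \<in> diagram_relations p"
    by (intro join_antisym f jacobi(4))+
  have "join (brk y (brk x z + brk z x)) w \<in> diagram_relations p"
  proof -
    \<comment> \<open>Antisymmetry is available for the top bracket of the first tree only; moving
      \<open>y\<close> across the edge brings \<open>[x, z] + [z, x]\<close> there.\<close>
    have "join (brk (brk x z + brk z x) y) w \<in> diagram_relations p"
    proof -
      have "join (brk x z) (brk y w) + join (brk z x) (brk y w) \<in> diagram_relations p"
        by (intro join_antisym f jacobi(4))
      moreover have "join (brk (brk x z + brk z x) y) w - join (brk x z + brk z x) (brk y w) \<in> diagram_relations p"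
        by (intro join_assoc f jacobi(4) pm.subspace_add[OF subspace_free_on])
      ultimately show ?thesis
        using pm.subspace_add[OF subspace_diagram_relations]
        by (fastforce simp: lin_add[OF lin_join_left[OF lin_id]])
    qed
    moreover have "join (brk (brk x z + brk z x) y) w + join (brk y (brk x z + brk z x)) w \<in> diagram_relations p"
      by (intro join_antisym f jacobi(4) pm.subspace_add[OF subspace_free_on])
    ultimately show ?thesis using pm.subspace_diff[OF subspace_diagram_relations] by (metis add_diff_cancel_left')
  qed
  then have 3: "join (brk y (brk x z)) w + join (brk y (brk z x)) w \<in> diagram_relations p"
    by (simp add: lin_add[OF lin_join_left[OF lin_id]] bilinear_ext_simps)
  have "(join (brk (brk x y) z) w + join (brk z (brk x y)) w) - (join (brk (brk x z) y) w + join (brk y (brk x z)) w)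
    + (join (brk y (brk x z)) w + join (brk y (brk z x)) w)
    - (join (brk (brk x y) z) w - (join (brk x (brk y z)) w + join (brk (brk x z) y) w)) \<in> diagram_relations p"
    by (intro pm.subspace_add[OF subspace_diagram_relations] pm.subspace_diff[OF subspace_diagram_relations] 1 2 3)
  then show ?case by (simp add: lin_add[OF lin_join_left[OF lin_id]] algebra_simps)
next
  case (bracket_left u x)
  note u = lie_ideal_in_free_on[OF bracket_left.hyps(1)]
  note xy = brk_in_free_on[OF bracket_left.hyps(2) bracket_left.prems]
  from pm.subspace_diff[OF subspace_diagram_relations pm.subspace_diff[OF subspace_diagram_relations
        join_antisym[OF bracket_left.hyps(2) u bracket_left.prems]
        join_assoc[OF u bracket_left.hyps(2) bracket_left.prems]] bracket_left.IH[OF xy]]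
  show ?case by simp
next
  case (bracket_right u x)
  note u = lie_ideal_in_free_on[OF bracket_right.hyps(1)]
  note xy = brk_in_free_on[OF bracket_right.hyps(2) bracket_right.prems]
  from pm.subspace_add[OF subspace_diagram_relations
      join_assoc[OF u bracket_right.hyps(2) bracket_right.prems] bracket_right.IH[OF xy]]
  show ?case by simp
qed (simp_all add: lin_add[OF lin_join_left[OF lin_id]] lin_scale[OF lin_join_left[OF lin_id]]
    subspace_diagram_relations pm.subspace_add pm.subspace_scale)

lemma join_lie_ideal_right:
  assumes "CHAR('k::field) \<noteq> 2"
    and "u \<in> (lie_ideal p :: (_ \<Rightarrow>\<^sub>0 'k) set)" "y \<in> free_on (monomials p)"
  shows "join y u \<in> diagram_relations p"
  using pm.subspace_add[OF subspace_diagram_relations join_sym[OF assms(3) lie_ideal_in_free_on[OF assms(2)]]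
      join_lie_ideal_left[OF assms]] by simp

text \<open>A single letter goes to 0, in accordance with its being a relation in \<open>H'\<close>:
  a diagram has at least two legs.\<close>

definition caterpillar :: "nat list \<Rightarrow> diagram \<Rightarrow>\<^sub>0 'k::field"
  where "caterpillar w = (if length w \<le> 1 then 0 else gen (joined (Br (comb (butlast w)) (Atom (last w)))))"

abbreviation "caterpillar_lin \<equiv> linear_ext caterpillar"

lemma caterpillar_snoc: "w \<noteq> [] \<Longrightarrow> caterpillar (w @ [b]) = gen (joined (Br (comb w) (Atom b)))"
  by (cases w) (auto simp: caterpillar_def)

lemma caterpillar_lin_conc_letter:
  assumes "x \<in> ASS p"
  shows "caterpillar_lin (x \<odot> gen [b]) = join (comb_lin x) (gen (Atom b))"
proof -
  have "caterpillar_lin (x \<odot> gen [b]) - join (comb_lin x) (gen (Atom b)) \<in> {0}"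
    by (rule lin_into_subspace[OF _ _ _ assms,
          of "\<lambda>x. caterpillar_lin (x \<odot> gen [b]) - join (comb_lin x) (gen (Atom b))"])
      (intro join_lin_intros pm.subspace_single_0 | simp add: words_def caterpillar_snoc)+
  then show ?thesis by simp
qed

text \<open>The tree behind the edge is taken apart from its root. For \<open>[s, t]\<close> the
  antipode moves \<open>commutator t\<close> next to \<open>x\<close> with a sign, while in the
  diagram the edge crosses the vertex, so that \<open>[x, t]\<close> is joined to
  \<open>s\<close>.\<close>

lemma caterpillar_lin_glue:
  fixes x :: "nat list \<Rightarrow>\<^sub>0 'k::field"
  assumes char: "CHAR('k) \<noteq> 2" and "t \<in> monomials p" "x \<in> ASS p"
  shows "caterpillar_lin (- (x \<odot> antipode_lin (unbracket t))) - join (comb_lin x) (gen t) \<in> diagram_relations p"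
  using assms(2,3)
proof (induction t arbitrary: x)
  case (Atom b)
  then show ?case
    by (simp add: antipode_def bilinear_ext_simps caterpillar_lin_conc_letter subspace_diagram_relations pm.subspace_0)
next
  case (Br s t)
  then have st: "s \<in> monomials p" "t \<in> monomials p" by (auto simp: Br_in_monomials)
  let ?y = "x \<odot> commutator t" and ?c = "comb_lin x"
  have y: "?y \<in> ASS p" using Br.prems(2) st by (intro conc_in_ASS commutator_in_ASS)
  have c: "?c \<in> free_on (monomials p)" using Br.prems(2) by (rule comb_lin_in)
  have 1: "caterpillar_lin (- (?y \<odot> antipode_lin (unbracket s))) - join (comb_lin ?y) (gen s) \<in> diagram_relations p"
    by (rule Br.IH(1)[OF st(1) y])
  have "join (comb_lin ?y - brk ?c (gen t)) (gen s) \<in> diagram_relations p"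
    using st Br.prems(2) by (intro join_lie_ideal_left char comb_lin_conc_commutator) auto
  then have 2: "join (comb_lin ?y) (gen s) - join (brk ?c (gen t)) (gen s) \<in> diagram_relations p"
    by (simp add: lin_diff[OF lin_join_left[OF lin_id]])
  have 3: "join (brk ?c (gen t)) (gen s) - join ?c (brk (gen t) (gen s)) \<in> diagram_relations p"
    using st c by (intro join_assoc) auto
  have "join ?c (brk (gen t) (gen s) + brk (gen s) (gen t)) \<in> diagram_relations p"
    using st c by (intro join_lie_ideal_right char lie_ideal_antisym) auto
  then have 4: "join ?c (gen (Br t s)) + join ?c (gen (Br s t)) \<in> diagram_relations p"
    by (simp add: lin_add[OF lin_join_right[OF lin_id]])
  note t = subspace_trans[OF subspace_diagram_relations]
  have "- (caterpillar_lin (- (?y \<odot> antipode_lin (unbracket s))) - join ?c (gen (Br t s)))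
      - (join ?c (gen (Br t s)) + join ?c (gen (Br s t))) \<in> diagram_relations p"
    by (rule pm.subspace_diff[OF subspace_diagram_relations
          pm.subspace_neg[OF subspace_diagram_relations t[OF 1 t[OF 2 3[unfolded bilinear_ext_gen]]]] 4])
  then show ?case
    by (simp add: antipode_lin_conc antipode_commutator bilinear_ext_simps linear_ext_simps conc_assoc)
qed

text \<open>Reversal turns the last edge around; a generator of \<open>H_l\<close> followed by a
  letter gives an element of the Lie ideal joined to a leg.\<close>

lemma caterpillar_lin_H':
  assumes char: "CHAR('k::field) \<noteq> 2" and x: "x \<in> (H' p :: (_ \<Rightarrow>\<^sub>0 'k) set)"
  shows "caterpillar_lin x \<in> diagram_relations p"
  using x lin_linear_ext subspace_diagram_relations
proof (rule H'_induct)
  fix a show "caterpillar_lin (gen [a]) \<in> (diagram_relations p :: (_ \<Rightarrow>\<^sub>0 'k) set)"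
    by (simp add: caterpillar_def subspace_diagram_relations pm.subspace_0)
next
  fix w :: "nat list" assume w: "w \<in> words p" "2 \<le> length w"
  then obtain u b where ub: "w = u @ [b]" "u \<noteq> []" by (cases w rule: rev_cases) (auto simp: Suc_le_eq)
  then have u: "u \<in> words p" and b: "b \<in> {1..p}" using w by (auto simp: words_def)
  have "antipode w = antipode_lin (gen u \<odot> gen [b] :: _ \<Rightarrow>\<^sub>0 'k)" by (simp add: ub)
  \<comment> \<open>The reversed word begins with \<open>b\<close>, so it is the word of the
    one-letter tree glued to \<open>comb u\<close>.\<close>
  also have "\<dots> = - (gen [b] \<odot> antipode_lin (unbracket (comb u)))"
    unfolding antipode_lin_conc using ub by (simp add: unbracket_comb antipode_def bilinear_ext_simps)
  finally have "caterpillar_lin (antipode w) - join (gen (Atom b)) (gen (comb u)) \<in> (diagram_relations p :: (_ \<Rightarrow>\<^sub>0 'k) set)"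
    using caterpillar_lin_glue[OF char comb_in_monomials[OF u], of "gen [b]"] b by (simp add: words_def)
  moreover have "join (gen (Atom b)) (gen (comb u)) - join (gen (comb u)) (gen (Atom b)) \<in> (diagram_relations p :: (_ \<Rightarrow>\<^sub>0 'k) set)"
    using b comb_in_monomials[OF u] by (intro join_sym) (auto simp: monomials_def)
  moreover have "caterpillar_lin (gen w) = (join (gen (comb u)) (gen (Atom b)) :: _ \<Rightarrow>\<^sub>0 'k)"
    using ub by (simp add: caterpillar_snoc)
  ultimately show "caterpillar_lin (antipode w) - caterpillar_lin (gen w) \<in> (diagram_relations p :: (_ \<Rightarrow>\<^sub>0 'k) set)"
    using subspace_trans[OF subspace_diagram_relations] by metis
next
  fix h :: "nat list \<Rightarrow>\<^sub>0 'k" and b assume h: "h \<in> H_l p" "b \<in> {1..p}"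
  then show "caterpillar_lin (h \<odot> gen [b]) \<in> diagram_relations p"
    unfolding caterpillar_lin_conc_letter[OF H_l_in_ASS[OF h(1)]]
    by (intro join_lie_ideal_left char comb_lin_H_l) (auto simp: monomials_def)
qed

lemma caterpillar_diagram_word:
  assumes char: "CHAR('k::field) \<noteq> 2" and D: "D \<in> jacobi_diagrams p"
  shows "caterpillar_lin (diagram_word D) - gen D \<in> (diagram_relations p :: (_ \<Rightarrow>\<^sub>0 'k) set)"
proof -
  define d where "d = (SOME x. x \<in> darts D)"
  have d: "d \<in> darts D" using jacobi_dart[OF D] by (simp add: d_def)
  define s t where "s = branch D d" and "t = branch D (opp D d)"
  have st: "s \<in> monomials p" "t \<in> monomials p"
    using branch_in_monomials[OF D d] branch_opp_in_monomials[OF D d] by (simp_all add: s_def t_def)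
  have w: "diagram_word D = - (unbracket s \<odot> antipode_lin (unbracket t) :: _ \<Rightarrow>\<^sub>0 'k)"
    by (simp add: diagram_word_def edge_word_def glue_def s_def t_def d_def)
  have 1: "caterpillar_lin (diagram_word D) - join (comb_lin (unbracket s)) (gen t) \<in> (diagram_relations p :: (_ \<Rightarrow>\<^sub>0 'k) set)"
    unfolding w by (rule caterpillar_lin_glue[OF char st(2) unbracket_in_ASS[OF st(1)]])
  have "join (comb_lin (unbracket s) - gen s) (gen t) \<in> (diagram_relations p :: (_ \<Rightarrow>\<^sub>0 'k) set)"
    using st by (intro join_lie_ideal_left char comb_unbracket) auto
  then have 2: "join (comb_lin (unbracket s)) (gen t) - gen (joined (Br s t)) \<in> (diagram_relations p :: (_ \<Rightarrow>\<^sub>0 'k) set)"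
    by (simp add: lin_diff[OF lin_join_left[OF lin_id]])
  have 3: "gen (joined (Br s t)) - gen D \<in> (diagram_relations p :: (_ \<Rightarrow>\<^sub>0 'k) set)"
    unfolding s_def t_def by (rule gen_joined[OF D d])
  note t = subspace_trans[OF subspace_diagram_relations]
  show ?thesis by (rule t[OF 1 t[OF 2 3]])
qed

text \<open>Read at its last edge, the caterpillar of \<open>w\<close> gives back \<open>w\<close>
  itself. For a single letter the caterpillar is 0, and the letter is a relation.\<close>

lemma diagram_word_caterpillar:
  assumes char: "CHAR('k::field) \<noteq> 2" and w: "w \<in> words p"
  shows "diagram_word_lin (caterpillar w) - gen w \<in> (H' p :: (_ \<Rightarrow>\<^sub>0 'k) set)"
proof -
  obtain u b where ub: "w = u @ [b]" using w by (cases w rule: rev_cases) (auto simp: words_def)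
  then have b: "b \<in> {1..p}" using w by (simp add: words_def)
  show ?thesis
  proof (cases "u = []")
    case True
    then show ?thesis using pm.subspace_neg[OF subspace_H' letter_in_H'[OF b]]
      by (simp add: ub caterpillar_def linear_ext_simps)
  next
    case False
    then have u: "u \<in> words p" using w by (auto simp: ub words_def)
    have m: "Br (comb u) (Atom b) \<in> monomials p"
      using comb_in_monomials[OF u] b by (simp add: monomials_def)
    from diagram_word_eq[OF char joined_jacobi[OF m] joined_dart[OF m]]
    show ?thesis
      using False by (simp add: ub caterpillar_snoc edge_word_def branch_joined[OF m] branch_joined_opp[OF m] glue_comb_letter)
  qed
qed

lemma caterpillar_graded:
  assumes "w \<in> words p"
  shows "caterpillar w \<in> free_on {D \<in> jacobi_diagrams p. card (legs D) = length w}"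
proof -
  obtain u b where ub: "w = u @ [b]" using assms by (cases w rule: rev_cases) (auto simp: words_def)
  show ?thesis
  proof (cases "u = []")
    case True
    then show ?thesis by (simp add: ub caterpillar_def pm.subspace_0[OF subspace_free_on])
  next
    case False
    then have u: "u \<in> words p" and b: "b \<in> {1..p}" using assms by (auto simp: ub words_def)
    have "Br (comb u) (Atom b) \<in> monomials p"
      using comb_in_monomials[OF u] b by (simp add: monomials_def)
    then show ?thesis using False comb_graded[OF u] joined_jacobi
      by (simp add: ub caterpillar_snoc card_legs_joined)
  qed
qed

theorem jacobi_diagrams_iso_words:
  fixes p :: nat
  assumes "CHAR('k::field) \<noteq> 2"
  shows "\<exists>\<phi> :: (diagram \<Rightarrow>\<^sub>0 'k) set \<Rightarrow> (nat list \<Rightarrow>\<^sub>0 'k) set.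
    quot_linear_iso (free_on (jacobi_diagrams p)) (diagram_relations p) (ASS p) (H' p) \<phi> \<and>
    (\<forall>n. \<phi> ` quot (free_on {D \<in> jacobi_diagrams p. card (legs D) = n}) (diagram_relations p)
       = quot (free_on {w \<in> words p. length w = n}) (H' p))"
proof -
  let ?F = "diagram_word_lin :: (diagram \<Rightarrow>\<^sub>0 'k) \<Rightarrow> _" and ?G = "caterpillar_lin :: (nat list \<Rightarrow>\<^sub>0 'k) \<Rightarrow> _"
  have GF: "?G (?F x) - x \<in> diagram_relations p" if "x \<in> free_on (jacobi_diagrams p)" for x
    by (rule lin_into_subspace[OF _ subspace_diagram_relations _ that, of "\<lambda>x. ?G (?F x) - x"])
      (intro lin_intros | simp add: caterpillar_diagram_word[OF assms])+
  have FG: "?F (?G y) - y \<in> H' p" if "y \<in> ASS p" for y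
    by (rule lin_into_subspace[OF _ subspace_H' _ that, of "\<lambda>y. ?F (?G y) - y"])
      (intro lin_intros | simp add: diagram_word_caterpillar[OF assms])+
  have F_graded: "?F ` free_on {D \<in> jacobi_diagrams p. card (legs D) = n} \<subseteq> free_on {w \<in> words p. length w = n}" for n
    by (auto intro!: linear_ext_in_free_on[of "{D \<in> jacobi_diagrams p. card (legs D) = n}" diagram_word] diagram_word_graded)
  have G_graded: "?G ` free_on {w \<in> words p. length w = n} \<subseteq> free_on {D \<in> jacobi_diagrams p. card (legs D) = n}" for n
    by (auto intro!: linear_ext_in_free_on[of "{w \<in> words p. length w = n}" caterpillar] caterpillar_graded)
  have "?F x \<in> ASS p" if "x \<in> free_on (jacobi_diagrams p)" for x
    by (rule linear_ext_in_free_on[OF _ that]) (rule graded_in_ASS, erule diagram_word_graded)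
  moreover have "?G y \<in> free_on (jacobi_diagrams p)" if "y \<in> ASS p" for y
    by (rule linear_ext_in_free_on[OF _ that]) (use caterpillar_graded in \<open>force simp: free_on_def\<close>)
  ultimately have "?F ` free_on (jacobi_diagrams p) \<subseteq> ASS p" "?F ` diagram_relations p \<subseteq> H' p"
    "?G ` ASS p \<subseteq> free_on (jacobi_diagrams p)" "?G ` H' p \<subseteq> diagram_relations p"
    by (auto simp: diagram_word_lin_relations[OF assms] caterpillar_lin_H'[OF assms])
  note iso = quot_linear_isoI[OF lin_linear_ext this(1,2) lin_linear_ext this(3,4)
      subspace_free_on subspace_free_on subspace_diagram_relations subspace_H' GF FG]
  have "(\<lambda>X. ?F ` X + H' p) ` quot (free_on {D \<in> jacobi_diagrams p. card (legs D) = n}) (diagram_relations p)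
       = quot (free_on {w \<in> words p. length w = n}) (H' p)" for n
    by (rule iso(2)[OF _ _ _ _ F_graded G_graded]) (auto intro!: free_on_mono)
  with iso(1) show ?thesis by blast
qed

theorem mainTheorem1:
  fixes p :: nat
  assumes "CHAR('k::field) \<noteq> 2"
  shows "(\<exists>\<phi> :: (diagram \<Rightarrow>\<^sub>0 'k) set \<Rightarrow> (nat list \<Rightarrow>\<^sub>0 'k) set.
            quot_linear_iso (free_on (jacobi_diagrams p)) (diagram_relations p) (ASS p) (H' p) \<phi> \<and>
            (\<forall>n. \<phi> ` quot (free_on {D \<in> jacobi_diagrams p. card (legs D) = n}) (diagram_relations p)
               = quot (free_on {w \<in> words p. length w = n}) (H' p)))
       \<and> (\<exists>\<psi> :: (nat monomial \<Rightarrow>\<^sub>0 'k) set \<Rightarrow> (nat list \<Rightarrow>\<^sub>0 'k) set.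
            quot_linear_iso (free_on (monomials p)) (lie_ideal p) (ASS p) (H_l p) \<psi> \<and>
            (\<forall>n. \<psi> ` quot (free_on {t \<in> monomials p. degree_mono t = n}) (lie_ideal p)
               = quot (free_on {w \<in> words p. length w = n}) (H_l p)))"
  using jacobi_diagrams_iso_words[OF assms, of p] lie_algebra_iso_words[OF assms, of p] by (rule conjI)

end
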